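(* As $n\to\infty$, $$Rt_3(D_{2,3};K_n)=\left(\frac{7}{78}+o(1)\right)n .$$
   Context: $D_{2,3}$ is the double star (a tree on $7$ vertices) whose two centres are adjacent, with two leaves attached to one centre and three leaves attached to the other. For an edge-colouring $\chi:E(K_n)\to[r]$ and a graph $H$, let $\nu_H(\chi)$ be the maximum over colours $\ell\in[r]$ of the maximum number of vertex-disjoint copies of $H$ all of whose edges have colour $\ell$. Then $Rt_r(H;K_n):=\min_{\chi:E(K_n)\to[r]}\nu_H(\chi)$. *)

theory Defs
  imports Complex_Main "HOL-Library.FuncSet" "HOL-Library.Landau_Symbols"
begin

text \<open>Simple graphs are pairs of a vertex set and a set of two-element subsets of it.\<close>

type_synonym 'a sgraph = "'a set \<times> 'a set set"

abbreviation verts :: "'a sgraph \<Rightarrow> 'a set" where "verts \<equiv> fst"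
abbreviation edges :: "'a sgraph \<Rightarrow> 'a set set" where "edges \<equiv> snd"

definition complete_graph :: "nat \<Rightarrow> nat sgraph" where
  "complete_graph n = ({..<n}, {e. e \<subseteq> {..<n} \<and> card e = 2})"

text \<open>The centres are \<open>0\<close> (with \<open>a\<close> leaves) and \<open>1\<close> (with \<open>b\<close> leaves).\<close>

definition double_star :: "nat \<Rightarrow> nat \<Rightarrow> nat sgraph" where
  "double_star a b =
     ({..<2 + a + b},
      {{0, 1}} \<union> {{0, i} | i. i \<in> {2..<2 + a}} \<union> {{1, j} | j. j \<in> {2 + a..<2 + a + b}})"

definition graph_isomorphic :: "'a sgraph \<Rightarrow> 'b sgraph \<Rightarrow> bool" where
  "graph_isomorphic H G \<longleftrightarrow>
     (\<exists>f. bij_betw f (verts H) (verts G) \<and> edges G = (\<lambda>e. f ` e) ` edges H)"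

text \<open>Copies of \<open>H\<close> are not necessarily induced subgraphs.\<close>

definition copies :: "'a sgraph \<Rightarrow> 'b sgraph \<Rightarrow> 'b sgraph set" where
  "copies H G = {C. verts C \<subseteq> verts G \<and> edges C \<subseteq> edges G \<and> graph_isomorphic H C}"

definition packings :: "'a sgraph \<Rightarrow> 'b sgraph \<Rightarrow> 'b sgraph set set" where
  "packings H G =
     {P. P \<subseteq> copies H G \<and> pairwise (\<lambda>C D. verts C \<inter> verts D = {}) P}"

definition packing_number :: "'a sgraph \<Rightarrow> 'b sgraph \<Rightarrow> nat" where
  "packing_number H G = Max (card ` packings H G)"

definition colour_class :: "'b sgraph \<Rightarrow> ('b set \<Rightarrow> nat) \<Rightarrow> nat \<Rightarrow> 'b sgraph" where
  "colour_class G \<chi> l = (verts G, {e \<in> edges G. \<chi> e = l})"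

definition mono_packing_number ::
    "nat \<Rightarrow> 'a sgraph \<Rightarrow> 'b sgraph \<Rightarrow> ('b set \<Rightarrow> nat) \<Rightarrow> nat" where
  "mono_packing_number r H G \<chi> =
     Max ((\<lambda>l. packing_number H (colour_class G \<chi> l)) ` {1..r})"

text \<open>Colourings are extensional functions, so that there are only finitely many of them.\<close>

definition Rt :: "nat \<Rightarrow> 'a sgraph \<Rightarrow> 'b sgraph \<Rightarrow> nat" where
  "Rt r H G = Min (mono_packing_number r H G ` (edges G \<rightarrow>\<^sub>E {1..r}))"

text \<open>The sets whose maximum or minimum is taken above are finite and nonempty.\<close>

lemma finite_packings:
  assumes "finite (verts G)" "finite (edges G)"
  shows "finite (packings H G)"
proof -
  have "copies H G \<subseteq> Pow (verts G) \<times> Pow (edges G)"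
    by (auto simp: copies_def)
  then have "finite (copies H G)"
    by (rule finite_subset) (use assms in auto)
  moreover have "packings H G \<subseteq> Pow (copies H G)"
    by (auto simp: packings_def)
  ultimately show ?thesis
    by (meson finite_Pow_iff finite_subset)
qed

lemma empty_in_packings: "{} \<in> packings H G"
  by (simp add: packings_def)

lemma finite_complete_graph:
  "finite (verts (complete_graph n))" "finite (edges (complete_graph n))"
  by (auto simp: complete_graph_def intro: finite_subset[of _ "Pow {..<n}"])

lemma finite_colourings:
  "finite (edges (complete_graph n) \<rightarrow>\<^sub>E {1..r :: nat})"
  by (intro finite_PiE finite_complete_graph) simp

lemma colourings_nonempty:
  assumes "(r :: nat) \<ge> 1"
  shows "edges (complete_graph n) \<rightarrow>\<^sub>E {1..r} \<noteq> {}"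
  using assms by (auto simp: PiE_eq_empty_iff)

end

theory Submission
  imports Defs "HOL-Library.Ramsey"
begin

text \<open>
Write \<open>D\<close> for the double star with two and three leaves.

\<^bold>\<open>Upper bound.\<close> Split the vertices into parts \<open>Y\<close>,
\<open>X\<close>, \<open>B\<close> in the proportions \<open>21 : 8 : 49\<close>. Colour 1 joins
\<open>Y\<close> to the other parts, colour 2 is used inside \<open>Y\<close> and on the remaining
edges that meet \<open>X\<close>, and colour 3 is used inside \<open>B\<close>. A copy of
\<open>D\<close> in colour 1 is bipartite between \<open>Y\<close> and the rest, so it has at
least three vertices in \<open>Y\<close>; a copy in colour 2 lies in \<open>Y\<close> or contains
two vertices of \<open>X\<close>; a copy in colour 3 lies in \<open>B\<close>. The packing numbers
are at most \<open>|Y|/3\<close>, \<open>|X|/2 + |Y|/7\<close> and \<open>|B|/7\<close>, and all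
three are about \<open>7n/78\<close> (lemma \<open>Rt_upper\<close>).

\<^bold>\<open>Lower bound.\<close> Let a colouring be given. The vertex set is split into
boundedly many clusters so that nearly every pair of clusters is \<^emph>\<open>rich\<close> in
some colour: that colour occurs between any two subsets that are not too small
(\<open>hole_regularity\<close>). Since \<open>D\<close> consists of two adjacent centres with
leaves, rich pairs are all that is needed to place a copy greedily, so every fractional packing of
\<open>D\<close> in the reduced graph of a colour can be realised by disjoint copies
(\<open>fractional_packing\<close>). If the packing number of colour \<open>c\<close> is small,
linear programming duality therefore gives a cheap weight function \<open>w c\<close> on the
clusters that is a cover: \<open>w c u + w c v + 2 w c a + 3 w c b \<ge> 1\<close> whenever
\<open>uv\<close>, \<open>ua\<close>, \<open>vb\<close> are rich in colour \<open>c\<close>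
(\<open>colour_weights\<close>).

It remains to see that three covers cannot all be cheap. Clusters are grouped by their rounded
weights in the three colours. By a Caratheodory argument three groups, with suitable masses,
already have costs in all colours that are as small as in the whole graph
(\<open>three_points_suffice\<close>), and Ramsey's theorem makes these groups homogeneous: each
group gets a colour on the pairs inside it, and each pair of groups gets a colour
(\<open>homogeneous_types\<close>). What is left is a three-coloured triangle with coloured loops
and masses on its vertices. Its finitely many colourings are treated by explicit fractional
packings, and in each of them some colour costs at least \<open>7/78\<close> of the total mass
(\<open>three_types\<close>).
\<close>

section \<open>Linear programming duality\<close>

text \<open>Linear functionals on the vector space of all real functions, given by a single equation. This
avoids a vector space type for functions.\<close>

definition linear_form :: "(('a \<Rightarrow> real) \<Rightarrow> real) \<Rightarrow> bool" where
  "linear_form \<alpha> \<longleftrightarrow> (\<forall>x z r. \<alpha> (\<lambda>j. x j + r * z j) = \<alpha> x + r * \<alpha> z)"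

lemma linear_formD: "linear_form \<alpha> \<Longrightarrow> \<alpha> (\<lambda>j. x j + r * z j) = \<alpha> x + r * \<alpha> z"
  by (auto simp: linear_form_def)

lemma linear_form_scale:
  assumes "linear_form \<alpha>" shows "\<alpha> (\<lambda>j. r * z j) = r * \<alpha> z"
proof -
  have "\<alpha> (\<lambda>j. 0) = 0"
    using linear_formD[OF assms, of "\<lambda>_. 0" 1 "\<lambda>_. 0"] by simp
  then show ?thesis
    using linear_formD[OF assms, of "\<lambda>_. 0" r z] by simp
qed

text \<open>Farkas' lemma by induction on the number of functionals, following Bartl. If \<open>\<gamma> \<le>
0\<close> does not follow without the functional \<open>\<alpha> k\<close>, there is a point
\<open>z\<close> with \<open>\<alpha> k z = 1\<close> at which the others are nonpositive and
\<open>\<gamma>\<close> is positive. Projecting along \<open>z\<close> to the kernel of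
\<open>\<alpha> k\<close> removes \<open>\<alpha> k\<close> from the hypothesis, and the
multiplier of \<open>\<alpha> k\<close> is recovered from the values at \<open>z\<close>.\<close>

lemma farkas:
  fixes \<alpha> :: "'i \<Rightarrow> ('a \<Rightarrow> real) \<Rightarrow> real"
  assumes "finite I" "\<forall>i\<in>I. linear_form (\<alpha> i)" "linear_form \<gamma>"
    and "\<forall>x. (\<forall>i\<in>I. \<alpha> i x \<le> 0) \<longrightarrow> \<gamma> x \<le> 0"
  shows "\<exists>l. (\<forall>i\<in>I. l i \<ge> (0::real)) \<and> (\<forall>x. \<gamma> x = (\<Sum>i\<in>I. l i * \<alpha> i x))"
  using assms
proof (induction I arbitrary: \<alpha> \<gamma> rule: finite_induct)
  case empty
  have "\<gamma> x = 0" for x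
  proof -
    have "\<gamma> x \<le> 0" using empty by auto
    moreover have "\<gamma> (\<lambda>j. (-1) * x j) \<le> 0" using empty(3) by blast
    ultimately show ?thesis using linear_form_scale[OF empty(2), of "-1" x] by simp
  qed
  then show ?case by auto
next
  case (insert k I)
  show ?case
  proof (cases "\<forall>x. (\<forall>i\<in>I. \<alpha> i x \<le> 0) \<longrightarrow> \<gamma> x \<le> 0")
    case True
    then obtain l where l: "\<forall>i\<in>I. l i \<ge> (0::real)" "\<forall>x. \<gamma> x = (\<Sum>i\<in>I. l i * \<alpha> i x)"
      using insert.IH[of \<alpha> \<gamma>] insert.prems by auto
    have "(\<Sum>i\<in>I. l i * \<alpha> i x) = (\<Sum>i\<in>I. (l(k := 0)) i * \<alpha> i x)" for x
      by (rule sum.cong) (use insert.hyps in auto)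
    then have "\<forall>x. \<gamma> x = (\<Sum>i\<in>insert k I. (l(k := 0)) i * \<alpha> i x)"
      using insert.hyps l by simp
    then show ?thesis using l(1) by (intro exI[of _ "l(k := 0)"]) auto
  next
    case False
    then obtain y where y: "\<forall>i\<in>I. \<alpha> i y \<le> 0" "\<gamma> y > 0" by force
    have ak: "linear_form (\<alpha> k)" using insert.prems by auto
    have kpos: "\<alpha> k y > 0"
      using insert.prems(3)[rule_format, of y] y by force
    \<comment> \<open>normalised so that \<open>\<alpha> k z = 1\<close>\<close>
    define z where "z = (\<lambda>j. (1 / \<alpha> k y) * y j)"
    have zk: "\<alpha> k z = 1"
      unfolding z_def linear_form_scale[OF ak] using kpos by simp
    have zi: "\<forall>i\<in>I. \<alpha> i z \<le> 0"
    proof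
      fix i assume "i \<in> I"
      then have "\<alpha> i z = 1 / \<alpha> k y * \<alpha> i y"
        unfolding z_def using insert.prems(1) by (intro linear_form_scale) auto
      then show "\<alpha> i z \<le> 0"
        using y(1) kpos \<open>i \<in> I\<close> by (simp add: divide_nonpos_pos)
    qed
    have zg: "\<gamma> z > 0"
      unfolding z_def linear_form_scale[OF insert.prems(2)] using y kpos by simp
    define P where "P = (\<lambda>x j. x j + (- \<alpha> k x) * z j)"
    have P: "f (P x) = f x - \<alpha> k x * f z" if "linear_form f" for f x
      using linear_formD[OF that, of x "- \<alpha> k x" z] by (simp add: P_def)
    have lin: "linear_form (\<lambda>x. f (P x))" if "linear_form f" for f
      unfolding P[OF that] using that ak by (auto simp: linear_form_def algebra_simps)
    have "\<exists>l. (\<forall>i\<in>I. l i \<ge> (0::real)) \<and> (\<forall>x. \<gamma> (P x) = (\<Sum>i\<in>I. l i * \<alpha> i (P x)))"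
    proof (rule insert.IH)
      show "\<forall>i\<in>I. linear_form (\<lambda>x. \<alpha> i (P x))" using lin insert.prems(1) by auto
      show "linear_form (\<lambda>x. \<gamma> (P x))" using lin insert.prems(2) by auto
      show "\<forall>x. (\<forall>i\<in>I. \<alpha> i (P x) \<le> 0) \<longrightarrow> \<gamma> (P x) \<le> 0"
        using insert.prems(3) P[OF ak] zk by simp
    qed
    then obtain l where l: "\<forall>i\<in>I. l i \<ge> (0::real)"
      "\<And>x. \<gamma> (P x) = (\<Sum>i\<in>I. l i * \<alpha> i (P x))" by auto
    \<comment> \<open>the multiplier of \<open>\<alpha> k\<close>\<close>
    define c where "c = \<gamma> z - (\<Sum>i\<in>I. l i * \<alpha> i z)"
    have "c \<ge> 0"
      using zg zi l(1) sum_nonpos[of I "\<lambda>i. l i * \<alpha> i z"]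
      by (simp add: c_def mult_nonneg_nonpos)
    have eq: "\<gamma> x = (\<Sum>i\<in>I. l i * \<alpha> i x) + c * \<alpha> k x" for x
    proof -
      have "\<gamma> x - \<alpha> k x * \<gamma> z = (\<Sum>i\<in>I. l i * \<alpha> i (P x))"
        using l(2)[of x] P[OF insert.prems(2)] by simp
      also have "\<dots> = (\<Sum>i\<in>I. l i * \<alpha> i x - \<alpha> k x * (l i * \<alpha> i z))"
        proof (rule sum.cong)
        fix i assume "i \<in> I"
        then have e: "\<alpha> i (P x) = \<alpha> i x - \<alpha> k x * \<alpha> i z" using P insert.prems(1) by blast
        then show "l i * \<alpha> i (P x) = l i * \<alpha> i x - \<alpha> k x * (l i * \<alpha> i z)"
          unfolding e by (simp add: algebra_simps)
      qed simp
      also have "\<dots> = (\<Sum>i\<in>I. l i * \<alpha> i x) - \<alpha> k x * (\<Sum>i\<in>I. l i * \<alpha> i z)"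
        by (simp add: sum_subtractf sum_distrib_left)
      finally show ?thesis by (simp add: c_def algebra_simps)
    qed
    have "(\<Sum>i\<in>I. l i * \<alpha> i x) = (\<Sum>i\<in>I. (l(k := c)) i * \<alpha> i x)" for x
      by (rule sum.cong) (use insert.hyps in auto)
    then have "\<forall>x. \<gamma> x = (\<Sum>i\<in>insert k I. (l(k := c)) i * \<alpha> i x)"
      using insert.hyps eq by simp
    then show ?thesis using l(1) \<open>c \<ge> 0\<close> by (intro exI[of _ "l(k := c)"]) auto
  qed
qed

text \<open>Farkas' lemma is applied to the homogenised system in the variables \<open>y \<tau>\<close> and
one scaling variable, which is the coordinate \<open>None\<close>. The multipliers of the load
constraints form the cover.\<close>

lemma packing_covering_duality:
  fixes a :: "'t \<Rightarrow> 'q \<Rightarrow> real" and x :: "'q \<Rightarrow> real"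
  assumes fin: "finite T" "finite Q"
    and a: "\<forall>\<tau>\<in>T. \<forall>q\<in>Q. a \<tau> q \<ge> 0" "\<forall>\<tau>\<in>T. \<exists>q\<in>Q. a \<tau> q > 0"
    and primal: "\<And>y. (\<forall>\<tau>\<in>T. y \<tau> \<ge> 0) \<Longrightarrow> (\<forall>q\<in>Q. (\<Sum>\<tau>\<in>T. y \<tau> * a \<tau> q) \<le> x q) \<Longrightarrow> (\<Sum>\<tau>\<in>T. y \<tau>) \<le> t"
  shows "\<exists>w. (\<forall>q\<in>Q. w q \<ge> 0) \<and> (\<forall>\<tau>\<in>T. (\<Sum>q\<in>Q. w q * a \<tau> q) \<ge> 1) \<and> (\<Sum>q\<in>Q. w q * x q) \<le> t"
proof -
  define I :: "('q + 't option) set" where "I = Inl ` Q \<union> Inr ` (Some ` T \<union> {None})"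
  define \<alpha> :: "('q + 't option) \<Rightarrow> ('t option \<Rightarrow> real) \<Rightarrow> real" where
    "\<alpha> i z = (case i of Inl q \<Rightarrow> (\<Sum>\<tau>\<in>T. z (Some \<tau>) * a \<tau> q) - z None * x q | Inr s \<Rightarrow> - z s)" for i z
  define \<gamma> :: "('t option \<Rightarrow> real) \<Rightarrow> real" where "\<gamma> z = (\<Sum>\<tau>\<in>T. z (Some \<tau>)) - t * z None" for z
  have "\<exists>l. (\<forall>i\<in>I. l i \<ge> (0::real)) \<and> (\<forall>z. \<gamma> z = (\<Sum>i\<in>I. l i * \<alpha> i z))"
  proof (rule farkas)
    show "finite I" using fin by (simp add: I_def)
    show "\<forall>i\<in>I. linear_form (\<alpha> i)"
      by (auto simp: linear_form_def \<alpha>_def algebra_simps sum.distrib sum_distrib_left split: sum.split)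
    show "linear_form \<gamma>"
      by (auto simp: linear_form_def \<gamma>_def algebra_simps sum.distrib sum_distrib_left)
    show "\<forall>z. (\<forall>i\<in>I. \<alpha> i z \<le> 0) \<longrightarrow> \<gamma> z \<le> 0"
    proof (intro allI impI)
      fix z assume z: "\<forall>i\<in>I. \<alpha> i z \<le> 0"
      have zQ: "(\<Sum>\<tau>\<in>T. z (Some \<tau>) * a \<tau> q) \<le> z None * x q" if "q \<in> Q" for q
        using bspec[OF z, of "Inl q"] that by (simp add: I_def \<alpha>_def)
      have zT: "z (Some \<tau>) \<ge> 0" if "\<tau> \<in> T" for \<tau>
        using bspec[OF z, of "Inr (Some \<tau>)"] that by (simp add: I_def \<alpha>_def)
      have z0: "z None \<ge> 0"
        using bspec[OF z, of "Inr None"] by (simp add: I_def \<alpha>_def)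
      show "\<gamma> z \<le> 0"
      proof (cases "z None = 0")
        case True
        have "z (Some \<tau>) = 0" if \<tau>: "\<tau> \<in> T" for \<tau>
        proof -
          obtain q where q: "q \<in> Q" "a \<tau> q > 0" using a(2) \<tau> by blast
          have "z (Some \<tau>) * a \<tau> q \<le> (\<Sum>\<tau>\<in>T. z (Some \<tau>) * a \<tau> q)"
            by (rule member_le_sum) (use \<tau> fin a(1) q zT in auto)
          then have "z (Some \<tau>) * a \<tau> q \<le> 0" using zQ[OF q(1)] True by simp
          then show ?thesis using q(2) zT[OF \<tau>] by (simp add: mult_le_0_iff)
        qed
        then show ?thesis using True by (simp add: \<gamma>_def)
      next
        case False
        then have pos: "z None > 0" using z0 by simp
        have "(\<Sum>\<tau>\<in>T. z (Some \<tau>) / z None) \<le> t"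
        proof (rule primal)
          show "\<forall>\<tau>\<in>T. z (Some \<tau>) / z None \<ge> 0" using zT pos by simp
          show "\<forall>q\<in>Q. (\<Sum>\<tau>\<in>T. z (Some \<tau>) / z None * a \<tau> q) \<le> x q"
          proof
            fix q assume "q \<in> Q"
            have "(\<Sum>\<tau>\<in>T. z (Some \<tau>) / z None * a \<tau> q) = (\<Sum>\<tau>\<in>T. z (Some \<tau>) * a \<tau> q) / z None"
              by (simp add: sum_divide_distrib)
            then show "(\<Sum>\<tau>\<in>T. z (Some \<tau>) / z None * a \<tau> q) \<le> x q"
              using zQ[OF \<open>q \<in> Q\<close>] pos by (simp add: pos_divide_le_eq mult.commute)
          qed
        qed
        then show ?thesis using pos by (simp add: \<gamma>_def pos_divide_le_eq flip: sum_divide_distrib)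
      qed
    qed
  qed
  then obtain l where l: "\<forall>i\<in>I. l i \<ge> (0::real)" "\<And>z. \<gamma> z = (\<Sum>i\<in>I. l i * \<alpha> i z)" by auto
  have expand: "\<gamma> z = (\<Sum>q\<in>Q. l (Inl q) * ((\<Sum>\<tau>\<in>T. z (Some \<tau>) * a \<tau> q) - z None * x q))
      - (\<Sum>\<tau>\<in>T. l (Inr (Some \<tau>)) * z (Some \<tau>)) - l (Inr None) * z None" for z
  proof -
    have "\<gamma> z = (\<Sum>i\<in>Inl ` Q. l i * \<alpha> i z) + (\<Sum>i\<in>Inr ` (Some ` T \<union> {None}). l i * \<alpha> i z)"
      unfolding l(2) I_def by (rule sum.union_disjoint) (use fin in auto)
    also have "(\<Sum>i\<in>Inl ` Q. l i * \<alpha> i z) = (\<Sum>q\<in>Q. l (Inl q) * \<alpha> (Inl q) z)"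
      by (subst sum.reindex) (auto simp: inj_on_def)
    also have "(\<Sum>i\<in>Inr ` (Some ` T \<union> {None}). l i * \<alpha> i z) = (\<Sum>i\<in>Some ` T \<union> {None}. l (Inr i) * \<alpha> (Inr i) z)"
      by (subst sum.reindex) (auto simp: inj_on_def)
    also have "\<dots> = (\<Sum>i\<in>Some ` T. l (Inr i) * \<alpha> (Inr i) z) + l (Inr None) * \<alpha> (Inr None) z"
      using fin by (subst sum.union_disjoint) auto
    also have "(\<Sum>i\<in>Some ` T. l (Inr i) * \<alpha> (Inr i) z) = (\<Sum>i\<in>T. l (Inr (Some i)) * \<alpha> (Inr (Some i)) z)"
      by (subst sum.reindex) (auto simp: inj_on_def)
    finally show ?thesis by (simp add: \<alpha>_def sum_negf)
  qed
  have "(\<Sum>q\<in>Q. l (Inl q) * a \<tau> q) \<ge> 1" if \<tau>: "\<tau> \<in> T" for \<tau>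
  proof -
    define e where "e = (\<lambda>s. if s = Some \<tau> then 1 else (0::real))"
    have *: "(\<Sum>\<sigma>\<in>T. e (Some \<sigma>) * f \<sigma>) = f \<tau>" for f :: "'t \<Rightarrow> real"
      using fin \<tau> by (simp add: e_def if_distrib[of "\<lambda>x. x * _"] cong: if_cong)
    have "\<gamma> e = 1" using *[of "\<lambda>_. 1"] by (simp add: \<gamma>_def e_def)
    moreover have "\<gamma> e = (\<Sum>q\<in>Q. l (Inl q) * a \<tau> q) - l (Inr (Some \<tau>))"
    proof -
      have "(\<Sum>\<sigma>\<in>T. l (Inr (Some \<sigma>)) * e (Some \<sigma>)) = l (Inr (Some \<tau>))"
        using *[of "\<lambda>\<sigma>. l (Inr (Some \<sigma>))"] by (simp only: mult.commute)
      moreover have "e None = 0" by (simp add: e_def)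
      ultimately show ?thesis unfolding expand * by simp
    qed
    moreover have "l (Inr (Some \<tau>)) \<ge> 0" using l(1) \<tau> by (simp add: I_def)
    ultimately show ?thesis by linarith
  qed
  moreover have "(\<Sum>q\<in>Q. l (Inl q) * x q) \<le> t"
  proof -
    define e where "e = (\<lambda>s::'t option. if s = None then 1 else (0::real))"
    have "\<gamma> e = - t" by (simp add: \<gamma>_def e_def)
    moreover have "\<gamma> e = - (\<Sum>q\<in>Q. l (Inl q) * x q) - l (Inr None)"
      unfolding expand by (simp add: e_def sum_negf)
    moreover have "l (Inr None) \<ge> 0" using l(1) by (simp add: I_def)
    ultimately show ?thesis by linarith
  qed
  moreover have "\<forall>q\<in>Q. l (Inl q) \<ge> 0" using l(1) by (simp add: I_def)
  ultimately show ?thesis by (intro exI[of _ "\<lambda>q. l (Inl q)"]) auto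
qed

section \<open>Reduction to three points\<close>

lemma homogeneous_system_nontrivial:
  fixes g :: "nat \<Rightarrow> 'a \<Rightarrow> real"
  assumes "finite S" "card S > m"
  shows "\<exists>d. (\<exists>p\<in>S. d p \<noteq> 0) \<and> (\<forall>i<m. (\<Sum>p\<in>S. d p * g i p) = 0)"
  using assms
proof (induction m arbitrary: S)
  case 0
  then obtain p where "p \<in> S" by fastforce
  then show ?case by (intro exI[of _ "\<lambda>_. 1"]) auto
next
  case (Suc m)
  have ext: "\<exists>d. (\<exists>p\<in>S - {r}. d p \<noteq> 0) \<and> d r = 0 \<and> (\<forall>i<m. (\<Sum>p\<in>S. d p * g i p) = 0)" if r: "r \<in> S" for r
  proof -
    have "card (S - {r}) > m" using Suc.prems r by (simp add: card_Diff_singleton)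
    then obtain d where d: "\<exists>p\<in>S - {r}. d p \<noteq> 0" "\<forall>i<m. (\<Sum>p\<in>S - {r}. d p * g i p) = 0"
      using Suc.IH[of "S - {r}"] Suc.prems by auto
    have "(\<Sum>p\<in>S. (d(r := 0)) p * g i p) = (\<Sum>p\<in>S - {r}. d p * g i p)" for i
      using Suc.prems r by (simp add: sum.remove[of S r])
    then show ?thesis using d by (intro exI[of _ "d(r := 0)"]) auto
  qed
  obtain r where "r \<in> S" using Suc.prems by fastforce
  then obtain d where d: "\<exists>p\<in>S - {r}. d p \<noteq> 0" "\<forall>i<m. (\<Sum>p\<in>S. d p * g i p) = 0" using ext by blast
  then obtain s where s: "s \<in> S" "d s \<noteq> 0" by blast
  then obtain e where e: "\<exists>p\<in>S - {s}. e p \<noteq> 0" "e s = 0" "\<forall>i<m. (\<Sum>p\<in>S. e p * g i p) = 0" using ext by blast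
  define A where "A = (\<Sum>p\<in>S. e p * g m p)"
  define B where "B = (\<Sum>p\<in>S. d p * g m p)"
  show ?case
  proof (cases "A = 0")
    case True
    then show ?thesis using e by (intro exI[of _ e]) (auto simp: A_def less_Suc_eq)
  next
    case False
    define f where "f = (\<lambda>p. A * d p - B * e p)"
    have lin: "(\<Sum>p\<in>S. f p * g i p) = A * (\<Sum>p\<in>S. d p * g i p) - B * (\<Sum>p\<in>S. e p * g i p)" for i
      by (simp add: f_def algebra_simps sum_subtractf sum_distrib_left)
    have "f s \<noteq> 0" using s e False by (simp add: f_def)
    moreover have "(\<Sum>p\<in>S. f p * g i p) = 0" if "i < Suc m" for i
      using that d e lin[of i] by (auto simp: less_Suc_eq A_def B_def)
    ultimately show ?thesis using s by blast
  qed
qed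

text \<open>Caratheodory's theorem in dimension three would give four points. Three are enough because the
costs only have to be bounded from above: four points carry a nonzero signed mass of total zero
that leaves two of the costs unchanged, and its sign can be chosen so that the third cost does not
increase. Moving along it empties a point.\<close>

lemma three_points_suffice:
  fixes x :: "'a \<Rightarrow> real" and f :: "nat \<Rightarrow> 'a \<Rightarrow> real"
  assumes "finite S" "\<forall>p\<in>S. x p \<ge> 0"
  shows "\<exists>S' y. S' \<subseteq> S \<and> card S' \<le> 3 \<and> (\<forall>p\<in>S'. y p \<ge> 0) \<and> (\<Sum>p\<in>S'. y p) = (\<Sum>p\<in>S. x p)
     \<and> (\<forall>c<3. (\<Sum>p\<in>S'. y p * f c p) \<le> (\<Sum>p\<in>S. x p * f c p))"
  using assms
proof (induction "card S" arbitrary: S x rule: less_induct)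
  case less
  show ?case
  proof (cases "card S \<le> 3")
    case True
    then show ?thesis using less.prems by (intro exI[of _ S] exI[of _ x]) auto
  next
    case False
    define g where "g = (\<lambda>i::nat. if i = 2 then (\<lambda>_. 1) else f i)"
    obtain d0 where d0: "\<exists>p\<in>S. d0 p \<noteq> 0" "\<forall>i<3. (\<Sum>p\<in>S. d0 p * g i p) = 0"
      using homogeneous_system_nontrivial[of S 3 g] less.prems False by auto
    define sg :: real where "sg = (if (\<Sum>p\<in>S. d0 p * f 2 p) \<le> 0 then 1 else -1)"
    define d where "d = (\<lambda>p. sg * d0 p)"
    have sum_d: "(\<Sum>p\<in>S. d p * h p) = sg * (\<Sum>p\<in>S. d0 p * h p)" for h
      by (simp add: d_def sum_distrib_left mult.assoc)
    have dne: "\<exists>p\<in>S. d p \<noteq> 0" using d0 by (auto simp: d_def sg_def)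
    have d1: "(\<Sum>p\<in>S. d p) = 0" using sum_d[of "\<lambda>_. 1"] d0(2)[rule_format, of 2] by (simp add: g_def)
    have df: "(\<Sum>p\<in>S. d p * f c p) \<le> 0" if "c < 3" for c
    proof (cases "c = 2")
      case True then show ?thesis using sum_d[of "f 2"] by (auto simp: sg_def)
    next
      case False then show ?thesis using sum_d[of "f c"] d0(2)[rule_format, of c] that by (simp add: g_def)
    qed
    define N where "N = {p\<in>S. d p < 0}"
    have "N \<noteq> {}"
    proof
      assume "N = {}"
      then have "\<forall>p\<in>S. d p \<ge> 0" by (force simp: N_def)
      then have "\<forall>p\<in>S. d p = 0" using d1 less.prems(1) by (simp add: sum_nonneg_eq_0_iff)
      then show False using dne by auto
    qed
    moreover have "finite N" using less.prems by (simp add: N_def)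
    ultimately obtain r where r: "r \<in> N" "\<forall>p\<in>N. x r / (- d r) \<le> x p / (- d p)"
      using ex_min_if_finite[of "(\<lambda>p. x p / (- d p)) ` N"] by (force simp: not_less)
    \<comment> \<open>the largest step for which all masses stay nonnegative; it empties the point \<open>r\<close>\<close>
    define \<theta> where "\<theta> = x r / (- d r)"
    define y where "y = (\<lambda>p. x p + \<theta> * d p)"
    have rS: "r \<in> S" "d r < 0" using r by (auto simp: N_def)
    have "\<theta> \<ge> 0" using rS less.prems by (auto simp: \<theta>_def intro: divide_nonneg_neg)
    have yr: "y r = 0" using rS by (simp add: y_def \<theta>_def)
    have ynn: "y p \<ge> 0" if p: "p \<in> S" for p
    proof (cases "d p < 0")
      case True
      then have "\<theta> \<le> x p / (- d p)" using r(2) p by (auto simp: N_def \<theta>_def)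
      then have "\<theta> * (- d p) \<le> x p" using True by (subst (asm) pos_le_divide_eq) auto
      then show ?thesis by (simp add: y_def)
    next
      case False then show ?thesis using \<open>\<theta> \<ge> 0\<close> less.prems p by (simp add: y_def)
    qed
    have drop: "(\<Sum>p\<in>S - {r}. y p * h p) = (\<Sum>p\<in>S. x p * h p) + \<theta> * (\<Sum>p\<in>S. d p * h p)" for h
    proof -
      have "(\<Sum>p\<in>S - {r}. y p * h p) = (\<Sum>p\<in>S. y p * h p)"
        using less.prems(1) rS yr by (simp add: sum.remove[of S r])
      then show ?thesis by (simp add: y_def algebra_simps sum.distrib sum_distrib_left)
    qed
    have "card (S - {r}) < card S" using less.prems(1) rS by (meson card_Diff1_less)
    then obtain S' z where S': "S' \<subseteq> S - {r}" "card S' \<le> 3" "\<forall>p\<in>S'. z p \<ge> 0"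
      "(\<Sum>p\<in>S'. z p) = (\<Sum>p\<in>S - {r}. y p)" "\<forall>c<3. (\<Sum>p\<in>S'. z p * f c p) \<le> (\<Sum>p\<in>S - {r}. y p * f c p)"
      using less.hyps[of "S - {r}" y] less.prems(1) ynn by auto
    have "(\<Sum>p\<in>S'. z p) = (\<Sum>p\<in>S. x p)" using S'(4) drop[of "\<lambda>_. 1"] d1 by simp
    moreover have "(\<Sum>p\<in>S'. z p * f c p) \<le> (\<Sum>p\<in>S. x p * f c p)" if "c < 3" for c
      using S'(5) drop[of "f c"] mult_nonneg_nonpos[OF \<open>\<theta> \<ge> 0\<close> df[OF that]] that by fastforce
    ultimately show ?thesis using S' by blast
  qed
qed

section \<open>Fractional covers of small reduced graphs\<close>

text \<open>The covers of the linear program for homomorphic images of the double star: the centres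
\<open>u\<close> and \<open>v\<close>, two leaves at a neighbour \<open>a\<close> of
\<open>u\<close>, and three leaves at a neighbour \<open>b\<close> of \<open>v\<close>. Putting
the leaves of a centre at different neighbours gives an average of these inequalities.\<close>

definition ds_cover :: "('p \<Rightarrow> real) \<Rightarrow> ('p \<Rightarrow> 'p \<Rightarrow> bool) \<Rightarrow> bool" where
  "ds_cover w H \<longleftrightarrow> (\<forall>u v a b. H u v \<longrightarrow> H u a \<longrightarrow> H v b \<longrightarrow> w u + w v + 2 * w a + 3 * w b \<ge> 1)"

lemma ds_coverD: "ds_cover w H \<Longrightarrow> H u v \<Longrightarrow> H u a \<Longrightarrow> H v b \<Longrightarrow> w u + w v + 2 * w a + 3 * w b \<ge> 1"
  by (auto simp: ds_cover_def)

lemma loop_bound: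
  assumes "ds_cover w H" "H p p" "x \<ge> (0::real)"
  shows "x * w p \<ge> x / 7"
proof -
  have "7 * w p \<ge> 1" using ds_coverD[OF assms(1), of p p p p] assms(2) by simp
  then show ?thesis using assms(3) mult_left_mono[of "1/7" "w p" x] by simp
qed

text \<open>Used with \<open>c\<close> the multiplicity of a tile and \<open>e\<close> its weight. All the
following bounds come from an explicit fractional tiling of the given masses, whose tiles weigh at
least one each.\<close>

lemma le_mult_ge_one: "\<lbrakk>0 \<le> c; (1::real) \<le> e\<rbrakk> \<Longrightarrow> c \<le> c * e"
  using mult_left_mono[of 1 e c] by simp

text \<open>If \<open>q\<close> has enough mass, tiles with both centres in \<open>p\<close> and all leaves in
\<open>q\<close> use up \<open>p\<close>. Otherwise these tiles use up \<open>q\<close>, and the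
rest of \<open>p\<close> is tiled by its loop.\<close>

lemma dominating_bound:
  assumes "ds_cover w H" "H p p" "H p q" "H q p" "x \<ge> 0" "y \<ge> 0" "w q \<ge> 0"
  shows "x * w p + y * w q \<ge> min (x / 2) ((x + y) / 7)"
proof -
  have 1: "7 * w p \<ge> 1" using ds_coverD[OF assms(1), of p p p p] assms(2) by simp
  have 2: "2 * w p + 5 * w q \<ge> 1" using ds_coverD[OF assms(1), of p p q q] assms(2,3) by simp
  show ?thesis
  proof (cases "y \<ge> 5 * x / 2")
    case True
    have "x / 2 \<le> x / 2 * (2 * w p + 5 * w q)" by (intro le_mult_ge_one) (use 2 assms(5) in auto)
    moreover have "0 \<le> (y - 5 * x / 2) * w q" using True assms(7) by simp
    ultimately show ?thesis by (simp add: algebra_simps min_def)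
  next
    case False
    have "y / 5 \<le> y / 5 * (2 * w p + 5 * w q)" by (intro le_mult_ge_one) (use 2 assms(6) in auto)
    moreover have "(x - 2 * y / 5) / 7 \<le> (x - 2 * y / 5) / 7 * (7 * w p)" by (intro le_mult_ge_one) (use 1 False in auto)
    moreover have "y / 5 * (2 * w p + 5 * w q) + (x - 2 * y / 5) / 7 * (7 * w p) = x * w p + y * w q"
      by (simp add: field_simps)
    moreover have "y / 5 + (x - 2 * y / 5) / 7 = (x + y) / 7" by (simp add: field_simps)
    ultimately have "(x + y) / 7 \<le> x * w p + y * w q" by linarith
    then show ?thesis by linarith
  qed
qed

text \<open>The two bipartition classes of the double star have three and four vertices, so a pair can be
tiled completely if the ratio of its masses is between \<open>3/4\<close> and \<open>4/3\<close>.
Otherwise the smaller side limits the tiling.\<close>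

lemma bipartite_bound:
  assumes "ds_cover w H" "H p q" "H q p" "x \<ge> 0" "y \<ge> 0" "w p \<ge> 0" "w q \<ge> 0"
  shows "x * w p + y * w q \<ge> min (x / 3) (min (y / 3) ((x + y) / 7))"
proof -
  have 1: "4 * w p + 3 * w q \<ge> 1" using ds_coverD[OF assms(1), of p q q p] assms(2,3) by simp
  have 2: "3 * w p + 4 * w q \<ge> 1" using ds_coverD[OF assms(1), of q p p q] assms(2,3) by simp
  consider "4 * x \<le> 3 * y" | "4 * y \<le> 3 * x" | "4 * x \<ge> 3 * y" "4 * y \<ge> 3 * x" by linarith
  then show ?thesis
  proof cases
    case a: 1
    have "x / 3 \<le> x / 3 * (3 * w p + 4 * w q)" by (intro le_mult_ge_one) (use 2 assms(4) in auto)
    moreover have "0 \<le> (y - 4 * x / 3) * w q" using a assms(7) by simp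
    ultimately show ?thesis by (simp add: algebra_simps min_def)
  next
    case b: 2
    have "y / 3 \<le> y / 3 * (4 * w p + 3 * w q)" by (intro le_mult_ge_one) (use 1 assms(5) in auto)
    moreover have "0 \<le> (x - 4 * y / 3) * w p" using b assms(6) by simp
    ultimately show ?thesis by (simp add: algebra_simps min_def)
  next
    case c: 3
    have "(4 * x - 3 * y) / 7 \<le> (4 * x - 3 * y) / 7 * (4 * w p + 3 * w q)" by (intro le_mult_ge_one) (use 1 c in auto)
    moreover have "(4 * y - 3 * x) / 7 \<le> (4 * y - 3 * x) / 7 * (3 * w p + 4 * w q)" by (intro le_mult_ge_one) (use 2 c in auto)
    moreover have "(4 * x - 3 * y) / 7 * (4 * w p + 3 * w q) + (4 * y - 3 * x) / 7 * (3 * w p + 4 * w q)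
      = x * w p + y * w q" by (simp add: field_simps)
    moreover have "(4 * x - 3 * y) / 7 + (4 * y - 3 * x) / 7 = (x + y) / 7" by (simp add: field_simps)
    ultimately have "(x + y) / 7 \<le> x * w p + y * w q" by linarith
    then show ?thesis by linarith
  qed
qed

text \<open>The two vertices \<open>p\<close> and \<open>p'\<close> act as a single part whose weight is the
smaller of their weights.\<close>

lemma bipartite_pair_bound:
  assumes "ds_cover w H" "H p q" "H q p" "H p' q" "H q p'"
    "x \<ge> 0" "x' \<ge> 0" "y \<ge> 0" "w p \<ge> 0" "w p' \<ge> 0" "w q \<ge> 0"
  shows "x * w p + x' * w p' + y * w q \<ge> min ((x + x') / 3) (min (y / 3) ((x + x' + y) / 7))"
proof -
  define m where "m = min (w p) (w p')"
  have "ds_cover (\<lambda>b. if b then m else w q) (\<lambda>a b. a \<noteq> b)"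
  proof (cases "w p \<le> w p'")
    case True
    then have m: "m = w p" by (simp add: m_def)
    show ?thesis unfolding ds_cover_def m
      using ds_coverD[OF assms(1), of p q q p] ds_coverD[OF assms(1), of q p p q] assms(2,3)
      by auto
  next
    case False
    then have m: "m = w p'" by (simp add: m_def)
    show ?thesis unfolding ds_cover_def m
      using ds_coverD[OF assms(1), of p' q q p'] ds_coverD[OF assms(1), of q p' p' q] assms(4,5)
      by auto
  qed
  from bipartite_bound[OF this, of True False "x + x'" y]
  have "(x + x') * m + y * w q \<ge> min ((x + x') / 3) (min (y / 3) ((x + x' + y) / 7))"
    using assms by (simp add: m_def)
  moreover have "x * m \<le> x * w p" "x' * m \<le> x' * w p'"
    using assms by (auto simp: m_def intro!: mult_left_mono)
  ultimately show ?thesis by (simp add: algebra_simps)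
qed

text \<open>As before, \<open>q\<close> and \<open>q'\<close> are merged into a part that has the smaller
weight.\<close>

lemma dominated_pair_bound:
  assumes "ds_cover w H" "H p p" "H p q" "H q p" "H p q'" "H q' p"
    "x \<ge> 0" "y \<ge> 0" "y' \<ge> 0" "w q \<ge> 0" "w q' \<ge> 0"
  shows "x * w p + y * w q + y' * w q' \<ge> min (x / 2) ((x + y + y') / 7)"
proof -
  define m where "m = min (w q) (w q')"
  have "m = w q \<or> m = w q'" by (auto simp: m_def)
  then obtain r where r: "m = w r" "H p r" "H r p" using assms by blast
  have "x * w p + (y + y') * m \<ge> min (x / 2) ((x + (y + y')) / 7)"
    unfolding r(1) by (rule dominating_bound[OF assms(1,2) r(2,3)]) (use assms r in \<open>auto simp: m_def\<close>)
  moreover have "y * m \<le> y * w q" "y' * m \<le> y' * w q'"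
    using assms by (auto simp: m_def intro!: mult_left_mono)
  ultimately show ?thesis by (simp add: algebra_simps)
qed

text \<open>Besides tiles on the edge \<open>rp\<close> and on the loop at \<open>q\<close> there is a mixed
tile: a centre in \<open>r\<close> with three leaves in \<open>p\<close>, the other centre in
\<open>q\<close> with its two leaves in \<open>q\<close>. It uses only one unit of
\<open>r\<close>, and this makes the bound strong enough. The multiplicity \<open>g\<close> of the
mixed tile is as large as possible.\<close>

lemma looped_path_bound:
  assumes "ds_cover w H" "H q q" "H q r" "H r q" "H r p" "H p r"
    "x \<ge> 0" "y \<ge> 0" "z \<ge> 0" "w p \<ge> 0" "w q \<ge> 0" "w r \<ge> 0"
  shows "x * w p + y * w q + z * w r \<ge>
    min (min (z / 3 + 2 * y / 9) (4 * z / 7 + y / 7)) (min (x / 3 + y / 7) ((x + y + z) / 7))"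
proof -
  have 1: "3 * w r + 4 * w p \<ge> 1" using ds_coverD[OF assms(1), of p r r p] assms(5,6) by simp
  have 2: "4 * w r + 3 * w p \<ge> 1" using ds_coverD[OF assms(1), of r p p r] assms(5,6) by simp
  have 3: "7 * w q \<ge> 1" using ds_coverD[OF assms(1), of q q q q] assms(2) by simp
  have 4: "w r + 3 * w q + 3 * w p \<ge> 1" using ds_coverD[OF assms(1), of q r q p] assms by simp
  have yq: "y * w q \<ge> y / 7" using loop_bound[OF assms(1,2)] assms by blast
  have *: "x * w p + z * w r \<ge> min (x / 3) (min (z / 3) ((x + z) / 7))"
    using bipartite_bound[OF assms(1), of p r x z] assms by simp
  show ?thesis
  proof (cases "4 * z \<le> 3 * x")
    case False
    have "x * w p + z * w r \<ge> min (x / 3) ((x + z) / 7)"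
      using * False by (auto simp: min_def split: if_splits)
    then show ?thesis using yq by (auto simp: min_def split: if_splits)
  next
    case True
    define g where "g = min (min z (y / 3)) ((3 * x - 4 * z) / 5)"
    have g: "g \<ge> 0" "g \<le> z" "3 * g \<le> y" "5 * g \<le> 3 * x - 4 * z"
      using assms True by (auto simp: g_def min_def)
    have "(z - g) / 3 \<le> (z - g) / 3 * (3 * w r + 4 * w p)" by (intro le_mult_ge_one) (use 1 g in auto)
    moreover have "(y - 3 * g) / 7 \<le> (y - 3 * g) / 7 * (7 * w q)" by (intro le_mult_ge_one) (use 3 g in auto)
    moreover have "g \<le> g * (w r + 3 * w q + 3 * w p)" by (intro le_mult_ge_one) (use 4 g in auto)
    moreover have "0 \<le> (x - 4 * (z - g) / 3 - 3 * g) * w p"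
    proof (rule mult_nonneg_nonneg)
      show "0 \<le> x - 4 * (z - g) / 3 - 3 * g" using g(4) by (simp add: field_simps)
    qed fact
    moreover have "(z - g) / 3 * (3 * w r + 4 * w p) + (y - 3 * g) / 7 * (7 * w q)
      + g * (w r + 3 * w q + 3 * w p) + (x - 4 * (z - g) / 3 - 3 * g) * w p
      = x * w p + y * w q + z * w r" by (simp add: field_simps)
    ultimately have "(z - g) / 3 + (y - 3 * g) / 7 + g \<le> x * w p + y * w q + z * w r"
      by linarith
    moreover have "(z - g) / 3 + (y - 3 * g) / 7 + g \<ge>
        min (min (z / 3 + 2 * y / 9) (4 * z / 7 + y / 7)) ((x + y + z) / 7)"
    proof -
      have "g = z \<or> g = y / 3 \<or> g = (3 * x - 4 * z) / 5" unfolding g_def min_def by presburger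
      then show ?thesis unfolding min_le_iff_disj by (elim disjE) (simp_all add: field_simps)
    qed
    ultimately show ?thesis by linarith
  qed
qed

section \<open>Three-coloured triangles with coloured loops\<close>

lemma le_mins: "(min a b \<le> (t::real)) = (a \<le> t \<or> b \<le> t)" "(u + min a b \<le> (t::real)) = (u + a \<le> t \<or> u + b \<le> t)" "(min a b + u \<le> (t::real)) = (a + u \<le> t \<or> b + u \<le> t)"
 by (auto simp: min_def)

lemma three_eq_cases:
  "(a = b \<and> b = c) \<or> (a = b \<and> a \<noteq> c) \<or> (a = c \<and> a \<noteq> b) \<or> (b = c \<and> b \<noteq> a) \<or> (a \<noteq> b \<and> a \<noteq> c \<and> b \<noteq> c)"
  by auto

lemma third_element:
  assumes "x \<noteq> y" "x \<in> {k, l, j}" "y \<in> {k, l, j}"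
  shows "\<exists>d. \<forall>c\<in>{k, l, j}. c = x \<or> c = y \<or> c = d"
  using assms by auto

lemma three_distinct_elements:
  assumes "a \<noteq> b" "a \<noteq> c" "b \<noteq> c" "{a, b, c} \<subseteq> {k, l, j}"
  shows "{a, b, c} = {k, l, j}"
proof (rule card_seteq)
  have "card {k, l, j} \<le> 3" by (simp add: card_insert_if)
  then show "card {k, l, j} \<le> card {a, b, c}" using assms(1-3) by simp
qed (use assms in simp_all)

text \<open>A complete graph with loops whose edges are coloured by \<open>C\<close>, masses \<open>m\<close>
on its vertices, and for each colour a cover of cost at most \<open>t\<close>. The aim is a lower
bound for \<open>t\<close>.\<close>

locale coloured_cover =
  fixes w :: "'c \<Rightarrow> 'p \<Rightarrow> real" and C :: "'p \<Rightarrow> 'p \<Rightarrow> 'c" and m :: "'p \<Rightarrow> real" and P :: "'p set" and t :: real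
  assumes sym: "C a b = C b a"
    and cover: "ds_cover (w c) (\<lambda>a b. C a b = c)"
    and w_nonneg: "w c a \<ge> 0"
    and m_nonneg: "m a \<ge> 0"
    and cost: "(\<Sum>a\<in>P. m a * w c a) \<le> t"
begin

definition tri :: "'p \<Rightarrow> 'p \<Rightarrow> 'p \<Rightarrow> bool" where
  "tri p q r \<longleftrightarrow> P = {p, q, r} \<and> p \<noteq> q \<and> p \<noteq> r \<and> q \<noteq> r"

lemma tri_perm: "tri p q r \<Longrightarrow> tri q p r" "tri p q r \<Longrightarrow> tri p r q" "tri p q r \<Longrightarrow> tri r q p"
  "tri p q r \<Longrightarrow> tri q r p" "tri p q r \<Longrightarrow> tri r p q"
  unfolding tri_def by (metis insert_commute)+

lemma tri_sum:
  fixes f :: "'p \<Rightarrow> real"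
  assumes "tri p q r"
  shows "sum f P = f p + f q + f r"
proof -
  have P: "P = {p, q, r}" and "p \<noteq> q" "p \<noteq> r" "q \<noteq> r"
    using assms unfolding tri_def by blast+
  then show ?thesis unfolding P by simp
qed

lemma tri_cost: "tri p q r \<Longrightarrow> m p * w c p + m q * w c q + m r * w c r \<le> t"
  using cost[of c] tri_sum[of p q r "\<lambda>a. m a * w c a"] by simp

lemma mw_nonneg: "m a * w c a \<ge> 0"
  by (simp add: m_nonneg w_nonneg)

lemma t_nonneg: "t \<ge> 0"
proof -
  have "0 \<le> (\<Sum>a\<in>P. m a * w c a)" for c by (intro sum_nonneg mw_nonneg)
  then show ?thesis using cost by (rule order_trans)
qed

lemma loopW: "m p * w (C p p) p \<ge> m p / 7"
  by (rule loop_bound[OF cover refl m_nonneg])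

lemma bipW: "m p * w (C p q) p + m q * w (C p q) q \<ge> min (m p / 3) (min (m q / 3) ((m p + m q) / 7))"
  by (rule bipartite_bound[OF cover refl sym m_nonneg m_nonneg w_nonneg w_nonneg])

lemma domW: "C p q = C p p \<Longrightarrow>
    m p * w (C p p) p + m q * w (C p p) q \<ge> min (m p / 2) ((m p + m q) / 7)"
  by (rule dominating_bound[OF cover refl _ _ m_nonneg m_nonneg w_nonneg]) (simp_all add: sym[of q p])

lemma dom2W: "C p q = C p p \<Longrightarrow> C p r = C p p \<Longrightarrow>
    m p * w (C p p) p + m q * w (C p p) q + m r * w (C p p) r \<ge> min (m p / 2) ((m p + m q + m r) / 7)"
  by (rule dominated_pair_bound[OF cover refl _ _ _ _ m_nonneg m_nonneg m_nonneg w_nonneg w_nonneg])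
    (simp_all add: sym[of q p] sym[of r p])

context
  fixes p q r
  assumes pqr: "tri p q r"
begin

lemma sum_boundI:
  assumes "7 * m p + 7 * m q + 7 * m r \<le> 78 * t"
  shows "7 * sum m P \<le> 78 * t"
  using assms tri_sum[OF pqr] by simp

lemmas nn = m_nonneg[of p] m_nonneg[of q] m_nonneg[of r] t_nonneg
lemmas mw = mw_nonneg[of p] mw_nonneg[of q] mw_nonneg[of r]
lemmas cst = tri_cost[OF pqr]

text \<open>Two vertices \<open>p\<close> and \<open>q\<close> with loops of the same colour are considered
next, together with a third vertex \<open>r\<close>.\<close>

lemma two_loops_cost:
  assumes "C p p = C q q"
  shows "m p + m q \<le> 7 * t" "m r \<le> 7 * t"
  using loopW[of p] loopW[of q] loopW[of r] cst[of "C p p"] cst[of "C r r"] mw[of "C p p"] mw[of "C r r"]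
  unfolding assms(1)[symmetric] by linarith+

lemma two_loops_dominating_cost:
  assumes "C p p = C q q" "C p r = C p p"
  shows "min (m p / 2) ((m p + m r) / 7) + m q / 7 \<le> t"
  using domW[OF assms(2)] loopW[of q] cst[of "C p p"] unfolding assms(1)[symmetric] by linarith

lemma bip_cost: "min (m q / 3) (min (m r / 3) ((m q + m r) / 7)) \<le> t"
  using bipW[of q r] cst[of "C q r"] mw[of "C q r"] by linarith

text \<open>This is the extremal case, with \<open>r\<close>, \<open>p\<close>, \<open>q\<close> in the roles
of \<open>B\<close>, \<open>X\<close>, \<open>Y\<close>. The pair \<open>q\<close>,
\<open>r\<close> is tiled in whichever colour it has.\<close>

lemma two_loops_dominating:
  assumes "C p p = C q q" "C p r = C p p"
  shows "7 * sum m P \<le> 78 * t"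
proof (rule sum_boundI)
  show "7 * m p + 7 * m q + 7 * m r \<le> 78 * t"
    using two_loops_dominating_cost[OF assms(1,2)] two_loops_cost[OF assms(1)] nn bip_cost
    unfolding le_mins by argo
qed

lemma two_loops_dominated:
  assumes "C p p = C q q" "C p r = C r r"
  shows "7 * sum m P \<le> 78 * t"
proof (rule sum_boundI)
  have "min (m r / 2) ((m r + m p) / 7) \<le> t"
    using domW[of r p] cst[of "C r r"] mw(2)[of "C r r"] assms(2)[unfolded sym[of p r]] by simp
  then show "7 * m p + 7 * m q + 7 * m r \<le> 78 * t"
    using two_loops_cost[OF assms(1)] nn bip_cost unfolding le_mins by argo
qed

lemma two_loops_bipartite:
  assumes "C p p = C q q" "C p r = C q r"
  shows "7 * sum m P \<le> 78 * t"
proof (rule sum_boundI)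
  have "min ((m p + m q) / 3) (min (m r / 3) ((m p + m q + m r) / 7)) \<le> t"
  proof -
    have "min ((m p + m q) / 3) (min (m r / 3) ((m p + m q + m r) / 7)) \<le> m p * w (C p r) p + m q * w (C p r) q + m r * w (C p r) r"
      by (rule bipartite_pair_bound[OF cover]) (simp_all add: assms sym[of r p] sym[of r q] m_nonneg w_nonneg)
    then show ?thesis using cst[of "C p r"] by linarith
  qed
  then show "7 * m p + 7 * m q + 7 * m r \<le> 78 * t"
    using two_loops_cost[OF assms(1)] nn unfolding le_mins by argo
qed

end

context
  fixes p q r
  assumes pqr: "tri p q r"
begin

text \<open>From here on the loops at \<open>p\<close>, \<open>q\<close> and \<open>r\<close> have different
colours. An edge has either the loop colour of one of its ends, which then
\<^emph>\<open>dominates\<close> the other end, or the loop colour of the opposite vertex.\<close>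

lemma loop_cost: "m p \<le> 7 * t" "m q \<le> 7 * t" "m r \<le> 7 * t"
proof -
  have "m a * w c a \<le> t" if "a \<in> {p, q, r}" for a c
    using cst[OF pqr, of c] mw_nonneg[of p c] mw_nonneg[of q c] mw_nonneg[of r c] that by auto
  from this[of p "C p p"] this[of q "C q q"] this[of r "C r r"]
  show "m p \<le> 7 * t" "m q \<le> 7 * t" "m r \<le> 7 * t"
    using loopW[of p] loopW[of q] loopW[of r] by simp_all
qed

lemma opposite_cost:
  assumes "C p q = C r r"
  shows "m r / 7 + min (m p / 3) (min (m q / 3) ((m p + m q) / 7)) \<le> t"
  using bipW[of p q] loopW[of r] cst[OF pqr, of "C r r"] unfolding assms by linarith

lemma dom_cost:
  assumes "C p q = C p p"
  shows "min (m p / 2) ((m p + m q) / 7) \<le> t"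
  using domW[OF assms] cst[OF pqr, of "C p p"] mw_nonneg[of r "C p p"] by linarith

lemma dom2_cost:
  assumes "C p q = C p p" "C p r = C p p"
  shows "min (m p / 2) ((m p + m q + m r) / 7) \<le> t"
  using dom2W[OF assms] cst[OF pqr, of "C p p"] by linarith

lemma path_cost:
  assumes "C p q = C p p" "C q r = C p p"
  shows "min (min (m q / 3 + 2 * m p / 9) (4 * m q / 7 + m p / 7)) (min (m r / 3 + m p / 7) ((m r + m p + m q) / 7)) \<le> t"
proof -
  have "min (min (m q / 3 + 2 * m p / 9) (4 * m q / 7 + m p / 7)) (min (m r / 3 + m p / 7) ((m r + m p + m q) / 7))
      \<le> m r * w (C p p) r + m p * w (C p p) p + m q * w (C p p) q"
    by (rule looped_path_bound[OF cover]) (simp_all add: assms sym[of q p] sym[of r q] m_nonneg w_nonneg)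
  then show ?thesis using cst[OF pqr, of "C p p"] by linarith
qed

end


lemma edges_all_opposite:
  assumes T: "tri p q r" and "C p q = C r r" "C p r = C q q" "C q r = C p p"
  shows "7 * sum m P \<le> 78 * t"
proof (rule sum_boundI[OF T])
  show "7 * m p + 7 * m q + 7 * m r \<le> 78 * t"
    using opposite_cost[OF T assms(2)] opposite_cost[OF tri_perm(2)[OF T] assms(3)] opposite_cost[OF tri_perm(4)[OF T] assms(4)]
      m_nonneg[of p] m_nonneg[of q] m_nonneg[of r] t_nonneg
    unfolding le_mins by argo
qed

text \<open>The edges \<open>qr\<close> and \<open>rp\<close> form a path in the loop colour of
\<open>q\<close>. Adding up a bound for the edge \<open>rp\<close> and one for the loop at
\<open>q\<close> would not suffice; \<open>looped_path_bound\<close> combines them.\<close>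

lemma edges_two_opposite:
  assumes T: "tri p q r" and "C p q = C r r" "C p r = C q q" "C q r = C q q"
  shows "7 * sum m P \<le> 78 * t"
proof (rule sum_boundI[OF T])
  have rp: "C r p = C q q" using assms(3) sym[of p r] by simp
  show "7 * m p + 7 * m q + 7 * m r \<le> 78 * t"
    using opposite_cost[OF T assms(2)] path_cost[OF tri_perm(4)[OF T] assms(4) rp] dom_cost[OF tri_perm(4)[OF T] assms(4)]
      loop_cost[OF T] m_nonneg[of p] m_nonneg[of q] m_nonneg[of r] t_nonneg
    unfolding le_mins by argo
qed

lemma edges_one_opposite_dominating:
  assumes T: "tri p q r" and "C p q = C r r" "C p r = C p p" "C q r = C q q"
  shows "7 * sum m P \<le> 78 * t"
proof (rule sum_boundI[OF T])
  show "7 * m p + 7 * m q + 7 * m r \<le> 78 * t"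
    using opposite_cost[OF T assms(2)] dom_cost[OF tri_perm(2)[OF T] assms(3)] dom_cost[OF tri_perm(4)[OF T] assms(4)]
      loop_cost[OF T] m_nonneg[of p] m_nonneg[of q] m_nonneg[of r] t_nonneg
    unfolding le_mins by argo
qed

text \<open>Here a single colour contains all edges and the loop at \<open>r\<close>. Pairs \<open>p\<close>,
\<open>q\<close> are tiled first; what is left of the larger part \<open>p\<close> is covered by
tiles with both centres in \<open>r\<close>.\<close>

lemma edges_one_opposite_dominated_le:
  assumes T: "tri p q r" and C: "C p q = C r r" "C p r = C r r" "C q r = C r r" and le: "m q \<le> m p"
  shows "7 * sum m P \<le> 78 * t"
proof (rule sum_boundI[OF T])
  have rp: "C r p = C r r" and rq: "C r q = C r r" and qp: "C q p = C r r" using C sym by metis+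
  define W where "W = w (C r r)"
  have W: "W a \<ge> 0" for a by (simp add: W_def w_nonneg)
  note cov = ds_coverD[OF cover[of "C r r"], folded W_def]
  have 1: "2 * W r + 5 * W p \<ge> 1" using cov[OF refl rp rp, unfolded rp] cov[of r r p p] rp by simp
  have 2: "3 * W q + 4 * W p \<ge> 1" using cov[of p q q p] C(1) qp by simp
  have 3: "4 * W q + 3 * W p \<ge> 1" using cov[of q p p q] C(1) qp by simp
  have 4: "7 * W r \<ge> 1" using cov[of r r r r] by simp
  have cost: "m p * W p + m q * W q + m r * W r \<le> t"
    using cst[OF T, of "C r r"] by (simp add: W_def)
  note nonneg = m_nonneg[of p] m_nonneg[of q] m_nonneg[of r] t_nonneg
  consider "5 * m r / 2 + 4 * m q / 3 \<le> m p" | "4 * m q / 3 \<le> m p" "m p \<le> 5 * m r / 2 + 4 * m q / 3"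
    | "m p \<le> 4 * m q / 3" by linarith
  then have "m r / 2 + m q / 3 \<le> t \<or> (m p + m q + m r) / 7 \<le> t"
  proof cases
    case a: 1
    have "m r / 2 \<le> m r / 2 * (2 * W r + 5 * W p)" by (intro le_mult_ge_one) (use 1 nonneg in auto)
    moreover have "m q / 3 \<le> m q / 3 * (3 * W q + 4 * W p)" by (intro le_mult_ge_one) (use 2 nonneg in auto)
    moreover have "0 \<le> (m p - 5 * m r / 2 - 4 * m q / 3) * W p" using a W by (intro mult_nonneg_nonneg) auto
    moreover have "m r / 2 * (2 * W r + 5 * W p) + m q / 3 * (3 * W q + 4 * W p)
       + (m p - 5 * m r / 2 - 4 * m q / 3) * W p = m p * W p + m q * W q + m r * W r"
      by (simp add: field_simps)
    ultimately show ?thesis using cost by linarith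
  next
    case b: 2
    define e where "e = m p - 4 * m q / 3"
    have "e / 5 \<le> e / 5 * (2 * W r + 5 * W p)" by (intro le_mult_ge_one) (use 1 b in \<open>auto simp: e_def\<close>)
    moreover have "m q / 3 \<le> m q / 3 * (3 * W q + 4 * W p)" by (intro le_mult_ge_one) (use 2 nonneg in auto)
    moreover have "(m r - 2 * e / 5) / 7 \<le> (m r - 2 * e / 5) / 7 * (7 * W r)"
      by (intro le_mult_ge_one) (use 4 b in \<open>auto simp: e_def field_simps\<close>)
    moreover have "e / 5 * (2 * W r + 5 * W p) + m q / 3 * (3 * W q + 4 * W p) + (m r - 2 * e / 5) / 7 * (7 * W r)
       = m p * W p + m q * W q + m r * W r"
      by (simp add: field_simps e_def)
    moreover have "e / 5 + m q / 3 + (m r - 2 * e / 5) / 7 = (m p + m q + m r) / 7"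
      by (simp add: field_simps e_def)
    ultimately show ?thesis using cost by linarith
  next
    case c: 3
    have "(4 * m p - 3 * m q) / 7 \<le> (4 * m p - 3 * m q) / 7 * (4 * W p + 3 * W q)"
      by (intro le_mult_ge_one) (use 2 le nonneg in auto)
    moreover have "(4 * m q - 3 * m p) / 7 \<le> (4 * m q - 3 * m p) / 7 * (3 * W p + 4 * W q)"
      by (intro le_mult_ge_one) (use 3 c in auto)
    moreover have "(4 * m p - 3 * m q) / 7 * (4 * W p + 3 * W q) + (4 * m q - 3 * m p) / 7 * (3 * W p + 4 * W q)
       = m p * W p + m q * W q" by (simp add: field_simps)
    moreover have "m r / 7 \<le> m r / 7 * (7 * W r)" by (intro le_mult_ge_one) (use 4 nonneg in auto)
    moreover have "m r / 7 * (7 * W r) = m r * W r" by simp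
    moreover have "(4 * m p - 3 * m q) / 7 + (4 * m q - 3 * m p) / 7 + m r / 7 = (m p + m q + m r) / 7"
      by (simp add: field_simps)
    ultimately show ?thesis using cost by linarith
  qed
  then show "7 * m p + 7 * m q + 7 * m r \<le> 78 * t"
    using loop_cost[OF T] nonneg by argo
qed

lemma edges_one_opposite_dominated:
  assumes T: "tri p q r" and C: "C p q = C r r" "C p r = C r r" "C q r = C r r"
  shows "7 * sum m P \<le> 78 * t"
proof (cases "m q \<le> m p")
  case True then show ?thesis using edges_one_opposite_dominated_le[OF T C] by simp
next
  case False
  then have "m p \<le> m q" by simp
  then show ?thesis using edges_one_opposite_dominated_le[OF tri_perm(1)[OF T] _ C(3,2)] C(1) sym by metis
qed

lemma edges_one_opposite_chain:
  assumes T: "tri p q r" and "C p q = C r r" "C p r = C p p" "C q r = C r r"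
  shows "7 * sum m P \<le> 78 * t"
proof (rule sum_boundI[OF T])
  have rq: "C r q = C r r" using assms(4) sym by metis
  show "7 * m p + 7 * m q + 7 * m r \<le> 78 * t"
    using opposite_cost[OF T assms(2)] dom_cost[OF tri_perm(2)[OF T] assms(3)] dom_cost[OF tri_perm(3)[OF T] rq]
      loop_cost[OF T] m_nonneg[of p] m_nonneg[of q] m_nonneg[of r] t_nonneg
    unfolding le_mins by argo
qed

lemma edges_transitive:
  assumes T: "tri p q r" and "C p q = C p p" "C p r = C p p" "C q r = C q q"
  shows "7 * sum m P \<le> 78 * t"
proof (rule sum_boundI[OF T])
  show "7 * m p + 7 * m q + 7 * m r \<le> 78 * t"
    using dom2_cost[OF T assms(2,3)] dom_cost[OF tri_perm(4)[OF T] assms(4)]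
      loop_cost[OF T] m_nonneg[of p] m_nonneg[of q] m_nonneg[of r] t_nonneg
    unfolding le_mins by argo
qed

lemma edges_cyclic:
  assumes T: "tri p q r" and "C p q = C p p" "C q r = C q q" "C r p = C r r"
  shows "7 * sum m P \<le> 78 * t"
proof (rule sum_boundI[OF T])
  show "7 * m p + 7 * m q + 7 * m r \<le> 78 * t"
    using dom_cost[OF T assms(2)] dom_cost[OF tri_perm(4)[OF T] assms(3)] dom_cost[OF tri_perm(5)[OF T] assms(4)]
      loop_cost[OF T] m_nonneg[of p] m_nonneg[of q] m_nonneg[of r] t_nonneg
    unfolding le_mins by argo
qed

lemma all_loops_equal:
  assumes "tri p q r" "C p p = C q q" "C q q = C r r"
  shows "7 * sum m P \<le> 78 * t"
  using two_loops_cost[OF assms(1,2)] two_loops_cost[OF tri_perm(4)[OF assms(1)] assms(3)] loopW[of p] loopW[of q] loopW[of r]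
    tri_cost[OF assms(1), of "C p p"] t_nonneg tri_sum[OF assms(1), of m]
  unfolding assms(2,3) by argo

lemma two_loops_equal:
  assumes T: "tri p q r" and eq: "C p p = C q q" and o: "\<forall>a\<in>{p, q}. C a r = C p p \<or> C a r = C r r \<or> C a r = k"
  shows "7 * sum m P \<le> 78 * t"
proof -
  note S = tri_perm(1)[OF T]
  consider "C p r = C p p" | "C q r = C q q" | "C p r = C r r" | "C q r = C r r" | "C p r = C q r"
    using o eq by auto
  then show ?thesis
  proof cases
    case 1 then show ?thesis by (rule two_loops_dominating[OF T eq])
  next
    case 2 then show ?thesis by (rule two_loops_dominating[OF S eq[symmetric]])
  next
    case 3 then show ?thesis by (rule two_loops_dominated[OF T eq])
  next
    case 4 then show ?thesis by (rule two_loops_dominated[OF S eq[symmetric]])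
  next
    case 5 then show ?thesis by (rule two_loops_bipartite[OF T eq])
  qed
qed

text \<open>The \<open>27\<close> colourings of the edges fall into seven classes under permutation of the
vertices.\<close>

lemma distinct_loops:
  assumes T: "tri p q r"
    and C: "C p q \<in> {C p p, C q q, C r r}" "C p r \<in> {C p p, C q q, C r r}" "C q r \<in> {C p p, C q q, C r r}"
  shows "7 * sum m P \<le> 78 * t"
proof -
  note T' = T tri_perm[OF T]
  have S: "C q p = C p q" "C r p = C p r" "C r q = C q r" using sym by auto
  note L0 = T'[THEN edges_all_opposite] T'[THEN edges_two_opposite] T'[THEN edges_one_opposite_dominating] T'[THEN edges_one_opposite_dominated] T'[THEN edges_one_opposite_chain] T'[THEN edges_transitive] T'[THEN edges_cyclic]
  note L = L0[unfolded S]
  show ?thesis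
    using C unfolding insert_iff empty_iff
    by - (elim disjE FalseE, (rule L; assumption)+)
qed

theorem three_types:
  assumes T: "tri p q r" and K: "\<forall>a\<in>P. \<forall>b\<in>P. C a b \<in> {k, l, j}"
  shows "7 * sum m P \<le> 78 * t"
proof -
  have P: "p \<in> P" "q \<in> P" "r \<in> P" using T by (auto simp: tri_def)
  have S: "C q p = C p q" "C r p = C p r" "C r q = C q r" using sym by auto
  have third: "\<exists>d. \<forall>a\<in>P. \<forall>b\<in>P. C a b = x \<or> C a b = y \<or> C a b = d" if "x \<noteq> y" "x \<in> {k, l, j}" "y \<in> {k, l, j}" for x y
    using third_element[OF that] K by meson
  consider "C p p = C q q" "C q q = C r r" | "C p p = C q q" "C p p \<noteq> C r r" | "C p p = C r r" "C p p \<noteq> C q q"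
    | "C q q = C r r" "C q q \<noteq> C p p" | "C p p \<noteq> C q q" "C p p \<noteq> C r r" "C q q \<noteq> C r r"
    using three_eq_cases[of "C p p" "C q q" "C r r"] by argo
  then show ?thesis
  proof cases
    case 1 then show ?thesis using all_loops_equal[OF T] by blast
  next
    case 2
    obtain d where "\<forall>a\<in>P. \<forall>b\<in>P. C a b = C p p \<or> C a b = C r r \<or> C a b = d" using third[OF 2(2)] K P by blast
    then show ?thesis using two_loops_equal[OF T 2(1), of d] P by blast
  next
    case 3
    obtain d where "\<forall>a\<in>P. \<forall>b\<in>P. C a b = C p p \<or> C a b = C q q \<or> C a b = d" using third[OF 3(2)] K P by blast
    then show ?thesis using two_loops_equal[OF tri_perm(2)[OF T] 3(1), of d] P by blast
  next
    case 4
    obtain d where "\<forall>a\<in>P. \<forall>b\<in>P. C a b = C q q \<or> C a b = C p p \<or> C a b = d" using third[OF 4(2)] K P by blast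
    then show ?thesis using two_loops_equal[OF tri_perm(4)[OF T] 4(1), of d] P by blast
  next
    case 5
    have "{C p p, C q q, C r r} \<subseteq> {k, l, j}" using K P by blast
    then have "{C p p, C q q, C r r} = {k, l, j}" using three_distinct_elements[OF 5] by simp
    then have mem: "C a b \<in> {C p p, C q q, C r r}" if "a \<in> P" "b \<in> P" for a b
      using K that by simp
    show ?thesis by (rule distinct_loops[OF T]) (intro mem P)+
  qed
qed

end

section \<open>A regularity lemma for holes\<close>

text \<open>A one-sided form of regularity: the relation has no hole of relative size \<open>\<delta>\<close>.
This is what a greedy embedding of trees uses.\<close>

definition rich :: "real \<Rightarrow> ('a \<Rightarrow> 'a \<Rightarrow> bool) \<Rightarrow> 'a set \<Rightarrow> 'a set \<Rightarrow> bool" where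
  "rich \<delta> E X Y \<longleftrightarrow> (\<forall>A\<subseteq>X. \<forall>B\<subseteq>Y. \<delta> * real (card X) \<le> real (card A) \<longrightarrow>
     \<delta> * real (card Y) \<le> real (card B) \<longrightarrow> (\<exists>a\<in>A. \<exists>b\<in>B. E a b))"

lemma richD:
  assumes "rich \<delta> E X Y" "A \<subseteq> X" "B \<subseteq> Y" "\<delta> * real (card X) \<le> real (card A)" "\<delta> * real (card Y) \<le> real (card B)"
  shows "\<exists>a\<in>A. \<exists>b\<in>B. E a b"
  using assms(1)[unfolded rich_def, rule_format, OF assms(2-5)] .

text \<open>The partition is represented by a family \<open>F\<close> of sets; refining it means adding sets
to \<open>F\<close>, and the parts are the classes of vertices that lie in the same members of
\<open>F\<close>.\<close>

definition atom :: "'a set \<Rightarrow> 'a set set \<Rightarrow> 'a \<Rightarrow> 'a set" where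
  "atom V F x = {y\<in>V. \<forall>A\<in>F. x \<in> A \<longleftrightarrow> y \<in> A}"

lemma atom_self: "x \<in> V \<Longrightarrow> x \<in> atom V F x"
  by (simp add: atom_def)

lemma atom_subset: "atom V F x \<subseteq> V"
  by (auto simp: atom_def)

lemma atom_eq: "y \<in> atom V F x \<Longrightarrow> atom V F y = atom V F x"
  unfolding atom_def by blast

lemma atom_mono: "F \<subseteq> F' \<Longrightarrow> atom V F' x \<subseteq> atom V F x"
  by (auto simp: atom_def)

lemma atom_in: "A \<in> F \<Longrightarrow> x \<in> A \<Longrightarrow> atom V F x \<subseteq> A"
  by (auto simp: atom_def)

lemma atom_disjoint: "atom V F x \<noteq> atom V F y \<Longrightarrow> atom V F x \<inter> atom V F y = {}"
  by (metis atom_eq disjoint_iff)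

lemma card_atoms:
  assumes "finite F"
  shows "finite (atom V F ` V)" "card (atom V F ` V) \<le> 2 ^ card F"
proof -
  have eq: "atom V F ` V = (\<lambda>S. {y\<in>V. \<forall>A\<in>F. A \<in> S \<longleftrightarrow> y \<in> A}) ` ((\<lambda>x. {A\<in>F. x \<in> A}) ` V)"
    unfolding image_image by (rule image_cong) (auto simp: atom_def)
  have sub: "(\<lambda>x. {A\<in>F. x \<in> A}) ` V \<subseteq> Pow F" by auto
  have fin: "finite ((\<lambda>x. {A\<in>F. x \<in> A}) ` V)" by (rule finite_subset[OF sub]) (use assms in simp)
  show "finite (atom V F ` V)" unfolding eq using fin by simp
  have "card (atom V F ` V) \<le> card ((\<lambda>x. {A\<in>F. x \<in> A}) ` V)" unfolding eq by (rule card_image_le[OF fin])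
  also have "\<dots> \<le> card (Pow F)" by (rule card_mono[OF _ sub]) (use assms in simp)
  finally show "card (atom V F ` V) \<le> 2 ^ card F" using assms by (simp add: card_Pow)
qed

definition poor_pairs :: "'a set \<Rightarrow> nat \<Rightarrow> ('a \<Rightarrow> 'a \<Rightarrow> nat) \<Rightarrow> real \<Rightarrow> 'a set set \<Rightarrow> ('a \<times> 'a) set" where
  "poor_pairs V k col \<delta> F =
    {(x, y) \<in> V \<times> V. \<not> (\<exists>c<k. rich \<delta> (\<lambda>a b. col a b = c) (atom V F x) (atom V F y))}"

text \<open>The size of this set serves as the potential in the regularity lemma. It can only grow under
refinement, because a colour that is absent between two atoms is absent between their subsets.\<close>

definition free_triples :: "'a set \<Rightarrow> nat \<Rightarrow> ('a \<Rightarrow> 'a \<Rightarrow> nat) \<Rightarrow> 'a set set \<Rightarrow> (nat \<times> 'a \<times> 'a) set" where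
  "free_triples V k col F =
    {(c, x, y) \<in> {..<k} \<times> V \<times> V. \<forall>a\<in>atom V F x. \<forall>b\<in>atom V F y. col a b \<noteq> c}"

lemma card_free_triples:
  assumes "finite V"
  shows "finite (free_triples V k col F)" "card (free_triples V k col F) \<le> k * card V ^ 2"
proof -
  have sub: "free_triples V k col F \<subseteq> {..<k} \<times> V \<times> V" by (auto simp: free_triples_def)
  show "finite (free_triples V k col F)" by (rule finite_subset[OF sub]) (use assms in simp)
  have "card (free_triples V k col F) \<le> card ({..<k} \<times> V \<times> V)" by (rule card_mono[OF _ sub]) (use assms in simp)
  then show "card (free_triples V k col F) \<le> k * card V ^ 2"
    by (simp add: card_cartesian_product power2_eq_square)
qed

text \<open>For a pair of atoms without a rich colour, take a colour that occurs between them. It has a hole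
of relative size \<open>\<delta>\<close>. After the two sides of the hole are added to
\<open>F\<close>, the colour becomes absent between the atoms inside the hole, and the potential
grows by the area of the hole.\<close>

lemma refine_holes:
  assumes V: "finite V" and F: "finite F" and col: "\<forall>x\<in>V. \<forall>y\<in>V. col x y < k" and \<delta>: "\<delta> > 0"
  shows "\<exists>F'. finite F' \<and> card F' \<le> card F + 2 * (2 ^ card F) ^ 2 \<and>
    real (card (free_triples V k col F)) + \<delta>\<^sup>2 * real (card (poor_pairs V k col \<delta> F)) \<le> real (card (free_triples V k col F'))"
proof -
  define P where "P = atom V F ` V"
  have P: "finite P" "card P \<le> 2 ^ card F" using card_atoms[OF F] by (auto simp: P_def)
  define bad where "bad = {(X, Y) \<in> P \<times> P. \<not> (\<exists>c<k. rich \<delta> (\<lambda>a b. col a b = c) X Y)}"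
  have bad: "finite bad" "card bad \<le> (2 ^ card F) ^ 2"
  proof -
    have sub: "bad \<subseteq> P \<times> P" by (auto simp: bad_def)
    show "finite bad" by (rule finite_subset[OF sub]) (use P in simp)
    have "card bad \<le> card (P \<times> P)" by (rule card_mono[OF _ sub]) (use P in simp)
    also have "\<dots> = card P ^ 2" by (simp add: card_cartesian_product power2_eq_square)
    also have "\<dots> \<le> (2 ^ card F) ^ 2" using P by (intro power_mono) auto
    finally show "card bad \<le> (2 ^ card F) ^ 2" .
  qed
  have P_fin: "finite X" if "X \<in> P" for X
    using that V atom_subset[of V F] finite_subset by (fastforce simp: P_def)
  have P_disj: "X \<inter> Y = {}" if XY: "X \<in> P" "Y \<in> P" "X \<noteq> Y" for X Y
    proof -
    obtain x y where "X = atom V F x" "Y = atom V F y" using XY(1,2) unfolding P_def by blast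
    then show ?thesis using XY(3) atom_disjoint[of V F x y] by simp
  qed
  have P_atom: "atom V F x = X" if "X \<in> P" "x \<in> X" for X x
    using that atom_eq by (fastforce simp: P_def)
  have P_sub: "X \<subseteq> V" if "X \<in> P" for X using that by (auto simp: P_def atom_def)
  \<comment> \<open>a hole of a colour that does occur between the two atoms\<close>
  have "\<exists>c A B. c < k \<and> (\<exists>a\<in>fst q. \<exists>b\<in>snd q. col a b = c) \<and> A \<subseteq> fst q \<and> B \<subseteq> snd q \<and>
      \<delta> * real (card (fst q)) \<le> real (card A) \<and> \<delta> * real (card (snd q)) \<le> real (card B) \<and>
      (\<forall>a\<in>A. \<forall>b\<in>B. col a b \<noteq> c)" if q: "q \<in> bad" for q
  proof -
    obtain X Y where XY: "q = (X, Y)" "X \<in> P" "Y \<in> P" by (use q in \<open>auto simp: bad_def\<close>)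
    then obtain x y where xy: "x \<in> X" "y \<in> Y" using atom_self by (fastforce simp: P_def)
    have "col x y < k" using xy XY col P_sub by blast
    then have "\<not> rich \<delta> (\<lambda>a b. col a b = col x y) X Y" using q XY by (auto simp: bad_def)
    then obtain A B where "A \<subseteq> X" "B \<subseteq> Y" "\<delta> * real (card X) \<le> real (card A)" "\<delta> * real (card Y) \<le> real (card B)"
       "\<forall>a\<in>A. \<forall>b\<in>B. col a b \<noteq> col x y" unfolding rich_def by blast
    then show ?thesis using \<open>col x y < k\<close> xy XY by (intro exI[of _ "col x y"] exI[of _ A] exI[of _ B]) auto
  qed
  then obtain c A B where hole: "\<And>q. q \<in> bad \<Longrightarrow> c q < k \<and> (\<exists>a\<in>fst q. \<exists>b\<in>snd q. col a b = c q) \<and> A q \<subseteq> fst q \<and> B q \<subseteq> snd q \<and>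
      \<delta> * real (card (fst q)) \<le> real (card (A q)) \<and> \<delta> * real (card (snd q)) \<le> real (card (B q)) \<and>
      (\<forall>a\<in>A q. \<forall>b\<in>B q. col a b \<noteq> c q)" by metis
  have hole_colour: "c q < k" "\<exists>a\<in>fst q. \<exists>b\<in>snd q. col a b = c q"
    and hole_sub: "A q \<subseteq> fst q" "B q \<subseteq> snd q"
    and hole_card: "\<delta> * real (card (fst q)) \<le> real (card (A q))" "\<delta> * real (card (snd q)) \<le> real (card (B q))"
    and hole_free: "\<And>a b. a \<in> A q \<Longrightarrow> b \<in> B q \<Longrightarrow> col a b \<noteq> c q" if "q \<in> bad" for q
    using hole[OF that] by simp_all
  define F' where "F' = F \<union> (A ` bad \<union> B ` bad)"
  have "finite F'" using F bad by (simp add: F'_def)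
  moreover have "card F' \<le> card F + 2 * (2 ^ card F) ^ 2"
  proof -
    have "card F' \<le> card F + (card (A ` bad) + card (B ` bad))"
      unfolding F'_def by (meson card_Un_le add_left_mono order_trans)
    also have "\<dots> \<le> card F + (card bad + card bad)"
      using bad(1) by (intro add_mono card_image_le) auto
    finally show ?thesis using bad(2) by simp
  qed
  moreover have "real (card (free_triples V k col F)) + \<delta>\<^sup>2 * real (card (poor_pairs V k col \<delta> F)) \<le> real (card (free_triples V k col F'))"
  proof -
    define N where "N = (\<lambda>q. {c q} \<times> A q \<times> B q)"
    have fqP: "fst q \<in> P" "snd q \<in> P" if "q \<in> bad" for q using that by (auto simp: bad_def)
    have finAB: "finite (A q)" "finite (B q)" if "q \<in> bad" for q
      using hole_sub[OF that] fqP[OF that] P_fin by (meson finite_subset)+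
    have disjN: "N q \<inter> N q' = {}" if "q \<in> bad" "q' \<in> bad" "q \<noteq> q'" for q q'
    proof -
      have "fst q \<noteq> fst q' \<or> snd q \<noteq> snd q'" using that(3) by (simp add: prod_eq_iff)
      then have "fst q \<inter> fst q' = {} \<or> snd q \<inter> snd q' = {}"
        using P_disj fqP that by meson
      moreover have "A q \<subseteq> fst q" "B q \<subseteq> snd q" "A q' \<subseteq> fst q'" "B q' \<subseteq> snd q'"
        using hole_sub that by simp_all
      ultimately have "A q \<inter> A q' = {} \<or> B q \<inter> B q' = {}" by blast
      then show ?thesis by (auto simp: N_def)
    qed
    have cardN: "\<delta>\<^sup>2 * real (card (fst q) * card (snd q)) \<le> real (card (N q))" if "q \<in> bad" for q
    proof -
      have "(\<delta> * real (card (fst q))) * (\<delta> * real (card (snd q))) \<le> real (card (A q)) * real (card (B q))"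
        using hole_card[OF that] \<delta> by (intro mult_mono) auto
      then show ?thesis by (simp add: N_def card_cartesian_product power2_eq_square mult_ac)
    qed
    have sub: "free_triples V k col F \<union> (\<Union>q\<in>bad. N q) \<subseteq> free_triples V k col F'"
    proof (rule Un_least)
      have "F \<subseteq> F'" by (auto simp: F'_def)
      then have mono: "atom V F' x \<subseteq> atom V F x" for x by (rule atom_mono)
      show "free_triples V k col F \<subseteq> free_triples V k col F'"
      proof
        fix z assume z: "z \<in> free_triples V k col F"
        obtain d x y where dxy: "z = (d, x, y)" by (cases z)
        have *: "d < k" "x \<in> V" "y \<in> V" "\<forall>a\<in>atom V F x. \<forall>b\<in>atom V F y. col a b \<noteq> d"
          using z unfolding dxy free_triples_def by simp_all
        have "\<forall>a\<in>atom V F' x. \<forall>b\<in>atom V F' y. col a b \<noteq> d" using *(4) mono by blast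
        then show "z \<in> free_triples V k col F'" using * unfolding dxy free_triples_def by simp
      qed
      show "(\<Union>q\<in>bad. N q) \<subseteq> free_triples V k col F'"
      proof (rule UN_least)
        fix q assume q: "q \<in> bad"
        have AF: "A q \<in> F'" "B q \<in> F'" using q by (auto simp: F'_def)
        have "A q \<subseteq> V" "B q \<subseteq> V" using hole_sub[OF q] P_sub[OF fqP(1)[OF q]] P_sub[OF fqP(2)[OF q]] by simp_all
        show "N q \<subseteq> free_triples V k col F'"
        proof
          fix z assume "z \<in> N q"
          then obtain x y where z: "z = (c q, x, y)" "x \<in> A q" "y \<in> B q" by (auto simp: N_def)
          have "atom V F' x \<subseteq> A q" "atom V F' y \<subseteq> B q"
            using atom_in[OF AF(1) z(2)] atom_in[OF AF(2) z(3)] by auto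
          then have "\<forall>a\<in>atom V F' x. \<forall>b\<in>atom V F' y. col a b \<noteq> c q" using hole_free[OF q] by blast
          then show "z \<in> free_triples V k col F'"
            using z(2,3) hole_colour(1)[OF q] \<open>A q \<subseteq> V\<close> \<open>B q \<subseteq> V\<close> unfolding z(1) free_triples_def
            by (simp add: subset_iff)
        qed
      qed
    qed
    have disj: "free_triples V k col F \<inter> (\<Union>q\<in>bad. N q) = {}"
    proof -
      have False if "q \<in> bad" "(d, x, y) \<in> N q" "(d, x, y) \<in> free_triples V k col F" for q d x y
      proof -
        have "x \<in> A q" "y \<in> B q" "d = c q" using that(2) by (auto simp: N_def)
        then have "x \<in> fst q" "y \<in> snd q" "d = c q" using hole_sub[OF that(1)] by auto
        then have "atom V F x = fst q" "atom V F y = snd q" using P_atom fqP[OF that(1)] by auto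
        moreover have "\<forall>a\<in>atom V F x. \<forall>b\<in>atom V F y. col a b \<noteq> d" using that(3) by (simp add: free_triples_def)
        moreover have "\<exists>a\<in>fst q. \<exists>b\<in>snd q. col a b = d" using hole_colour(2)[OF that(1)] \<open>d = c q\<close> by simp
        ultimately show False by simp
      qed
      then show ?thesis by fastforce
    qed
    have finN: "finite (N q)" if "q \<in> bad" for q using finAB[OF that] by (simp add: N_def)
    have "poor_pairs V k col \<delta> F \<subseteq> (\<Union>q\<in>bad. fst q \<times> snd q)"
    proof
      fix p assume "p \<in> poor_pairs V k col \<delta> F"
      then obtain x y where p: "p = (x, y)" "x \<in> V" "y \<in> V"
        "\<not> (\<exists>c<k. rich \<delta> (\<lambda>a b. col a b = c) (atom V F x) (atom V F y))" by (auto simp: poor_pairs_def)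
      then have "(atom V F x, atom V F y) \<in> bad" by (simp add: bad_def P_def)
      moreover have "p \<in> fst (atom V F x, atom V F y) \<times> snd (atom V F x, atom V F y)"
        using p(1) atom_self[OF p(2)] atom_self[OF p(3)] by simp
      ultimately show "p \<in> (\<Union>q\<in>bad. fst q \<times> snd q)" by (rule UN_I)
    qed
    then have "card (poor_pairs V k col \<delta> F) \<le> card (\<Union>q\<in>bad. fst q \<times> snd q)"
      using bad(1) fqP P_fin by (intro card_mono) auto
    also have "\<dots> \<le> (\<Sum>q\<in>bad. card (fst q) * card (snd q))"
      using card_UN_le[OF bad(1), of "\<lambda>q. fst q \<times> snd q"] by (simp add: card_cartesian_product)
    finally have "\<delta>\<^sup>2 * real (card (poor_pairs V k col \<delta> F)) \<le> \<delta>\<^sup>2 * real (\<Sum>q\<in>bad. card (fst q) * card (snd q))"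
      by (intro mult_left_mono) (auto simp del: of_nat_sum)
    also have "\<dots> = (\<Sum>q\<in>bad. \<delta>\<^sup>2 * real (card (fst q) * card (snd q)))"
      by (simp add: sum_distrib_left)
    also have "\<dots> \<le> (\<Sum>q\<in>bad. real (card (N q)))" by (rule sum_mono) (rule cardN)
    also have "\<dots> = real (card (\<Union>q\<in>bad. N q))"
      using bad(1) finN disjN by (subst card_UN_disjoint) auto
    finally have "real (card (free_triples V k col F)) + \<delta>\<^sup>2 * real (card (poor_pairs V k col \<delta> F))
        \<le> real (card (free_triples V k col F) + card (\<Union>q\<in>bad. N q))" by simp
    also have "card (free_triples V k col F) + card (\<Union>q\<in>bad. N q) = card (free_triples V k col F \<union> (\<Union>q\<in>bad. N q))"
      using disj bad(1) finN card_free_triples(1)[OF V] by (subst card_Un_disjoint) auto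
    also have "real \<dots> \<le> real (card (free_triples V k col F'))"
      using card_mono[OF card_free_triples(1)[OF V] sub] by simp
    finally show ?thesis .
  qed
  ultimately show ?thesis by blast
qed

primrec refinement_size :: "nat \<Rightarrow> nat" where
  "refinement_size 0 = 0"
| "refinement_size (Suc i) = refinement_size i + 2 * (2 ^ refinement_size i) ^ 2"

text \<open>The potential is at most \<open>k |V|^2\<close> and each refinement increases it by at least
\<open>\<delta>^2 \<epsilon> |V|^2\<close>, so the process stops after a bounded number of steps.\<close>

lemma hole_regularity:
  assumes "\<delta> > 0" "\<epsilon> > (0::real)"
  shows "\<exists>K. \<forall>(V::'a set) col. finite V \<longrightarrow> (\<forall>x\<in>V. \<forall>y\<in>V. col x y < k) \<longrightarrow>
    (\<exists>F. finite F \<and> card F \<le> K \<and> real (card (poor_pairs V k col \<delta> F)) \<le> \<epsilon> * real (card V) ^ 2)"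
proof -
  obtain j :: nat where j: "real j * (\<delta>\<^sup>2 * \<epsilon>) > real k"
    using reals_Archimedean3[of "\<delta>\<^sup>2 * \<epsilon>"] mult_pos_pos[OF zero_less_power[OF assms(1)] assms(2)] by blast
  show ?thesis
  proof (intro exI[of _ "refinement_size j"] allI impI)
    fix V :: "'a set" and col
    assume V: "finite V" and col: "\<forall>x\<in>V. \<forall>y\<in>V. col x y < k"
    let ?good = "\<lambda>F. real (card (poor_pairs V k col \<delta> F)) \<le> \<epsilon> * real (card V) ^ 2"
    have step: "(\<exists>F. finite F \<and> card F \<le> refinement_size i \<and> ?good F) \<or>
        (\<exists>F. finite F \<and> card F \<le> refinement_size i \<and> real i * (\<delta>\<^sup>2 * \<epsilon>) * real (card V) ^ 2 \<le> real (card (free_triples V k col F)))" for i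
    proof (induction i)
      case 0
      have "finite {} \<and> card {} \<le> refinement_size 0 \<and> real 0 * (\<delta>\<^sup>2 * \<epsilon>) * real (card V) ^ 2 \<le> real (card (free_triples V k col {}))"
        by simp
      then show ?case by blast
    next
      case (Suc i)
      show ?case
      proof (cases "\<exists>F. finite F \<and> card F \<le> refinement_size i \<and> ?good F")
        case True
        then obtain F where "finite F" "card F \<le> refinement_size i" "?good F" by blast
        then show ?thesis by (intro disjI1 exI[of _ F]) auto
      next
        case False
        then obtain F where F: "finite F" "card F \<le> refinement_size i"
          "real i * (\<delta>\<^sup>2 * \<epsilon>) * real (card V) ^ 2 \<le> real (card (free_triples V k col F))" using Suc.IH by blast
        then have poor: "real (card (poor_pairs V k col \<delta> F)) > \<epsilon> * real (card V) ^ 2" using False F(1,2) by (meson not_le)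
        obtain F' where F': "finite F'" "card F' \<le> card F + 2 * (2 ^ card F) ^ 2"
          "real (card (free_triples V k col F)) + \<delta>\<^sup>2 * real (card (poor_pairs V k col \<delta> F)) \<le> real (card (free_triples V k col F'))"
          using refine_holes[OF V F(1) col assms(1)] by blast
        have "card F + 2 * (2 ^ card F) ^ 2 \<le> refinement_size (Suc i)"
        proof -
          have "((2::nat) ^ card F) ^ 2 \<le> (2 ^ refinement_size i) ^ 2"
            using F(2) by (intro power_mono power_increasing) auto
          then show ?thesis using F(2) unfolding refinement_size.simps by linarith
        qed
        then have "card F' \<le> refinement_size (Suc i)" using F'(2) by linarith
        moreover have "\<delta>\<^sup>2 * (\<epsilon> * real (card V) ^ 2) \<le> \<delta>\<^sup>2 * real (card (poor_pairs V k col \<delta> F))"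
          using poor by (intro mult_left_mono) auto
        then have "real (Suc i) * (\<delta>\<^sup>2 * \<epsilon>) * real (card V) ^ 2 \<le> real (card (free_triples V k col F'))"
          using F(3) F'(3) by (simp add: algebra_simps)
        ultimately show ?thesis using F'(1) by blast
      qed
    qed
    show "\<exists>F. finite F \<and> card F \<le> refinement_size j \<and> ?good F"
    proof (cases "V = {}")
      case True
      then show ?thesis by (intro exI[of _ "{}"]) (simp add: poor_pairs_def)
    next
      case False
      then have "real (card V) ^ 2 > 0" using V by (simp add: card_gt_0_iff)
      then have "real k * real (card V) ^ 2 < real j * (\<delta>\<^sup>2 * \<epsilon>) * real (card V) ^ 2" using j by simp
      moreover have "real (card (free_triples V k col F)) \<le> real k * real (card V) ^ 2" for F
      proof -
        have "real (card (free_triples V k col F)) \<le> real (k * card V ^ 2)"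
          using card_free_triples(2)[OF V] by (simp only: of_nat_le_iff)
        then show ?thesis by simp
      qed
      ultimately have "\<not> real j * (\<delta>\<^sup>2 * \<epsilon>) * real (card V) ^ 2 \<le> real (card (free_triples V k col F))" for F
        by (metis not_less order_trans)
      then show ?thesis using step[of j] by blast
    qed
  qed
qed

section \<open>Double stars and packings\<close>

definition spans_star :: "('a \<Rightarrow> 'a \<Rightarrow> bool) \<Rightarrow> 'a set \<Rightarrow> bool" where
  "spans_star E S \<longleftrightarrow> (\<exists>u v a1 a2 b1 b2 b3. distinct [u, v, a1, a2, b1, b2, b3] \<and>
     S = {u, v, a1, a2, b1, b2, b3} \<and> E u v \<and> E u a1 \<and> E u a2 \<and> E v b1 \<and> E v b2 \<and> E v b3)"

lemma double_star_2_3: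
  "double_star 2 3 = ({0, 1, 2, 3, 4, 5, 6}, {{0, 1}, {0, 2}, {0, 3}, {1, 4}, {1, 5}, {1, 6}})"
proof -
  have "{..<2 + 2 + 3} = {0, 1, 2, 3, 4, 5, 6 :: nat}" by auto
  moreover have "{2..<2 + 2} = {2, 3 :: nat}" "{2 + 2..<2 + 2 + 3} = {4, 5, 6 :: nat}" by auto
  ultimately show ?thesis by (auto simp: double_star_def)
qed

lemma spans_star_copy:
  fixes \<chi> :: "nat set \<Rightarrow> nat"
  assumes S: "spans_star (\<lambda>x y. \<chi> {x, y} = c) S" "S \<subseteq> {..<n}"
  shows "\<exists>D\<in>copies (double_star 2 3) (colour_class (complete_graph n) \<chi> c). verts D = S"
proof -
  obtain u v a1 a2 b1 b2 b3 where d: "distinct [u, v, a1, a2, b1, b2, b3]"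
    and S': "S = {u, v, a1, a2, b1, b2, b3}"
    and E: "\<chi> {u, v} = c" "\<chi> {u, a1} = c" "\<chi> {u, a2} = c" "\<chi> {v, b1} = c" "\<chi> {v, b2} = c" "\<chi> {v, b3} = c"
    using S(1) unfolding spans_star_def by blast
  define f where "f = (\<lambda>i::nat. [u, v, a1, a2, b1, b2, b3] ! i)"
  define D where "D = (S, {{u, v}, {u, a1}, {u, a2}, {v, b1}, {v, b2}, {v, b3}})"
  have f: "f 0 = u" "f (Suc 0) = v" "f 2 = a1" "f 3 = a2" "f 4 = b1" "f 5 = b2" "f 6 = b3" by (simp_all add: f_def)
  have "bij_betw f {0, 1, 2, 3, 4, 5, 6} S"
    unfolding bij_betw_def S' using d by (auto simp: f inj_on_def)
  then have "graph_isomorphic (double_star 2 3) D"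
    unfolding graph_isomorphic_def double_star_2_3 D_def by (intro exI[of _ f]) (simp add: f)
  moreover have "edges D \<subseteq> edges (colour_class (complete_graph n) \<chi> c)"
    using d S(2) E unfolding D_def colour_class_def complete_graph_def S' by auto
  ultimately show ?thesis
    using S(2) by (intro bexI[of _ D]) (auto simp: copies_def D_def colour_class_def complete_graph_def)
qed

lemma packing_number_ge:
  fixes \<chi> :: "nat set \<Rightarrow> nat"
  assumes "finite \<S>" "\<forall>S\<in>\<S>. spans_star (\<lambda>x y. \<chi> {x, y} = c) S \<and> S \<subseteq> {..<n}" "pairwise disjnt \<S>"
  shows "card \<S> \<le> packing_number (double_star 2 3) (colour_class (complete_graph n) \<chi> c)"
proof -
  let ?G = "colour_class (complete_graph n) \<chi> c"
  have "\<forall>S\<in>\<S>. \<exists>D. D \<in> copies (double_star 2 3) ?G \<and> verts D = S"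
  proof
    fix S assume "S \<in> \<S>"
    then have "spans_star (\<lambda>x y. \<chi> {x, y} = c) S" "S \<subseteq> {..<n}" using assms(2) by simp_all
    then show "\<exists>D. D \<in> copies (double_star 2 3) ?G \<and> verts D = S"
      using spans_star_copy[of \<chi> c S n] unfolding Bex_def by simp
  qed
  from bchoice[OF this] obtain D where D0: "\<forall>S\<in>\<S>. D S \<in> copies (double_star 2 3) ?G \<and> verts (D S) = S" ..
  then have D: "D S \<in> copies (double_star 2 3) ?G" "verts (D S) = S" if "S \<in> \<S>" for S
    using that by simp_all
  have inj: "inj_on D \<S>" by (rule inj_on_inverseI[of _ verts]) (rule D(2))
  have "pairwise (\<lambda>C D. verts C \<inter> verts D = {}) (D ` \<S>)"
  proof (rule pairwiseI)
    fix C C' assume "C \<in> D ` \<S>" "C' \<in> D ` \<S>" "C \<noteq> C'"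
    then obtain S S' where S: "S \<in> \<S>" "S' \<in> \<S>" "C = D S" "C' = D S'" by blast
    then have "disjnt S S'" using pairwiseD[OF assms(3), of S S'] \<open>C \<noteq> C'\<close> by blast
    then show "verts C \<inter> verts C' = {}" using D(2)[OF S(1)] D(2)[OF S(2)] S(3,4) by (simp add: disjnt_def)
  qed
  moreover have "D ` \<S> \<subseteq> copies (double_star 2 3) ?G" using D(1) by (rule image_subsetI)
  ultimately have "D ` \<S> \<in> packings (double_star 2 3) ?G" by (simp add: packings_def)
  moreover have "finite (packings (double_star 2 3) ?G)"
    by (rule finite_packings) (simp_all add: colour_class_def finite_complete_graph)
  ultimately have "card (D ` \<S>) \<le> packing_number (double_star 2 3) ?G"
    unfolding packing_number_def by (intro Max_ge finite_imageI imageI)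
  then show ?thesis using inj by (simp add: card_image)
qed

lemma copies_finite:
  assumes "finite (verts G)" "finite (edges G)"
  shows "finite (copies H G)"
proof -
  have "copies H G \<subseteq> Pow (verts G) \<times> Pow (edges G)" by (auto simp: copies_def)
  then show ?thesis by (rule finite_subset) (use assms in simp)
qed

text \<open>Weak duality: the weights of disjoint copies add up.\<close>

lemma packing_number_le:
  fixes w :: "'b \<Rightarrow> real"
  assumes fin: "finite (verts G)" "finite (edges G)" and w: "\<And>v. w v \<ge> 0"
    and cover: "\<And>C. C \<in> copies H G \<Longrightarrow> 1 \<le> (\<Sum>v\<in>verts C. w v)"
  shows "real (packing_number H G) \<le> (\<Sum>v\<in>verts G. w v)"
proof -
  have "packing_number H G \<in> card ` packings H G"
    unfolding packing_number_def
    by (rule Max_in) (use finite_packings[OF fin, of H] empty_in_packings[of H G] in \<open>auto\<close>)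
  then obtain P where P: "P \<in> packings H G" "packing_number H G = card P" by blast
  then have sub: "P \<subseteq> copies H G" and dis: "pairwise (\<lambda>C D. verts C \<inter> verts D = {}) P"
    by (simp_all add: packings_def)
  have finP: "finite P" using sub copies_finite[OF fin] by (rule finite_subset)
  have vsub: "verts C \<subseteq> verts G" if "C \<in> P" for C
    using subsetD[OF sub that] by (simp add: copies_def)
  have finv: "finite (verts C)" if "C \<in> P" for C using vsub[OF that] fin(1) by (rule finite_subset)
  have "real (card P) = (\<Sum>C\<in>P. 1)" by simp
  also have "\<dots> \<le> (\<Sum>C\<in>P. \<Sum>v\<in>verts C. w v)" by (rule sum_mono) (use sub cover in blast)
  also have "\<dots> = (\<Sum>v\<in>(\<Union>C\<in>P. verts C). w v)"
    by (rule sum.UNION_disjoint[symmetric]) (use finP finv dis in \<open>auto simp: pairwise_def\<close>)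
  also have "\<dots> \<le> (\<Sum>v\<in>verts G. w v)"
    by (rule sum_mono2) (use fin vsub w in auto)
  finally show ?thesis using P(2) by simp
qed

lemma copy_spans_star:
  fixes G :: "'a sgraph"
  assumes "D \<in> copies (double_star 2 3) G"
  shows "spans_star (\<lambda>x y. {x, y} \<in> edges G) (verts D)" "verts D \<subseteq> verts G"
proof -
  have sub: "verts D \<subseteq> verts G" "edges D \<subseteq> edges G" and iso: "graph_isomorphic (double_star 2 3) D"
    using assms by (simp_all add: copies_def)
  show "verts D \<subseteq> verts G" by fact
  obtain f :: "nat \<Rightarrow> 'a" where f: "bij_betw f {0, 1, 2, 3, 4, 5, 6} (verts D)"
    "edges D = (\<lambda>e. f ` e) ` {{0, 1}, {0, 2}, {0, 3}, {1, 4}, {1, 5}, {1, 6}}"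
    using iso unfolding graph_isomorphic_def double_star_2_3 fst_conv snd_conv by blast
  have e: "{{f 0, f 1}, {f 0, f 2}, {f 0, f 3}, {f 1, f 4}, {f 1, f 5}, {f 1, f 6}} \<subseteq> edges G"
    using sub(2) unfolding f(2) by simp
  have inj: "inj_on f {0, 1, 2, 3, 4, 5, 6}" and img: "f ` {0, 1, 2, 3, 4, 5, 6} = verts D"
    using f(1) by (simp_all add: bij_betw_def)
  have "distinct (map f [0, 1, 2, 3, 4, 5, 6])"
    unfolding distinct_map using inj by simp
  then have d: "distinct [f 0, f 1, f 2, f 3, f 4, f 5, f 6]" by simp
  have v: "verts D = {f 0, f 1, f 2, f 3, f 4, f 5, f 6}" using img by auto
  show "spans_star (\<lambda>x y. {x, y} \<in> edges G) (verts D)"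
    unfolding spans_star_def
    by (rule exI[of _ "f 0"], rule exI[of _ "f 1"], rule exI[of _ "f 2"], rule exI[of _ "f 3"],
        rule exI[of _ "f 4"], rule exI[of _ "f 5"], rule exI[of _ "f 6"]) (use d v e in simp)
qed

lemma star_cover_bound:
  fixes w :: "nat \<Rightarrow> real"
  assumes w: "\<And>v. w v \<ge> 0"
    and cover: "\<And>u v a1 a2 b1 b2 b3. distinct [u, v, a1, a2, b1, b2, b3] \<Longrightarrow>
      \<chi> {u, v} = c \<Longrightarrow> \<chi> {u, a1} = c \<Longrightarrow> \<chi> {u, a2} = c \<Longrightarrow> \<chi> {v, b1} = c \<Longrightarrow> \<chi> {v, b2} = c \<Longrightarrow> \<chi> {v, b3} = c \<Longrightarrow>
      1 \<le> w u + w v + w a1 + w a2 + w b1 + w b2 + w b3"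
  shows "real (packing_number (double_star 2 3) (colour_class (complete_graph n) \<chi> c)) \<le> (\<Sum>v<n. w v)"
proof -
  let ?G = "colour_class (complete_graph n) \<chi> c"
  have "real (packing_number (double_star 2 3) ?G) \<le> (\<Sum>v\<in>verts ?G. w v)"
  proof (rule packing_number_le)
    show "finite (verts ?G)" "finite (edges ?G)" by (simp_all add: colour_class_def finite_complete_graph)
    fix D assume "D \<in> copies (double_star 2 3) ?G"
    from copy_spans_star(1)[OF this] obtain u v a1 a2 b1 b2 b3 where d: "distinct [u, v, a1, a2, b1, b2, b3]"
      and v: "verts D = {u, v, a1, a2, b1, b2, b3}"
      and e: "{u, v} \<in> edges ?G" "{u, a1} \<in> edges ?G" "{u, a2} \<in> edges ?G" "{v, b1} \<in> edges ?G" "{v, b2} \<in> edges ?G" "{v, b3} \<in> edges ?G"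
      unfolding spans_star_def by blast
    have "1 \<le> w u + w v + w a1 + w a2 + w b1 + w b2 + w b3"
      by (rule cover[OF d]) (use e in \<open>simp_all add: colour_class_def\<close>)
    also have "\<dots> = (\<Sum>x\<in>verts D. w x)" unfolding v using d by (simp add: add.assoc)
    finally show "1 \<le> (\<Sum>x\<in>verts D. w x)" .
  qed (rule w)
  then show ?thesis by (simp add: colour_class_def complete_graph_def)
qed

section \<open>The extremal colouring\<close>

text \<open>The parts are \<open>Y = {0, ..., y-1}\<close>, \<open>X = {y, ..., z-1}\<close> and
\<open>B\<close>, the set of all other vertices.\<close>

definition three_part_colouring :: "nat \<Rightarrow> nat \<Rightarrow> nat set \<Rightarrow> nat" where
  "three_part_colouring y z e =
    (if e \<subseteq> {..<y} then 2 else if e \<inter> {..<y} \<noteq> {} then 1 else if e \<inter> {..<z} \<noteq> {} then 2 else 3)"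

lemma three_part_colouring_pair:
  "three_part_colouring y z {a, b} = 1 \<longleftrightarrow> (a < y \<longleftrightarrow> \<not> b < y)"
  "three_part_colouring y z {a, b} = 2 \<longleftrightarrow> a < y \<and> b < y \<or> \<not> a < y \<and> \<not> b < y \<and> (a < z \<or> b < z)"
  "three_part_colouring y z {a, b} = 3 \<longleftrightarrow> \<not> a < y \<and> \<not> b < y \<and> \<not> a < z \<and> \<not> b < z"
  by (auto simp: three_part_colouring_def)

text \<open>In each colour the summand is a fractional cover. In colour 1 the edge between the centres has one
end in \<open>Y\<close>, and the leaves of its other end are in \<open>Y\<close> as well. In
colour 2 a copy that avoids \<open>Y\<close> has two vertices in \<open>X\<close>, since a single
vertex meets only some of its edges.\<close>

lemma three_part_packings:
  fixes y z n :: nat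
  defines "\<psi> \<equiv> three_part_colouring y z"
  defines "pn \<equiv> \<lambda>c. real (packing_number (double_star 2 3) (colour_class (complete_graph n) \<psi> c))"
  shows "pn 1 \<le> (\<Sum>v<n. if v < y then 1 / 3 else 0)"
    and "pn 2 \<le> (\<Sum>v<n. if v < y then 1 / 7 else if v < z then 1 / 2 else 0)"
    and "pn 3 \<le> (\<Sum>v<n. if v < y then 0 else if v < z then 0 else 1 / 7)"
proof -
  show "pn 1 \<le> (\<Sum>v<n. if v < y then 1 / 3 else 0)"
    unfolding pn_def
  proof (rule star_cover_bound, simp, unfold \<psi>_def three_part_colouring_pair)
    fix u v a1 a2 b1 b2 b3
    assume *: "u < y \<longleftrightarrow> \<not> v < y" "u < y \<longleftrightarrow> \<not> a1 < y" "u < y \<longleftrightarrow> \<not> a2 < y" "v < y \<longleftrightarrow> \<not> b1 < y" "v < y \<longleftrightarrow> \<not> b2 < y" "v < y \<longleftrightarrow> \<not> b3 < y"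
    define w :: "nat \<Rightarrow> real" where "w = (\<lambda>v. if v < y then 1 / 3 else 0)"
    have w: "w v \<ge> 0" "v < y \<Longrightarrow> w v = 1 / 3" for v by (simp_all add: w_def)
    have "1 \<le> w u + w v + w a1 + w a2 + w b1 + w b2 + w b3"
    proof (cases "u < y")
      case True
      then have "w u = 1 / 3" "w b1 = 1 / 3" "w b2 = 1 / 3" using * w(2) by simp_all
      then show ?thesis using w(1)[of v] w(1)[of a1] w(1)[of a2] w(1)[of b3] by linarith
    next
      case False
      then have "w v = 1 / 3" "w a1 = 1 / 3" "w a2 = 1 / 3" using * w(2) by simp_all
      then show ?thesis using w(1)[of u] w(1)[of b1] w(1)[of b2] w(1)[of b3] by linarith
    qed
    then show "1 \<le> (if u < y then 1 / 3 else 0) + (if v < y then 1 / 3 else 0) + (if a1 < y then 1 / 3 else 0) +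
      (if a2 < y then 1 / 3 else 0) + (if b1 < y then 1 / 3 else 0) + (if b2 < y then 1 / 3 else 0) + (if b3 < y then 1 / 3 else (0::real))"
      unfolding w_def .
  qed
  define w :: "nat \<Rightarrow> real" where "w = (\<lambda>v. if v < y then 1 / 7 else if v < z then 1 / 2 else 0)"
  have w: "w v \<ge> 0" "v < y \<Longrightarrow> w v = 1 / 7" "\<not> v < y \<Longrightarrow> v < z \<Longrightarrow> w v = 1 / 2" for v by (simp_all add: w_def)
  have "pn 2 \<le> (\<Sum>v<n. w v)"
    unfolding pn_def
  proof (rule star_cover_bound, rule w(1), unfold \<psi>_def three_part_colouring_pair)
    fix u v a1 a2 b1 b2 b3
    let ?e = "\<lambda>a b. a < y \<and> b < y \<or> \<not> a < y \<and> \<not> b < y \<and> (a < z \<or> b < z)"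
    assume *: "?e u v" "?e u a1" "?e u a2" "?e v b1" "?e v b2" "?e v b3"
    note nn = w(1)[of u] w(1)[of v] w(1)[of a1] w(1)[of a2] w(1)[of b1] w(1)[of b2] w(1)[of b3]
    show "1 \<le> w u + w v + w a1 + w a2 + w b1 + w b2 + w b3"
    proof (cases "u < y")
      case True
      then have "w u = 1 / 7" "w v = 1 / 7" "w a1 = 1 / 7" "w a2 = 1 / 7" "w b1 = 1 / 7" "w b2 = 1 / 7" "w b3 = 1 / 7"
        using * w(2) by simp_all
      then show ?thesis by linarith
    next
      case False
      then have ge: "\<not> u < y" "\<not> v < y" "\<not> a1 < y" "\<not> b1 < y" using * by simp_all
      consider "u < z" "v < z" | "u < z" "b1 < z" | "v < z" "a1 < z" using * ge by blast
      then show ?thesis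
      proof cases
        case 1 then show ?thesis using w(3)[of u] w(3)[of v] ge nn by linarith
      next
        case 2 then show ?thesis using w(3)[of u] w(3)[of b1] ge nn by linarith
      next
        case 3 then show ?thesis using w(3)[of a1] w(3)[of v] ge nn by linarith
      qed
    qed
  qed
  then show "pn 2 \<le> (\<Sum>v<n. if v < y then 1 / 7 else if v < z then 1 / 2 else 0)" unfolding w_def .
  show "pn 3 \<le> (\<Sum>v<n. if v < y then 0 else if v < z then 0 else 1 / 7)"
    unfolding pn_def
    by (rule star_cover_bound, simp, unfold \<psi>_def three_part_colouring_pair) simp
qed

lemma sum_lessThan_if:
  assumes "y \<le> n"
  shows "(\<Sum>v<n. if v < y then r else s) = real y * r + (real n - real y) * s"
proof -
  have "(\<Sum>v<n. if v < y then r else s) = (\<Sum>v\<in>{..<y} \<union> {y..<n}. if v < y then r else s)"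
    using assms by (simp add: ivl_disj_un)
  also have "\<dots> = (\<Sum>v<y. r) + (\<Sum>v\<in>{y..<n}. s)"
    by (subst sum.union_disjoint) auto
  finally show ?thesis using assms by (simp add: of_nat_diff)
qed

text \<open>The sizes \<open>21n/78\<close> and \<open>8n/78\<close> make the three covers of equal cost.\<close>

lemma Rt_upper:
  "real (Rt 3 (double_star 2 3) (complete_graph n)) \<le> 7 / 78 * real n + 1"
proof -
  define y where "y = 7 * n div 26"
  define x where "x = 4 * n div 39"
  have y: "real y \<le> 7 / 26 * real n" "real y \<ge> 7 / 26 * real n - 1" unfolding y_def by linarith+
  have x: "real x \<le> 4 / 39 * real n" "real x \<ge> 4 / 39 * real n - 1" unfolding x_def by linarith+
  have yxn: "y + x \<le> n" using x(1) y(1) by linarith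
  define \<chi> where "\<chi> = restrict (three_part_colouring y (y + x)) (edges (complete_graph n))"
  define \<psi> where "\<psi> = three_part_colouring y (y + x)"
  let ?pn = "\<lambda>\<chi> c. packing_number (double_star 2 3) (colour_class (complete_graph n) \<chi> c)"
  have same: "colour_class (complete_graph n) \<chi> c = colour_class (complete_graph n) \<psi> c" for c
    by (auto simp: colour_class_def \<chi>_def \<psi>_def)
  have mem: "\<chi> \<in> edges (complete_graph n) \<rightarrow>\<^sub>E {1..3}"
    by (auto simp: \<chi>_def three_part_colouring_def)
  have c1: "real (?pn \<chi> 1) \<le> 7 / 78 * real n + 1"
  proof -
    have "real (?pn \<psi> 1) \<le> (\<Sum>v<n. if v < y then 1 / 3 else 0)"
      unfolding \<psi>_def by (rule three_part_packings)
    also have "\<dots> = real y / 3" using yxn by (subst sum_lessThan_if) auto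
    finally show ?thesis using y unfolding same by linarith
  qed
  have c2: "real (?pn \<chi> 2) \<le> 7 / 78 * real n + 1"
  proof -
    have "real (?pn \<psi> 2) \<le> (\<Sum>v<n. if v < y then 1 / 7 else if v < y + x then 1 / 2 else 0)"
      unfolding \<psi>_def by (rule three_part_packings)
    also have "\<dots> = (\<Sum>v<n. (if v < y then 1 / 7 - 1 / 2 else 0) + (if v < y + x then 1 / 2 else 0))"
      by (rule sum.cong) simp_all
    also have "\<dots> = real y * (1 / 7 - 1 / 2) + real (y + x) * (1 / 2)"
      unfolding sum.distrib using yxn sum_lessThan_if[of y n "1 / 7 - 1 / 2" 0] sum_lessThan_if[of "y + x" n "1 / 2" 0] by simp
    also have "\<dots> = real y / 7 + real x / 2" by (simp add: field_simps)
    finally show ?thesis using y x unfolding same by linarith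
  qed
  have c3: "real (?pn \<chi> 3) \<le> 7 / 78 * real n + 1"
  proof -
    have "real (?pn \<psi> 3) \<le> (\<Sum>v<n. if v < y then 0 else if v < y + x then 0 else 1 / 7)"
      unfolding \<psi>_def by (rule three_part_packings)
    also have "\<dots> = (\<Sum>v<n. if v < y + x then 0 else 1 / 7)" by (rule sum.cong) simp_all
    also have "\<dots> = (real n - real (y + x)) * (1 / 7)" using sum_lessThan_if[OF yxn, of 0 "1 / 7"] by simp
    finally have "real (?pn \<psi> 3) * 7 \<le> real n - real y - real x" by simp
    then show ?thesis using y x unfolding same by linarith
  qed
  have set: "{1..3} = {1, 2, 3 :: nat}" by auto
  have "real (mono_packing_number 3 (double_star 2 3) (complete_graph n) \<chi>) \<le> 7 / 78 * real n + 1"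
    unfolding mono_packing_number_def set using c1 c2 c3 by (simp add: max_def)
  moreover have "Rt 3 (double_star 2 3) (complete_graph n) \<le> mono_packing_number 3 (double_star 2 3) (complete_graph n) \<chi>"
    unfolding Rt_def by (intro Min_le finite_imageI imageI finite_colourings mem)
  ultimately show ?thesis by linarith
qed

section \<open>From fractional to integral packings\<close>

lemma disjoint_pieces:
  assumes "finite S" "k * m \<le> card S"
  shows "\<exists>g. (\<forall>i<k. g i \<subseteq> S \<and> card (g i) = m) \<and> (\<forall>i<k. \<forall>j<k. i \<noteq> j \<longrightarrow> g i \<inter> g j = {})"
  using assms
proof (induction k arbitrary: S)
  case 0 then show ?case by simp
next
  case (Suc k)
  then obtain T where T: "T \<subseteq> S" "card T = m"
    by (metis le_add1 mult_Suc obtain_subset_with_card_n order_trans)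
  have "k * m \<le> card (S - T)" using Suc.prems T by (simp add: card_Diff_subset finite_subset)
  then obtain g where g: "\<forall>i<k. g i \<subseteq> S - T \<and> card (g i) = m" "\<forall>i<k. \<forall>j<k. i \<noteq> j \<longrightarrow> g i \<inter> g j = {}"
    using Suc.IH[of "S - T"] Suc.prems by blast
  show ?case
  proof (intro exI[of _ "g(k := T)"] conjI allI impI)
    fix i assume "i < Suc k" then show "(g(k := T)) i \<subseteq> S" "card ((g(k := T)) i) = m"
      using g(1) T by (auto simp: less_Suc_eq)
  next
    fix i j assume "i < Suc k" "j < Suc k" "i \<noteq> j"
    then consider "i < k" "j < k" | "i = k" "j < k" | "i < k" "j = k" by linarith
    then show "(g(k := T)) i \<inter> (g(k := T)) j = {}"
    proof cases
      case 1 then show ?thesis using g(2) \<open>i \<noteq> j\<close> by simp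
    next
      case 2
      then have "g j \<subseteq> S - T" using g(1) by simp
      then show ?thesis using 2 by auto
    next
      case 3
      then have "g i \<subseteq> S - T" using g(1) by simp
      then show ?thesis using 3 by auto
    qed
  qed
qed

text \<open>Otherwise these vertices and \<open>L\<close> would form a hole.\<close>

lemma few_without_neighbour:
  assumes "rich \<delta> E X Y" "U \<subseteq> X" "L \<subseteq> Y" "\<delta> * real (card Y) \<le> real (card L)"
  shows "real (card {u\<in>U. \<forall>l\<in>L. \<not> E u l}) < \<delta> * real (card X)"
proof (rule ccontr)
  assume "\<not> ?thesis"
  then have "\<delta> * real (card X) \<le> real (card {u\<in>U. \<forall>l\<in>L. \<not> E u l})" by simp
  moreover have "{u\<in>U. \<forall>l\<in>L. \<not> E u l} \<subseteq> X" using assms(2) by blast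
  ultimately have "\<exists>a\<in>{u\<in>U. \<forall>l\<in>L. \<not> E u l}. \<exists>b\<in>L. E a b"
    using richD[OF assms(1) _ assms(3) _ assms(4)] by blast
  then show False by blast
qed

text \<open>Each of the seven vertices gets its own piece of the unused part of its cluster, so that the
vertices are automatically distinct. The pieces have about \<open>4 \<delta> |X|\<close> vertices:
at most \<open>\<delta> |X|\<close> vertices of a centre piece are lost for each of the at most
three leaf pieces, and enough remain on both sides to find adjacent centres. The factor
\<open>40\<close> leaves room for seven pieces and for rounding.\<close>

lemma find_star:
  fixes X :: "nat \<Rightarrow> 'a set"
  assumes \<delta>: "\<delta> > 0" and fin: "\<forall>i<4. finite (X i)"
    and disj: "\<forall>i<4. \<forall>j<4. X i = X j \<or> X i \<inter> X j = {}"
    and large: "\<forall>i<4. 1 \<le> \<delta> * real (card (X i))"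
    and room: "\<forall>i<4. 40 * \<delta> * real (card (X i)) \<le> real (card (X i - W))"
    and rich: "rich \<delta> E (X 0) (X 1)" "rich \<delta> E (X 0) (X 2)" "rich \<delta> E (X 1) (X 3)"
  shows "\<exists>u v a1 a2 b1 b2 b3. distinct [u, v, a1, a2, b1, b2, b3] \<and>
     E u v \<and> E u a1 \<and> E u a2 \<and> E v b1 \<and> E v b2 \<and> E v b3 \<and>
     u \<in> X 0 - W \<and> v \<in> X 1 - W \<and> a1 \<in> X 2 - W \<and> a2 \<in> X 2 - W \<and> b1 \<in> X 3 - W \<and> b2 \<in> X 3 - W \<and> b3 \<in> X 3 - W"
proof -
  define m where "m = (\<lambda>S::'a set. nat \<lceil>4 * \<delta> * real (card S)\<rceil>)"
  have m_ge: "4 * \<delta> * real (card S) \<le> real (m S)" for S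
    unfolding m_def by linarith
  have pieces: "\<exists>g. (\<forall>i<7::nat. g i \<subseteq> S - W \<and> card (g i) = m S) \<and> (\<forall>i<7::nat. \<forall>j<7::nat. i \<noteq> j \<longrightarrow> g i \<inter> g j = {})"
    if S: "S \<in> X ` {..<4}" for S
  proof (rule disjoint_pieces)
    obtain i where i: "i < 4" "S = X i" using S by auto
    show "finite (S - W)" using i fin by simp
    have "0 \<le> 4 * \<delta> * real (card S)" using \<delta> by simp
    then have "real (m S) \<le> 4 * \<delta> * real (card S) + 1" unfolding m_def by linarith
    then have "real (7 * m S) \<le> 40 * \<delta> * real (card S)" using large i by (auto simp: algebra_simps)
    then have "real (7 * m S) \<le> real (card (S - W))" using room i by fastforce
    then show "7 * m S \<le> card (S - W)" by linarith
  qed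
  then obtain g where g: "\<And>S i. S \<in> X ` {..<4} \<Longrightarrow> i < (7::nat) \<Longrightarrow> g S i \<subseteq> S - W \<and> card (g S i) = m S"
    "\<And>S i j. S \<in> X ` {..<4} \<Longrightarrow> i < (7::nat) \<Longrightarrow> j < (7::nat) \<Longrightarrow> i \<noteq> j \<Longrightarrow> g S i \<inter> g S j = {}"
    by metis
  define G where "G = (\<lambda>r i. g (X r) i)"
  have G: "G r i \<subseteq> X r - W" "4 * \<delta> * real (card (X r)) \<le> real (card (G r i))" "finite (G r i)"
    if "r < 4" "i < 7" for r i
  proof -
    show *: "G r i \<subseteq> X r - W" using g(1)[of "X r" i] that by (auto simp: G_def)
    show "4 * \<delta> * real (card (X r)) \<le> real (card (G r i))"
      using g(1)[of "X r" i] that m_ge[of "X r"] by (simp add: G_def)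
    show "finite (G r i)" using * fin that by (meson finite_Diff finite_subset)
  qed
  have Gdisj: "G r i \<inter> G s j = {}" if "r < 4" "s < 4" "i < 7" "j < 7" "i \<noteq> j" for r s i j
  proof (cases "X r = X s")
    case True then show ?thesis using g(2)[of "X r" i j] that by (simp add: G_def)
  next
    case False
    then show ?thesis using disj[rule_format, OF that(1,2)] G(1)[OF that(1,3)] G(1)[OF that(2,4)] by blast
  qed
  have weak: "\<delta> * real (card (X r)) \<le> real (card (G r i))" if "r < 4" "i < 7" for r i
  proof -
    have "\<delta> * real (card (X r)) \<le> 4 * \<delta> * real (card (X r))" using \<delta> by simp
    then show ?thesis using G(2)[OF that] by linarith
  qed
  define miss where "miss = (\<lambda>r i s j. {u \<in> G r i. \<forall>l\<in>G s j. \<not> E u l})"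
  have miss: "real (card (miss r i s j)) < \<delta> * real (card (X r))"
    if "rich \<delta> E (X r) (X s)" "r < 4" "s < 4" "i < 7" "j < 7" for r i s j
    unfolding miss_def by (rule few_without_neighbour[OF that(1)]) (use G weak that in blast)+
  have many: "\<delta> * real (card (X r)) \<le> real (card (G r i - M))"
    if "r < 4" "i < 7" "finite M" "real (card M) \<le> 3 * (\<delta> * real (card (X r)))" for r i M
  proof -
    have "card (G r i) - card M \<le> card (G r i - M)" using that G(3) by (intro diff_card_le_card_Diff) auto
    then have "real (card (G r i)) - real (card M) \<le> real (card (G r i - M))" by linarith
    then show ?thesis using G(2)[OF that(1,2)] that(4) by linarith
  qed
  have finm: "finite (miss r i s j)" if "r < 4" "i < 7" for r i s j
    using G(3)[OF that] by (simp add: miss_def)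
  define U where "U = G 0 0 - (miss 0 0 2 2 \<union> miss 0 0 2 3)"
  define V where "V = G 1 1 - (miss 1 1 3 4 \<union> (miss 1 1 3 5 \<union> miss 1 1 3 6))"
  have "real (card (miss 0 0 2 2 \<union> miss 0 0 2 3)) \<le> 3 * (\<delta> * real (card (X 0)))"
    using card_Un_le[of "miss 0 0 2 2" "miss 0 0 2 3"] miss[OF rich(2), of 0 2] miss[OF rich(2), of 0 3] \<delta> by simp
  then have U: "\<delta> * real (card (X 0)) \<le> real (card U)" unfolding U_def by (intro many) (use finm in auto)
  have "real (card (miss 1 1 3 4 \<union> (miss 1 1 3 5 \<union> miss 1 1 3 6))) \<le> 3 * (\<delta> * real (card (X 1)))"
    using card_Un_le[of "miss 1 1 3 4" "miss 1 1 3 5 \<union> miss 1 1 3 6"] card_Un_le[of "miss 1 1 3 5" "miss 1 1 3 6"]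
      miss[OF rich(3), of 1 4] miss[OF rich(3), of 1 5] miss[OF rich(3), of 1 6] by simp
  then have V: "\<delta> * real (card (X 1)) \<le> real (card V)" unfolding V_def by (intro many) (use finm in auto)
  have "U \<subseteq> X 0" "V \<subseteq> X 1" using G(1)[of 0 0] G(1)[of 1 1] by (auto simp: U_def V_def)
  then obtain u v where uv: "u \<in> U" "v \<in> V" "E u v" using richD[OF rich(1) _ _ U V] by blast
  obtain a1 a2 where a: "a1 \<in> G 2 2" "E u a1" "a2 \<in> G 2 3" "E u a2"
    using uv(1) unfolding U_def miss_def by blast
  obtain b1 b2 b3 where b: "b1 \<in> G 3 4" "E v b1" "b2 \<in> G 3 5" "E v b2" "b3 \<in> G 3 6" "E v b3"
    using uv(2) unfolding V_def miss_def by blast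
  have u: "u \<in> G 0 0" "v \<in> G 1 1" using uv by (auto simp: U_def V_def)
  have ne: "x \<noteq> y" if "x \<in> G r i" "y \<in> G s j" "r < 4" "s < 4" "i < 7" "j < 7" "i \<noteq> j" for x y r s i j
    using Gdisj[OF that(3-7)] that(1,2) by blast
  have "distinct [u, v, a1, a2, b1, b2, b3]"
    using ne[OF u(1) u(2)] ne[OF u(1) a(1)] ne[OF u(1) a(3)] ne[OF u(1) b(1)] ne[OF u(1) b(3)] ne[OF u(1) b(5)]
      ne[OF u(2) a(1)] ne[OF u(2) a(3)] ne[OF u(2) b(1)] ne[OF u(2) b(3)] ne[OF u(2) b(5)]
      ne[OF a(1) a(3)] ne[OF a(1) b(1)] ne[OF a(1) b(3)] ne[OF a(1) b(5)]
      ne[OF a(3) b(1)] ne[OF a(3) b(3)] ne[OF a(3) b(5)]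
      ne[OF b(1) b(3)] ne[OF b(1) b(5)] ne[OF b(3) b(5)] by simp
  moreover have "u \<in> X 0 - W" "v \<in> X 1 - W" "a1 \<in> X 2 - W" "a2 \<in> X 2 - W" "b1 \<in> X 3 - W" "b2 \<in> X 3 - W" "b3 \<in> X 3 - W"
    using G(1)[of 0 0] G(1)[of 1 1] G(1)[of 2 2] G(1)[of 2 3] G(1)[of 3 4] G(1)[of 3 5] G(1)[of 3 6] u a b by auto
  ultimately show ?thesis using uv(3) a(2,4) b(2,4,6) by blast
qed

text \<open>The number of vertices that a copy of type \<open>(i, j, a, b)\<close>, that is with centres in
\<open>i\<close> and \<open>j\<close>, two leaves in \<open>a\<close> and three leaves in
\<open>b\<close>, takes from \<open>q\<close>.\<close>

fun load :: "'q \<times> 'q \<times> 'q \<times> 'q \<Rightarrow> 'q \<Rightarrow> nat" where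
  "load (i, j, a, b) q = of_bool (i = q) + of_bool (j = q) + 2 * of_bool (a = q) + 3 * of_bool (b = q)"

definition star_types :: "real \<Rightarrow> ('a \<Rightarrow> 'a \<Rightarrow> bool) \<Rightarrow> 'a set set \<Rightarrow> ('a set \<times> 'a set \<times> 'a set \<times> 'a set) set" where
  "star_types \<delta> E Q = {(i, j, a, b) \<in> Q \<times> Q \<times> Q \<times> Q. rich \<delta> E i j \<and> rich \<delta> E i a \<and> rich \<delta> E j b}"

lemma star_types_finite:
  assumes "finite Q"
  shows "finite (star_types \<delta> E Q)" "card (star_types \<delta> E Q) \<le> card Q ^ 4"
proof -
  have sub: "star_types \<delta> E Q \<subseteq> Q \<times> Q \<times> Q \<times> Q" by (auto simp: star_types_def)
  show "finite (star_types \<delta> E Q)" by (rule finite_subset[OF sub]) (simp add: assms)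
  have "card (star_types \<delta> E Q) \<le> card (Q \<times> Q \<times> Q \<times> Q)" by (rule card_mono[OF _ sub]) (simp add: assms)
  then show "card (star_types \<delta> E Q) \<le> card Q ^ 4"
    by (simp add: card_cartesian_product power_def numeral_eq_Suc)
qed

text \<open>As long as a \<open>40 \<delta>\<close> fraction of every cluster is unused, another copy of any
prescribed type can be placed.\<close>

lemma greedy_packing:
  fixes Q :: "'a set set"
  assumes \<delta>: "\<delta> > 0" and Q: "\<forall>X\<in>Q. finite X \<and> 1 \<le> \<delta> * real (card X)"
    and disj: "\<forall>X\<in>Q. \<forall>Y\<in>Q. X = Y \<or> X \<inter> Y = {}"
    and ts: "set ts \<subseteq> star_types \<delta> E Q"
    and loads: "\<forall>q\<in>Q. real (\<Sum>\<tau>\<leftarrow>ts. load \<tau> q) \<le> (1 - 40 * \<delta>) * real (card q)"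
  shows "\<exists>\<S>. finite \<S> \<and> card \<S> = length ts \<and> (\<forall>S\<in>\<S>. spans_star E S \<and> S \<subseteq> \<Union>Q) \<and> pairwise disjnt \<S> \<and>
     (\<forall>q\<in>Q. card (\<Union>\<S> \<inter> q) \<le> (\<Sum>\<tau>\<leftarrow>ts. load \<tau> q))"
  using ts loads
proof (induction ts)
  case Nil
  then show ?case by (intro exI[of _ "{}"]) simp
next
  case (Cons \<tau> ts)
  have sub: "set ts \<subseteq> star_types \<delta> E Q" using Cons.prems(1) by simp
  have le: "(\<Sum>\<tau>\<leftarrow>ts. load \<tau> q) \<le> (\<Sum>\<tau>\<leftarrow>\<tau> # ts. load \<tau> q)" for q by simp
  have less: "\<forall>q\<in>Q. real (\<Sum>\<tau>\<leftarrow>ts. load \<tau> q) \<le> (1 - 40 * \<delta>) * real (card q)"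
  proof
    fix q assume "q \<in> Q"
    have "real (\<Sum>\<tau>\<leftarrow>ts. load \<tau> q) \<le> real (\<Sum>\<tau>\<leftarrow>\<tau> # ts. load \<tau> q)"
      using le by (simp only: of_nat_le_iff)
    also have "\<dots> \<le> (1 - 40 * \<delta>) * real (card q)" using Cons.prems(2) \<open>q \<in> Q\<close> by blast
    finally show "real (\<Sum>\<tau>\<leftarrow>ts. load \<tau> q) \<le> (1 - 40 * \<delta>) * real (card q)" .
  qed
  obtain \<S> where S: "finite \<S>" "card \<S> = length ts" "\<And>S. S \<in> \<S> \<Longrightarrow> spans_star E S \<and> S \<subseteq> \<Union>Q"
    "pairwise disjnt \<S>" "\<And>q. q \<in> Q \<Longrightarrow> card (\<Union>\<S> \<inter> q) \<le> (\<Sum>\<tau>\<leftarrow>ts. load \<tau> q)"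
    using Cons.IH[OF sub less] by blast
  obtain i j a b where \<tau>: "\<tau> = (i, j, a, b)" by (cases \<tau>)
  have mem: "i \<in> Q" "j \<in> Q" "a \<in> Q" "b \<in> Q" and rich: "rich \<delta> E i j" "rich \<delta> E i a" "rich \<delta> E j b"
    using Cons.prems(1) by (simp_all add: \<tau> star_types_def)
  define X where "X = (\<lambda>r::nat. [i, j, a, b] ! r)"
  have XQ: "X r \<in> Q" if "r < 4" for r
  proof -
    have "r = 0 \<or> r = 1 \<or> r = 2 \<or> r = 3" using that by linarith
    then show ?thesis using mem by (auto simp: X_def)
  qed
  have X: "X 0 = i" "X 1 = j" "X 2 = a" "X 3 = b" by (simp_all add: X_def)
  define W where "W = \<Union>\<S>"
  have room: "40 * \<delta> * real (card q) \<le> real (card (q - W))" if q: "q \<in> Q" for q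
  proof -
    have "card (q - W) = card q - card (W \<inter> q)"
      using Q q by (metis Int_commute card_Diff_subset_Int finite_Int)
    then have "real (card q) - real (card (W \<inter> q)) \<le> real (card (q - W))" by linarith
    moreover have "real (card (W \<inter> q)) \<le> real (\<Sum>\<tau>\<leftarrow>ts. load \<tau> q)"
      using S(5)[OF q] unfolding W_def by (simp only: of_nat_le_iff)
    moreover have "real (\<Sum>\<tau>\<leftarrow>ts. load \<tau> q) \<le> (1 - 40 * \<delta>) * real (card q)" using less q by blast
    ultimately show ?thesis by (simp add: algebra_simps)
  qed
  have "\<exists>u v a1 a2 b1 b2 b3. distinct [u, v, a1, a2, b1, b2, b3] \<and>
     E u v \<and> E u a1 \<and> E u a2 \<and> E v b1 \<and> E v b2 \<and> E v b3 \<and>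
     u \<in> X 0 - W \<and> v \<in> X 1 - W \<and> a1 \<in> X 2 - W \<and> a2 \<in> X 2 - W \<and> b1 \<in> X 3 - W \<and> b2 \<in> X 3 - W \<and> b3 \<in> X 3 - W"
  proof (rule find_star[OF \<delta>])
    show "\<forall>r<4. finite (X r)" "\<forall>r<4. 1 \<le> \<delta> * real (card (X r))" using Q XQ by simp_all
    show "\<forall>r<4. \<forall>s<4. X r = X s \<or> X r \<inter> X s = {}" using disj XQ by simp
    show "\<forall>r<4. 40 * \<delta> * real (card (X r)) \<le> real (card (X r - W))" using room XQ by simp
  qed (simp_all only: X rich)
  then obtain u v a1 a2 b1 b2 b3 where d: "distinct [u, v, a1, a2, b1, b2, b3]"
    and E: "E u v" "E u a1" "E u a2" "E v b1" "E v b2" "E v b3"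
    and inX: "u \<in> i - W" "v \<in> j - W" "a1 \<in> a - W" "a2 \<in> a - W" "b1 \<in> b - W" "b2 \<in> b - W" "b3 \<in> b - W"
    unfolding X by blast
  define N where "N = {u, v, a1, a2, b1, b2, b3}"
  have star: "spans_star E N" unfolding spans_star_def N_def using d E by blast
  have NQ: "N \<subseteq> \<Union>Q" using inX mem unfolding N_def by blast
  have NW: "N \<inter> W = {}" using inX unfolding N_def by blast
  have new: "N \<notin> \<S>"
  proof
    assume "N \<in> \<S>"
    then have "N \<subseteq> W" unfolding W_def by blast
    then show False using NW unfolding N_def by blast
  qed
  have Nload: "card (N \<inter> q) \<le> load \<tau> q" if q: "q \<in> Q" for q
  proof -
    have eq: "p = q" if "x \<in> p" "x \<in> q" "p \<in> Q" for x p using disj that q by blast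
    have "N \<inter> q \<subseteq> (if i = q then {u} else {}) \<union> ((if j = q then {v} else {}) \<union>
       ((if a = q then {a1, a2} else {}) \<union> (if b = q then {b1, b2, b3} else {})))" (is "_ \<subseteq> ?A \<union> (?B \<union> (?C \<union> ?D))")
    proof
      fix x assume x: "x \<in> N \<inter> q"
      then consider "x = u" | "x = v" | "x \<in> {a1, a2}" | "x \<in> {b1, b2, b3}" unfolding N_def by blast
      then show "x \<in> ?A \<union> (?B \<union> (?C \<union> ?D))"
      proof cases
        case 1 then have "i = q" using eq[of x i] x inX mem by blast
        then show ?thesis using 1 by simp
      next
        case 2 then have "j = q" using eq[of x j] x inX mem by blast
        then show ?thesis using 2 by simp
      next
        case 3 then have "a = q" using eq[of x a] x inX mem by blast
        then show ?thesis using 3 by auto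
      next
        case 4 then have "b = q" using eq[of x b] x inX mem by blast
        then show ?thesis using 4 by auto
      qed
    qed
    then have "card (N \<inter> q) \<le> card (?A \<union> (?B \<union> (?C \<union> ?D)))" by (intro card_mono) simp_all
    also have "\<dots> \<le> card ?A + (card ?B + (card ?C + card ?D))"
      by (meson card_Un_le add_left_mono order_trans)
    also have "\<dots> \<le> load \<tau> q"
      by (simp add: \<tau> card_insert_if)
    finally show ?thesis .
  qed
  show ?case
  proof (intro exI[of _ "insert N \<S>"] conjI ballI)
    show "finite (insert N \<S>)" using S(1) by simp
    show "card (insert N \<S>) = length (\<tau> # ts)" using S(1,2) new by simp
    fix S' assume "S' \<in> insert N \<S>"
    then show "spans_star E S'" "S' \<subseteq> \<Union>Q" using S(3) star NQ by blast+
  next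
    show "pairwise disjnt (insert N \<S>)"
      unfolding pairwise_insert using S(4) NW unfolding W_def disjnt_def by blast
  next
    fix q assume q: "q \<in> Q"
    have "\<Union>(insert N \<S>) \<inter> q = (N \<inter> q) \<union> (W \<inter> q)" unfolding W_def by blast
    then have "card (\<Union>(insert N \<S>) \<inter> q) \<le> card (N \<inter> q) + card (W \<inter> q)" using card_Un_le by metis
    also have "\<dots> \<le> load \<tau> q + (\<Sum>\<tau>\<leftarrow>ts. load \<tau> q)"
      using Nload[OF q] S(5)[OF q] unfolding W_def by (rule add_mono)
    finally show "card (\<Union>(insert N \<S>) \<inter> q) \<le> (\<Sum>\<tau>\<leftarrow>\<tau> # ts. load \<tau> q)" by simp
  qed
qed

lemma list_with_multiplicities:
  assumes "finite T"
  shows "\<exists>ts. set ts \<subseteq> T \<and> (\<forall>f::'t \<Rightarrow> nat. (\<Sum>\<tau>\<leftarrow>ts. f \<tau>) = (\<Sum>\<tau>\<in>T. N \<tau> * f \<tau>))"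
  using assms
proof (induction T rule: finite_induct)
  case empty
  then show ?case by (intro exI[of _ "[]"]) simp
next
  case (insert \<sigma> T)
  then obtain ts where ts: "set ts \<subseteq> T" "\<And>f::'t \<Rightarrow> nat. (\<Sum>\<tau>\<leftarrow>ts. f \<tau>) = (\<Sum>\<tau>\<in>T. N \<tau> * f \<tau>)" by blast
  show ?case
  proof (intro exI[of _ "replicate (N \<sigma>) \<sigma> @ ts"] conjI allI)
    show "set (replicate (N \<sigma>) \<sigma> @ ts) \<subseteq> insert \<sigma> T" using ts(1) by (auto simp: set_replicate_conv_if)
    fix f :: "'t \<Rightarrow> nat"
    show "(\<Sum>\<tau>\<leftarrow>replicate (N \<sigma>) \<sigma> @ ts. f \<tau>) = (\<Sum>\<tau>\<in>insert \<sigma> T. N \<tau> * f \<tau>)"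
      using insert.hyps ts(2)[of f] by (simp add: sum_list_replicate)
  qed
qed

text \<open>Rounding the multiplicities down loses at most one copy for each type.\<close>

lemma fractional_packing:
  fixes \<chi> :: "nat set \<Rightarrow> nat" and n c :: nat
  defines "E \<equiv> \<lambda>x y. \<chi> {x, y} = c"
  assumes \<delta>: "\<delta> > 0" and finQ: "finite Q" and Q: "\<forall>X\<in>Q. X \<subseteq> {..<n} \<and> 1 \<le> \<delta> * real (card X)"
    and disj: "\<forall>X\<in>Q. \<forall>Y\<in>Q. X = Y \<or> X \<inter> Y = {}"
    and y: "\<forall>\<tau>\<in>star_types \<delta> E Q. y \<tau> \<ge> (0::real)"
    and loads: "\<forall>q\<in>Q. (\<Sum>\<tau>\<in>star_types \<delta> E Q. y \<tau> * real (load \<tau> q)) \<le> (1 - 40 * \<delta>) * real (card q)"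
  shows "(\<Sum>\<tau>\<in>star_types \<delta> E Q. y \<tau>) \<le>
    real (packing_number (double_star 2 3) (colour_class (complete_graph n) \<chi> c)) + real (card Q) ^ 4"
proof -
  let ?T = "star_types \<delta> E Q"
  define N where "N = (\<lambda>\<tau>. nat \<lfloor>y \<tau>\<rfloor>)"
  have N: "real (N \<tau>) \<le> y \<tau>" "y \<tau> \<le> real (N \<tau>) + 1" if "\<tau> \<in> ?T" for \<tau>
  proof -
    have "0 \<le> y \<tau>" using y that by blast
    then show "real (N \<tau>) \<le> y \<tau>" "y \<tau> \<le> real (N \<tau>) + 1" unfolding N_def by linarith+
  qed
  obtain ts where ts: "set ts \<subseteq> ?T" "\<And>f::_ \<Rightarrow> nat. (\<Sum>\<tau>\<leftarrow>ts. f \<tau>) = (\<Sum>\<tau>\<in>?T. N \<tau> * f \<tau>)"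
    using list_with_multiplicities[OF star_types_finite(1)[OF finQ]] by metis
  have "\<exists>\<S>. finite \<S> \<and> card \<S> = length ts \<and> (\<forall>S\<in>\<S>. spans_star E S \<and> S \<subseteq> \<Union>Q) \<and> pairwise disjnt \<S> \<and>
     (\<forall>q\<in>Q. card (\<Union>\<S> \<inter> q) \<le> (\<Sum>\<tau>\<leftarrow>ts. load \<tau> q))"
  proof (rule greedy_packing[OF \<delta> _ disj ts(1)])
    show "\<forall>X\<in>Q. finite X \<and> 1 \<le> \<delta> * real (card X)" using Q by (meson finite_lessThan finite_subset)
    show "\<forall>q\<in>Q. real (\<Sum>\<tau>\<leftarrow>ts. load \<tau> q) \<le> (1 - 40 * \<delta>) * real (card q)"
    proof
      fix q assume q: "q \<in> Q"
      have "real (\<Sum>\<tau>\<leftarrow>ts. load \<tau> q) = (\<Sum>\<tau>\<in>?T. real (N \<tau>) * real (load \<tau> q))"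
        unfolding ts(2) by simp
      also have "\<dots> \<le> (\<Sum>\<tau>\<in>?T. y \<tau> * real (load \<tau> q))"
        by (intro sum_mono mult_right_mono N) auto
      finally show "real (\<Sum>\<tau>\<leftarrow>ts. load \<tau> q) \<le> (1 - 40 * \<delta>) * real (card q)" using loads q by fastforce
    qed
  qed
  then obtain \<S> where S: "finite \<S>" "card \<S> = length ts" "\<forall>S\<in>\<S>. spans_star E S \<and> S \<subseteq> \<Union>Q" "pairwise disjnt \<S>"
    by blast
  have "\<forall>S\<in>\<S>. spans_star (\<lambda>x y. \<chi> {x, y} = c) S \<and> S \<subseteq> {..<n}"
    using S(3) Q unfolding E_def by blast
  then have pack: "card \<S> \<le> packing_number (double_star 2 3) (colour_class (complete_graph n) \<chi> c)"
    by (rule packing_number_ge[OF S(1) _ S(4)])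
  have len: "length ts = (\<Sum>\<tau>\<in>?T. N \<tau>)"
    using ts(2)[of "\<lambda>_. 1"] by (simp add: sum_list_triv)
  have "(\<Sum>\<tau>\<in>?T. y \<tau>) \<le> (\<Sum>\<tau>\<in>?T. real (N \<tau>) + 1)" by (rule sum_mono) (rule N)
  also have "\<dots> = real (length ts) + real (card ?T)" by (simp add: sum.distrib len)
  also have "real (card ?T) \<le> real (card Q) ^ 4"
    using star_types_finite(2)[OF finQ, of \<delta> E] by (metis of_nat_le_iff of_nat_power)
  finally show ?thesis using pack S(2) by simp
qed

text \<open>The fractional packings of the reduced graph are bounded by the packing number, so duality
provides a cheap cover.\<close>

lemma colour_weights:
  fixes \<chi> :: "nat set \<Rightarrow> nat" and n c :: nat
  defines "E \<equiv> \<lambda>x y. \<chi> {x, y} = c"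
  assumes \<delta>: "\<delta> > 0" "40 * \<delta> < 1" and finQ: "finite Q" and Q: "\<forall>X\<in>Q. X \<subseteq> {..<n} \<and> 1 \<le> \<delta> * real (card X)"
    and disj: "\<forall>X\<in>Q. \<forall>Y\<in>Q. X = Y \<or> X \<inter> Y = {}"
  shows "\<exists>w. (\<forall>q\<in>Q. 0 \<le> w q) \<and>
    (\<forall>i\<in>Q. \<forall>j\<in>Q. \<forall>a\<in>Q. \<forall>b\<in>Q. rich \<delta> E i j \<longrightarrow> rich \<delta> E i a \<longrightarrow> rich \<delta> E j b \<longrightarrow> w i + w j + 2 * w a + 3 * w b \<ge> 1) \<and>
    (\<Sum>q\<in>Q. w q * real (card q)) \<le>
      (real (packing_number (double_star 2 3) (colour_class (complete_graph n) \<chi> c)) + real (card Q) ^ 4) / (1 - 40 * \<delta>)"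
proof -
  let ?T = "star_types \<delta> E Q"
  let ?\<nu> = "real (packing_number (double_star 2 3) (colour_class (complete_graph n) \<chi> c)) + real (card Q) ^ 4"
  have finT: "finite ?T" by (rule star_types_finite(1)[OF finQ])
  have "\<exists>w. (\<forall>q\<in>Q. w q \<ge> 0) \<and> (\<forall>\<tau>\<in>?T. (\<Sum>q\<in>Q. w q * real (load \<tau> q)) \<ge> 1) \<and>
     (\<Sum>q\<in>Q. w q * real (card q)) \<le> ?\<nu> / (1 - 40 * \<delta>)"
  proof (rule packing_covering_duality[OF finT finQ])
    show "\<forall>\<tau>\<in>?T. \<forall>q\<in>Q. 0 \<le> real (load \<tau> q)" by simp
    show "\<forall>\<tau>\<in>?T. \<exists>q\<in>Q. 0 < real (load \<tau> q)"
    proof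
      fix \<tau> assume \<tau>: "\<tau> \<in> ?T"
      obtain i j a b where t: "\<tau> = (i, j, a, b)" by (cases \<tau>)
      have "i \<in> Q" using \<tau> unfolding t star_types_def by simp
      moreover have "0 < real (load \<tau> i)" unfolding t by simp
      ultimately show "\<exists>q\<in>Q. 0 < real (load \<tau> q)" by (rule bexI[rotated])
    qed
    fix y assume y: "\<forall>\<tau>\<in>?T. 0 \<le> y \<tau>" "\<forall>q\<in>Q. (\<Sum>\<tau>\<in>?T. y \<tau> * real (load \<tau> q)) \<le> real (card q)"
    have "(\<Sum>\<tau>\<in>?T. (1 - 40 * \<delta>) * y \<tau>) \<le> ?\<nu>"
      unfolding E_def
    proof (rule fractional_packing[OF \<delta>(1) finQ Q disj], fold E_def)
      show "\<forall>\<tau>\<in>?T. 0 \<le> (1 - 40 * \<delta>) * y \<tau>" using y(1) \<delta>(2) by simp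
      show "\<forall>q\<in>Q. (\<Sum>\<tau>\<in>?T. (1 - 40 * \<delta>) * y \<tau> * real (load \<tau> q)) \<le> (1 - 40 * \<delta>) * real (card q)"
      proof
        fix q assume q: "q \<in> Q"
        have "(\<Sum>\<tau>\<in>?T. (1 - 40 * \<delta>) * y \<tau> * real (load \<tau> q)) = (1 - 40 * \<delta>) * (\<Sum>\<tau>\<in>?T. y \<tau> * real (load \<tau> q))"
          by (simp add: sum_distrib_left mult.assoc)
        also have "\<dots> \<le> (1 - 40 * \<delta>) * real (card q)" using y(2) q \<delta>(2) by (intro mult_left_mono) auto
        finally show "(\<Sum>\<tau>\<in>?T. (1 - 40 * \<delta>) * y \<tau> * real (load \<tau> q)) \<le> (1 - 40 * \<delta>) * real (card q)" .
      qed
    qed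
    then have "(1 - 40 * \<delta>) * (\<Sum>\<tau>\<in>?T. y \<tau>) \<le> ?\<nu>" by (simp add: sum_distrib_left)
    then show "(\<Sum>\<tau>\<in>?T. y \<tau>) \<le> ?\<nu> / (1 - 40 * \<delta>)" using \<delta>(2) by (simp add: pos_le_divide_eq mult.commute)
  qed
  then obtain w where w: "\<forall>q\<in>Q. w q \<ge> 0" "\<forall>\<tau>\<in>?T. (\<Sum>q\<in>Q. w q * real (load \<tau> q)) \<ge> 1"
     "(\<Sum>q\<in>Q. w q * real (card q)) \<le> ?\<nu> / (1 - 40 * \<delta>)" by blast
  have "w i + w j + 2 * w a + 3 * w b \<ge> 1"
    if ij: "i \<in> Q" "j \<in> Q" "a \<in> Q" "b \<in> Q" "rich \<delta> E i j" "rich \<delta> E i a" "rich \<delta> E j b" for i j a b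
  proof -
    have pick: "(\<Sum>q\<in>Q. w q * of_bool (p = q)) = w p" if "p \<in> Q" for p
      using finQ that by (simp add: of_bool_def if_distrib cong: if_cong)
    have "(i, j, a, b) \<in> ?T" using ij by (simp add: star_types_def)
    then have "1 \<le> (\<Sum>q\<in>Q. w q * real (load (i, j, a, b) q))" using w(2) by blast
    also have "\<dots> = (\<Sum>q\<in>Q. w q * of_bool (i = q) + w q * of_bool (j = q) + 2 * (w q * of_bool (a = q)) + 3 * (w q * of_bool (b = q)))"
      by (simp add: algebra_simps)
    also have "\<dots> = w i + w j + 2 * w a + 3 * w b"
      unfolding sum.distrib sum_distrib_left[symmetric] using pick ij(1-4) by simp
    finally show ?thesis .
  qed
  then show ?thesis using w(1,3) by blast
qed

section \<open>Homogeneous types\<close>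

lemma ramsey_finitely_many_colours:
  fixes H :: "'c set" and m :: nat
  assumes "finite H"
  shows "\<exists>N::nat. \<forall>h::nat \<Rightarrow> nat \<Rightarrow> 'c. (\<forall>k<N. \<forall>l<N. k < l \<longrightarrow> h k l \<in> H) \<longrightarrow>
    (\<exists>(t :: nat \<Rightarrow> nat) c. (\<forall>i<m. t i < N) \<and> (\<forall>i<m. \<forall>j<m. i < j \<longrightarrow> t i < t j \<and> h (t i) (t j) = c))"
proof -
  obtain code where code: "bij_betw code H {0..<card H}" using ex_bij_betw_finite_nat[OF assms] by blast
  obtain N :: nat where N: "partn_lst {..<N} (replicate (card H) m) 2" using ramsey_full by blast
  show ?thesis
  proof (intro exI[of _ N] allI impI)
    fix h :: "nat \<Rightarrow> nat \<Rightarrow> 'c" assume h: "\<forall>k<N. \<forall>l<N. k < l \<longrightarrow> h k l \<in> H"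
    define f where "f = (\<lambda>S. code (h (Min S) (Max S)))"
    have f_pair: "f {k, l} = code (h k l)" if "k < l" for k l
      using that by (simp add: f_def min_def max_def)
    have "f \<in> nsets {..<N} 2 \<rightarrow> {..<length (replicate (card H) m)}"
    proof
      fix S assume "S \<in> nsets {..<N} 2"
      then obtain k l where "S = {k, l}" "k \<in> {..<N}" "l \<in> {..<N}" "k \<noteq> l" by (elim nsets2_E)
      then obtain k l where S: "S = {k, l}" "k < l" "k < N" "l < N"
        by (metis insert_commute lessThan_iff linorder_neqE_nat)
      have "h k l \<in> H" using h S by blast
      then have "code (h k l) \<in> {0..<card H}" using code by (meson bij_betwE)
      then show "f S \<in> {..<length (replicate (card H) m)}" using f_pair[OF S(2)] S(1) by simp
    qed
    then obtain i where i: "i < length (replicate (card H) m)" "monochromatic {..<N} (replicate (card H) m ! i) 2 f i"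
      using N unfolding partn_lst_def by blast
    then obtain T where T: "T \<in> nsets {..<N} m" "f ` nsets T 2 \<subseteq> {i}"
      unfolding monochromatic_def by auto
    have Tf: "finite T" "card T = m" "T \<subseteq> {..<N}" using T(1) by (simp_all add: nsets_def)
    define t where "t = (\<lambda>i. sorted_list_of_set T ! i)"
    have tT: "t i \<in> T" if "i < m" for i
      using that Tf by (metis nth_mem sorted_list_of_set(1) length_sorted_list_of_set t_def)
    have tless: "t i < t j" if "i < j" "j < m" for i j
      using that Tf strict_sorted_list_of_set[of T] unfolding t_def by (simp add: sorted_wrt_nth_less)
    have mono: "code (h (t i') (t j)) = i" if "i' < j" "j < m" for i' j
    proof -
      have "{t i', t j} \<in> nsets T 2" using tT that tless[OF that] by simp
      then have "f {t i', t j} = i" using T(2) by blast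
      then show ?thesis using f_pair[OF tless[OF that]] by simp
    qed
    have "h (t i') (t j) = inv_into H code i" if "i' < j" "j < m" for i' j
    proof -
      have "t i' \<in> T" "t j \<in> T" using tT that by simp_all
      then have "t i' < N" "t j < N" using Tf(3) by auto
      then have "h (t i') (t j) \<in> H" using h tless[OF that] by blast
      then show ?thesis using mono[OF that] code by (metis bij_betw_inv_into_left)
    qed
    then show "\<exists>(t :: nat \<Rightarrow> nat) c. (\<forall>i<m. t i < N) \<and> (\<forall>i<m. \<forall>j<m. i < j \<longrightarrow> t i < t j \<and> h (t i) (t j) = c)"
      using tT Tf(3) tless by (intro exI[of _ t] exI[of _ "inv_into H code i"]) auto
  qed
qed

text \<open>Among \<open>3N\<close> vertices, \<open>N\<close> in each of three groups (vertex \<open>3k +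
r\<close> belongs to group \<open>r\<close>), there are two representatives of each group such
that the relations between first and second representatives are described by a colouring of the
triangle with loops. Two representatives are needed to see the colour of a loop.\<close>

definition forces_types :: "nat \<Rightarrow> bool" where
  "forces_types N \<longleftrightarrow> (\<forall>(R :: nat \<Rightarrow> nat \<Rightarrow> nat \<Rightarrow> bool) v.
     (\<forall>c x y. R c x y \<longrightarrow> R c y x) \<longrightarrow>
     (\<forall>k<3 * N. \<forall>l<3 * N. k < l \<longrightarrow> (\<exists>c<3. R c (v k) (v l))) \<longrightarrow>
     (\<exists>C u. (\<forall>r s. C r s = C s r \<and> C r s < (3::nat)) \<and>
        (\<forall>r<3. \<forall>b<2. \<exists>k<N. u r b = v (3 * k + r)) \<and>
        (\<forall>r<3. \<forall>s<3. R (C r s) (u r (0::nat)) (u s 1))))"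

text \<open>Ramsey's theorem is applied to the indices \<open>k < N\<close>, where the colour of a pair
\<open>k < l\<close> records the colours between all nine pairs of groups. Six indices of a
homogeneous set suffice: group \<open>r\<close> takes its representatives at the indices
\<open>2r\<close> and \<open>2r + 1\<close>, so that the order of the indices agrees with the
order of the groups.\<close>

lemma homogeneous_types: "\<exists>N. forces_types N"
proof -
  define H :: "(nat \<times> nat \<Rightarrow> nat) set" where "H = ({..<3} \<times> {..<3}) \<rightarrow>\<^sub>E {..<3}"
  have "finite H" unfolding H_def by (intro finite_PiE) auto
  from ramsey_finitely_many_colours[OF this, of 6]
  obtain N :: nat where N: "\<forall>h::nat \<Rightarrow> nat \<Rightarrow> (nat \<times> nat \<Rightarrow> nat). (\<forall>k<N. \<forall>l<N. k < l \<longrightarrow> h k l \<in> H) \<longrightarrow>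
    (\<exists>(t :: nat \<Rightarrow> nat) c. (\<forall>i<6. t i < N) \<and> (\<forall>i<6. \<forall>j<6. i < j \<longrightarrow> t i < t j \<and> h (t i) (t j) = c))" ..
  show ?thesis
    unfolding forces_types_def
  proof (intro exI[of _ N] allI impI)
    fix R :: "nat \<Rightarrow> nat \<Rightarrow> nat \<Rightarrow> bool" and v :: "nat \<Rightarrow> nat"
    assume sym: "\<forall>c x y. R c x y \<longrightarrow> R c y x" and col: "\<forall>k<3 * N. \<forall>l<3 * N. k < l \<longrightarrow> (\<exists>c<3. R c (v k) (v l))"
    define \<rho> where "\<rho> = (\<lambda>k l. SOME c. c < 3 \<and> R c (v k) (v l))"
    have \<rho>: "\<rho> k l < 3" "R (\<rho> k l) (v k) (v l)" if "k < l" "l < 3 * N" for k l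
    proof -
      have "\<exists>c. c < 3 \<and> R c (v k) (v l)" using col that by (meson less_trans)
      from someI_ex[OF this] show "\<rho> k l < 3" "R (\<rho> k l) (v k) (v l)" unfolding \<rho>_def by blast+
    qed
    define h where "h = (\<lambda>k l. restrict (\<lambda>(r, s). \<rho> (3 * k + r) (3 * l + s)) ({..<3} \<times> {..<3}))"
    have hH: "h k l \<in> H" if kl: "k < N" "l < N" "k < l" for k l
    proof -
      have "\<rho> (3 * k + r) (3 * l + s) < 3" if rs: "r < 3" "s < 3" for r s
      proof (rule \<rho>)
        show "3 * k + r < 3 * l + s" using rs kl by linarith
        show "3 * l + s < 3 * N" using rs kl by linarith
      qed
      then show ?thesis unfolding h_def H_def restrict_PiE_iff by auto
    qed
    have "\<forall>k<N. \<forall>l<N. k < l \<longrightarrow> h k l \<in> H" using hH by simp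
    with N[THEN spec, of h] obtain t :: "nat \<Rightarrow> nat" and c where tc: "(\<forall>i<6. t i < N) \<and> (\<forall>i<6. \<forall>j<6. i < j \<longrightarrow> t i < t j \<and> h (t i) (t j) = c)"
      by (elim impE exE)
    have t: "t i < N" if "i < 6" for i using tc that by simp
    have t2: "t i < t j \<and> h (t i) (t j) = c" if "i < 6" "j < 6" "i < j" for i j using tc that by simp
    define u where "u = (\<lambda>r b. v (3 * t (2 * r + b) + r))"
    define C where "C = (\<lambda>r s. if r < 3 \<and> s < 3 then c (min r s, max r s) else 0)"
    have rel: "R (c (r, s)) (u r b) (u s b') \<and> c (r, s) < 3"
      if "r < 3" "s < 3" "b < 2" "b' < 2" "2 * r + b < 2 * s + b'" for r s b b'
    proof -
      have i: "2 * r + b < 6" "2 * s + b' < 6" using that by linarith+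
      note tt = t2[OF i that(5)]
      have less: "3 * t (2 * r + b) + r < 3 * t (2 * s + b') + s" using tt that(1) by linarith
      have lt: "3 * t (2 * s + b') + s < 3 * N" using t[OF i(2)] that(2) by linarith
      have "h k l (r, s) = \<rho> (3 * k + r) (3 * l + s)" for k l
        using that(1,2) by (simp add: h_def)
      then have "c (r, s) = \<rho> (3 * t (2 * r + b) + r) (3 * t (2 * s + b') + s)"
        using tt by metis
      then show ?thesis using \<rho>[OF less lt] by (simp add: u_def)
    qed
    have c3: "c (r, s) < 3" if "r < 3" "s < 3" "r \<le> s" for r s
      using rel[of r s 0 1] that by simp
    show "\<exists>C u. (\<forall>r s. C r s = C s r \<and> C r s < (3::nat)) \<and>
        (\<forall>r<3. \<forall>b<2. \<exists>k<N. u r b = v (3 * k + r)) \<and>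
        (\<forall>r<3. \<forall>s<3. R (C r s) (u r (0::nat)) (u s 1))"
    proof (rule exI[of _ C], rule exI[of _ u], intro conjI allI impI)
      fix r s
      show "C r s = C s r" by (simp add: C_def min.commute max.commute)
      show "C r s < 3" unfolding C_def using c3[of "min r s" "max r s"] by simp
    next
      fix r b :: nat assume "r < 3" "b < 2"
      then have "t (2 * r + b) < N" using t[of "2 * r + b"] by linarith
      then show "\<exists>k<N. u r b = v (3 * k + r)" unfolding u_def by blast
    next
      fix r s :: nat assume rs: "r < 3" "s < 3"
      show "R (C r s) (u r 0) (u s 1)"
      proof (cases "r \<le> s")
        case True
        then show ?thesis using rel[of r s 0 1] rs by (simp add: C_def)
      next
        case False
        then have "R (c (s, r)) (u s 1) (u r 0)" using rel[of s r 1 0] rs by simp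
        then show ?thesis using sym False rs by (simp add: C_def)
      qed
    qed
  qed
qed

text \<open>Each chosen vertex excludes at most \<open>d\<close> later candidates.\<close>

lemma greedy_choice:
  fixes \<Gamma> :: "nat \<Rightarrow> 'v set" and Bad :: "('v \<times> 'v) set"
  assumes "finite V" "\<forall>k<M. \<Gamma> k \<subseteq> V" "\<forall>k<M. \<forall>x\<in>\<Gamma> k. real (card {y\<in>V. (x, y) \<in> Bad}) \<le> d"
    and "\<forall>k<M. real (card (\<Gamma> k)) > real M * d" and "d \<ge> 0"
  shows "\<exists>v. \<forall>k<M. v k \<in> \<Gamma> k \<and> (\<forall>l<k. (v l, v k) \<notin> Bad)"
proof -
  have "m \<le> M \<Longrightarrow> \<exists>v. \<forall>k<m. v k \<in> \<Gamma> k \<and> (\<forall>l<k. (v l, v k) \<notin> Bad)" for m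
  proof (induction m)
    case 0 then show ?case by simp
  next
    case (Suc m)
    have "m \<le> M" using Suc.prems by simp
    from Suc.IH[OF this] obtain v where v0: "\<forall>k<m. v k \<in> \<Gamma> k \<and> (\<forall>l<k. (v l, v k) \<notin> Bad)" ..
    then have v: "v k \<in> \<Gamma> k" "l < k \<Longrightarrow> (v l, v k) \<notin> Bad" if "k < m" for k l
      using that by simp_all
    define B where "B = (\<Union>l\<in>{..<m}. {y\<in>V. (v l, y) \<in> Bad})"
    have finB: "finite B" using assms(1) by (simp add: B_def)
    have "card B \<le> (\<Sum>l<m. card {y\<in>V. (v l, y) \<in> Bad})" unfolding B_def by (rule card_UN_le) simp
    then have "real (card B) \<le> real (\<Sum>l<m. card {y\<in>V. (v l, y) \<in> Bad})"
      by (simp only: of_nat_le_iff)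
    also have "\<dots> = (\<Sum>l<m. real (card {y\<in>V. (v l, y) \<in> Bad}))" by simp
    also have "\<dots> \<le> (\<Sum>l<m. d)"
    proof (rule sum_mono)
      fix l assume "l \<in> {..<m}"
      then have "l < m" by simp
      then show "real (card {y\<in>V. (v l, y) \<in> Bad}) \<le> d"
        using assms(3)[rule_format, of l "v l"] v(1)[of l] Suc.prems by linarith
    qed
    also have "\<dots> = real m * d" by simp
    also have "\<dots> \<le> real M * d" by (rule mult_right_mono) (use Suc.prems assms(5) in simp_all)
    also have "\<dots> < real (card (\<Gamma> m))" using assms(4)[rule_format, of m] Suc.prems by linarith
    finally have "card B < card (\<Gamma> m)" by (simp only: of_nat_less_iff)
    then have "\<not> \<Gamma> m \<subseteq> B" using card_mono[OF finB] by (meson not_less)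
    then obtain x where x: "x \<in> \<Gamma> m" "x \<notin> B" by blast
    have "m < M" using Suc.prems by linarith
    then have xV: "x \<in> V" using x(1) assms(2) by blast
    have "(v(m := x)) k \<in> \<Gamma> k \<and> (\<forall>l<k. ((v(m := x)) l, (v(m := x)) k) \<notin> Bad)" if "k < Suc m" for k
    proof (cases "k = m")
      case True
      have "(v l, x) \<notin> Bad" if "l < m" for l
        using x(2) xV that unfolding B_def by blast
      then show ?thesis using True x(1) by simp
    next
      case False
      then have k: "k < m" using that by simp
      then show ?thesis using v(1)[OF k] v(2)[OF k] by simp
    qed
    then show ?case by (intro exI[of _ "v(m := x)"]) simp
  qed
  from this[of M] show ?thesis by simp
qed

lemma list_three_points:
  fixes y :: "'a \<Rightarrow> real"
  assumes "finite S" "card S \<le> 3" "S \<noteq> {}" "\<forall>k\<in>S. y k \<ge> 0"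
  shows "\<exists>(g :: nat \<Rightarrow> 'a) m. (\<forall>r. g r \<in> S \<and> m r \<ge> 0) \<and> (\<forall>\<phi>. (\<Sum>r<3. m r * \<phi> (g r)) = (\<Sum>k\<in>S. y k * \<phi> k))"
proof -
  obtain l where l: "distinct l" "set l = S" using finite_distinct_list[OF assms(1)] by blast
  then have len: "length l \<le> 3" using assms(2) distinct_card[OF l(1)] by simp
  define g where "g = (\<lambda>r. if r < length l then l ! r else hd l)"
  define m where "m = (\<lambda>r::nat. if r < length l then y (l ! r) else 0)"
  have "l \<noteq> []" using l(2) assms(3) by auto
  have gS: "g r \<in> S" for r
  proof -
    have "g r \<in> set l" using \<open>l \<noteq> []\<close> by (simp add: g_def)
    then show ?thesis unfolding l(2) .
  qed
  have mr: "m r \<ge> 0" for r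
  proof (cases "r < length l")
    case True
    then have "l ! r \<in> S" unfolding l(2)[symmetric] by (rule nth_mem)
    then show ?thesis using assms(4) True by (simp add: m_def)
  qed (simp add: m_def)
  have eq: "(\<Sum>r<3. m r * \<phi> (g r)) = (\<Sum>k\<in>S. y k * \<phi> k)" for \<phi>
  proof -
    have "(\<Sum>r<3. m r * \<phi> (g r)) = (\<Sum>r<length l. m r * \<phi> (g r))"
      by (rule sum.mono_neutral_right) (use len in \<open>simp_all add: m_def\<close>)
    also have "\<dots> = (\<Sum>r<length l. y (l ! r) * \<phi> (l ! r))"
      by (rule sum.cong) (simp_all add: m_def g_def)
    also have "\<dots> = (\<Sum>k\<in>S. y k * \<phi> k)"
      by (rule sum.reindex_bij_betw[OF bij_betw_nth[OF l(1) refl l(2)[symmetric]]])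
    finally show ?thesis .
  qed
  show ?thesis by (intro exI[of _ g] exI[of _ m] conjI allI gS mr eq)
qed

lemma sum_below_three:
  fixes g :: "nat \<Rightarrow> real"
  shows "(\<Sum>r<3. g r) = g 0 + g 1 + g 2"
proof -
  have "{..<3} = {0, 1, 2 :: nat}" by auto
  then show ?thesis by simp
qed

text \<open>A homogeneous choice of representatives turns the groups into a triangle with coloured loops. The
locale speaks of all natural numbers as vertices, so the data are extended periodically.\<close>

lemma three_group_bound:
  fixes R :: "nat \<Rightarrow> nat \<Rightarrow> nat \<Rightarrow> bool" and \<Gamma> :: "nat \<Rightarrow> nat set" and f :: "nat \<Rightarrow> nat \<Rightarrow> real" and m :: "nat \<Rightarrow> real"
  assumes N: "forces_types N" and V: "finite V"
    and sym: "\<And>c x y. R c x y \<Longrightarrow> R c y x"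
    and sub: "\<And>r. r < 3 \<Longrightarrow> \<Gamma> r \<subseteq> V"
    and deg: "\<And>r x. r < 3 \<Longrightarrow> x \<in> \<Gamma> r \<Longrightarrow> real (card {y\<in>V. \<not> (\<exists>c<3. R c x y)}) \<le> d"
    and big: "\<And>r. r < 3 \<Longrightarrow> real (card (\<Gamma> r)) > real (3 * N) * d" and d: "d \<ge> 0"
    and f: "\<And>c r. f c r \<ge> 0"
    and cover: "\<And>c r s p q x y a b. c < 3 \<Longrightarrow> r < 3 \<Longrightarrow> s < 3 \<Longrightarrow> p < 3 \<Longrightarrow> q < 3 \<Longrightarrow>
       x \<in> \<Gamma> r \<Longrightarrow> y \<in> \<Gamma> s \<Longrightarrow> a \<in> \<Gamma> p \<Longrightarrow> b \<in> \<Gamma> q \<Longrightarrow>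
       R c x y \<Longrightarrow> R c x a \<Longrightarrow> R c y b \<Longrightarrow> 1 \<le> f c r + f c s + 2 * f c p + 3 * f c q"
    and m: "\<And>r. m r \<ge> 0" and cost: "\<And>c. c < 3 \<Longrightarrow> (\<Sum>r<3. m r * f c r) \<le> t"
  shows "7 * (\<Sum>r<3. m r) \<le> 78 * t"
proof -
  have t0: "0 \<le> t"
  proof -
    have "0 \<le> (\<Sum>r<3. m r * f 0 r)" by (intro sum_nonneg mult_nonneg_nonneg m f)
    also have "\<dots> \<le> t" by (rule cost) simp
    finally show ?thesis .
  qed
  define Bad where "Bad = {(x, y). \<not> (\<exists>c<3. R c x y)}"
  have mod3: "k mod 3 < 3" for k :: nat by simp
  have "\<exists>v. \<forall>k<3 * N. v k \<in> \<Gamma> (k mod 3) \<and> (\<forall>l<k. (v l, v k) \<notin> Bad)"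
  proof (rule greedy_choice[OF V, where d = d])
    show "\<forall>k<3 * N. \<Gamma> (k mod 3) \<subseteq> V" using sub[OF mod3] by blast
    show "\<forall>k<3 * N. \<forall>x\<in>\<Gamma> (k mod 3). real (card {y \<in> V. (x, y) \<in> Bad}) \<le> d"
      using deg[OF mod3] unfolding Bad_def by simp
    show "\<forall>k<3 * N. real (3 * N) * d < real (card (\<Gamma> (k mod 3)))" using big[OF mod3] by blast
  qed (rule d)
  then obtain v where v0: "\<forall>k<3 * N. v k \<in> \<Gamma> (k mod 3) \<and> (\<forall>l<k. (v l, v k) \<notin> Bad)" ..
  have v: "v k \<in> \<Gamma> (k mod 3)" if "k < 3 * N" for k using v0 that by simp
  have good: "\<exists>c<3. R c (v k) (v l)" if "k < l" "l < 3 * N" for k l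
  proof -
    have "(v k, v l) \<notin> Bad" using v0 that by simp
    then show ?thesis by (simp add: Bad_def)
  qed
  have "\<forall>c x y. R c x y \<longrightarrow> R c y x" using sym by simp
  moreover have "\<forall>k<3 * N. \<forall>l<3 * N. k < l \<longrightarrow> (\<exists>c<3. R c (v k) (v l))" using good by simp
  ultimately obtain C u where Cu: "(\<forall>r s. C r s = C s r \<and> C r s < (3::nat)) \<and>
        (\<forall>r<3. \<forall>b<2. \<exists>k<N. u r b = v (3 * k + r)) \<and>
        (\<forall>r<3. \<forall>s<3. R (C r s) (u r (0::nat)) (u s 1))"
    using N[unfolded forces_types_def, THEN spec, of R, THEN spec, of v] by (elim impE exE)
  have C: "C r s = C s r" "C r s < 3" for r s using Cu by simp_all
  have Ru: "R (C r s) (u r 0) (u s 1)" if "r < 3" "s < 3" for r s using Cu that by simp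
  have u: "u r b \<in> \<Gamma> r" if rb: "r < 3" "b < 2" for r b
  proof -
    have "\<exists>k<N. u r b = v (3 * k + r)" using Cu rb by simp
    then obtain k where k: "k < N" "u r b = v (3 * k + r)" by blast
    have "3 * k + r < 3 * N" using k(1) rb(1) by linarith
    moreover have "(3 * k + r) mod 3 = r" using rb(1) by simp
    ultimately show ?thesis using v[of "3 * k + r"] k(2) by simp
  qed
  have type_cover: "1 \<le> f c r + f c s + 2 * f c p + 3 * f c q"
    if "r < 3" "s < 3" "p < 3" "q < 3" "C r s = c" "C r p = c" "C s q = c" for c r s p q
  proof (rule cover[of c r s p q "u r 0" "u s 1" "u p 1" "u q 0"])
    show "c < 3" using C(2)[of r s] that(5) by simp
    show "R c (u r 0) (u s 1)" using Ru[of r s] that by simp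
    show "R c (u r 0) (u p 1)" using Ru[of r p] that by simp
    show "R c (u s 1) (u q 0)" using Ru[of q s] sym C(1)[of s q] that by simp
  qed (use that u in simp_all)
  define w' where "w' = (\<lambda>c r. if c < 3 then f c (r mod 3) else 0)"
  define C' where "C' = (\<lambda>r s :: nat. C (r mod 3) (s mod 3))"
  define m' where "m' = (\<lambda>r :: nat. m (r mod 3))"
  interpret coloured_cover w' C' m' "{0, 1, 2}" t
  proof
    show "C' a b = C' b a" for a b using C(1) by (simp add: C'_def)
    show "ds_cover (w' c) (\<lambda>a b. C' a b = c)" for c
      unfolding ds_cover_def
    proof (intro allI impI)
      fix r s p q assume *: "C' r s = c" "C' r p = c" "C' s q = c"
      then have "c < 3" using C(2) by (auto simp: C'_def)
      then show "1 \<le> w' c r + w' c s + 2 * w' c p + 3 * w' c q"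
        using type_cover[OF mod3 mod3 mod3 mod3 *[unfolded C'_def]] by (simp add: w'_def)
    qed
    show "0 \<le> w' c a" for c a using f by (simp add: w'_def)
    show "0 \<le> m' a" for a using m by (simp add: m'_def)
    show "(\<Sum>a\<in>{0, 1, 2}. m' a * w' c a) \<le> t" for c
    proof (cases "c < 3")
      case True
      have "(\<Sum>a\<in>{0, 1, 2}. m' a * w' c a) = (\<Sum>r<3. m r * f c r)"
        unfolding sum_below_three using True by (simp add: w'_def m'_def)
      then show ?thesis using cost[OF True] by simp
    next
      case False
      then show ?thesis using t0 by (simp add: w'_def)
    qed
  qed
  have "7 * sum m' {0, 1, 2} \<le> 78 * t"
  proof (rule three_types[of 0 1 2 0 1 2])
    show "tri 0 1 2" unfolding tri_def by simp
    have "C' a b \<in> {0, 1, 2}" for a b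
    proof -
      have "C' a b < 3" using C(2) by (simp add: C'_def)
      then have "C' a b = 0 \<or> C' a b = 1 \<or> C' a b = 2" by linarith
      then show ?thesis by simp
    qed
    then show "\<forall>a\<in>{0, 1, 2}. \<forall>b\<in>{0, 1, 2}. C' a b \<in> {0, 1, 2}" by simp
  qed
  moreover have "sum m' {0, 1, 2} = (\<Sum>r<3. m r)"
    unfolding sum_below_three by (simp add: m'_def)
  ultimately show ?thesis by simp
qed

section \<open>Covers of a coloured complete graph are expensive\<close>

lemma few_high_degrees:
  fixes V :: "'v set"
  assumes V: "finite V" "V \<noteq> {}" and e: "e > 0"
    and poor: "real (card {(x, y) \<in> V \<times> V. B x y}) \<le> e\<^sup>2 * (real (card V))\<^sup>2"
  shows "real (card {x\<in>V. real (card {y\<in>V. B x y}) > e * real (card V)}) \<le> e * real (card V)"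
proof -
  define A where "A = {x\<in>V. real (card {y\<in>V. B x y}) > e * real (card V)}"
  have finA: "finite A" using V(1) by (simp add: A_def)
  have pos: "e * real (card V) > 0" using V e by (simp add: card_gt_0_iff)
  have "real (card A) * (e * real (card V)) = (\<Sum>x\<in>A. e * real (card V))" by simp
  also have "\<dots> \<le> (\<Sum>x\<in>A. real (card {y\<in>V. B x y}))"
    by (rule sum_mono) (simp add: A_def)
  also have "\<dots> = real (\<Sum>x\<in>A. card {y\<in>V. B x y})" by simp
  also have "(\<Sum>x\<in>A. card {y\<in>V. B x y}) = card (SIGMA x:A. {y\<in>V. B x y})"
    using finA V(1) by (simp add: card_SigmaI)
  also have "real \<dots> \<le> real (card {(x, y) \<in> V \<times> V. B x y})"
  proof -
    have "(SIGMA x:A. {y\<in>V. B x y}) \<subseteq> {(x, y) \<in> V \<times> V. B x y}" by (auto simp: A_def)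
    moreover have "finite {(x, y) \<in> V \<times> V. B x y}"
      by (rule finite_subset[of _ "V \<times> V"]) (use V(1) in auto)
    ultimately show ?thesis by (simp add: card_mono)
  qed
  also have "\<dots> \<le> (e * real (card V)) * (e * real (card V))"
    using poor by (simp add: power2_eq_square mult_ac)
  finally show ?thesis using pos mult_le_cancel_right_pos[OF pos] unfolding A_def by blast
qed

definition round_up :: "nat \<Rightarrow> real \<Rightarrow> nat" where
  "round_up G a = nat \<lceil>real G * a\<rceil>"

lemma round_up:
  assumes "0 \<le> a" "a \<le> 1" "G \<ge> 1"
  shows "a \<le> real (round_up G a) / real G" "real (round_up G a) / real G \<le> a + 1 / real G" "round_up G a \<le> G"
proof -
  have nn: "0 \<le> real G * a" using assms by simp
  have G: "real G > 0" using assms(3) by simp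
  have lo: "real G * a \<le> real (round_up G a)" unfolding round_up_def using nn by linarith
  have hi: "real (round_up G a) \<le> real G * a + 1" unfolding round_up_def using nn by linarith
  show "a \<le> real (round_up G a) / real G" using lo G by (simp add: pos_le_divide_eq mult.commute)
  show "real (round_up G a) / real G \<le> a + 1 / real G" using hi G by (simp add: field_simps)
  have "real G * a \<le> real G * 1" using assms(2) by (intro mult_left_mono) simp_all
  then have "real G * a \<le> of_int (int G)" by simp
  then have "\<lceil>real G * a\<rceil> \<le> int G" by (simp only: ceiling_le_iff)
  then show "round_up G a \<le> G" unfolding round_up_def by linarith
qed

text \<open>The vertices are grouped by their weights, rounded up to multiples of \<open>1/G\<close>. Rounding
up preserves the cover inequalities and costs at most \<open>|V|/G\<close>. Groups with fewer than
\<open>\<kappa> |V|\<close> vertices are discarded, and the remaining ones can be replaced by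
three groups with new masses, since the costs are linear in the masses.\<close>

lemma cover_cost_bound:
  fixes V V' :: "nat set" and R :: "nat \<Rightarrow> nat \<Rightarrow> nat \<Rightarrow> bool" and w :: "nat \<Rightarrow> nat \<Rightarrow> real"
  assumes N: "forces_types N" and V: "finite V" "V \<noteq> {}" and V': "V' \<subseteq> V"
    and sym: "\<And>c x y. R c x y \<Longrightarrow> R c y x"
    and \<kappa>: "\<kappa> > 0" and G: "G \<ge> 1"
    and poor: "real (card {(x, y) \<in> V \<times> V. \<not> (\<exists>c<3. R c x y)}) \<le> (\<kappa> / real (3 * N + 2))\<^sup>2 * (real (card V))\<^sup>2"
    and w: "\<And>c x. x \<in> V' \<Longrightarrow> 0 \<le> w c x \<and> w c x \<le> 1"
    and cover: "\<And>c x y a b. c < 3 \<Longrightarrow> x \<in> V' \<Longrightarrow> y \<in> V' \<Longrightarrow> a \<in> V' \<Longrightarrow> b \<in> V' \<Longrightarrow>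
       R c x y \<Longrightarrow> R c x a \<Longrightarrow> R c y b \<Longrightarrow> 1 \<le> w c x + w c y + 2 * w c a + 3 * w c b"
    and cost: "\<And>c. c < 3 \<Longrightarrow> (\<Sum>x\<in>V'. w c x) \<le> t"
  shows "7 * (real (card V') - real (G + 1) ^ 3 * \<kappa> * real (card V)) \<le> 78 * (t + real (card V) / real G)"
proof -
  define n where "n = real (card V)"
  have n: "n > 0" using V by (simp add: n_def card_gt_0_iff)
  have finV': "finite V'" using V' V(1) by (rule finite_subset)
  have G0: "real G > 0" using G by simp
  define key where "key = (\<lambda>x. (round_up G (w 0 x), round_up G (w 1 x), round_up G (w 2 x)))"
  define f where "f = (\<lambda>(c::nat) (k :: nat \<times> nat \<times> nat). real (if c = 0 then fst k else if c = 1 then fst (snd k) else snd (snd k)) / real G)"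
  have f_nonneg: "f c k \<ge> 0" for c k by (simp add: f_def)
  have f_key: "f c (key x) = real (round_up G (w c x)) / real G" if "c < 3" for c x
  proof -
    have "c = 0 \<or> c = 1 \<or> c = 2" using that by linarith
    then show ?thesis by (auto simp: f_def key_def)
  qed
  have f_ge: "w c x \<le> f c (key x)" and f_le: "f c (key x) \<le> w c x + 1 / real G" if "c < 3" "x \<in> V'" for c x
    using round_up[of "w c x" G] w[OF that(2), of c] G unfolding f_key[OF that(1)] by simp_all
  define KS :: "(nat \<times> nat \<times> nat) set" where "KS = {0..G} \<times> {0..G} \<times> {0..G}"
  have KS: "finite KS" "real (card KS) = real (G + 1) ^ 3"
    by (simp_all add: KS_def card_cartesian_product power3_eq_cube algebra_simps)
  have keyKS: "key ` V' \<subseteq> KS"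
    using round_up(3) w G by (auto simp: key_def KS_def)
  define mass where "mass = (\<lambda>k. real (card {x\<in>V'. key x = k}))"
  have mass_nonneg: "mass k \<ge> 0" for k by (simp add: mass_def)
  have fibre: "(\<Sum>k\<in>KS. mass k * \<phi> k) = (\<Sum>x\<in>V'. \<phi> (key x))" for \<phi> :: "_ \<Rightarrow> real"
  proof -
    have "(\<Sum>k\<in>KS. mass k * \<phi> k) = (\<Sum>k\<in>KS. \<Sum>x\<in>{x\<in>V'. key x = k}. \<phi> (key x))"
      by (rule sum.cong) (simp_all add: mass_def)
    also have "\<dots> = (\<Sum>x\<in>V'. \<phi> (key x))"
      by (rule sum.group[OF finV' KS(1) keyKS])
    finally show ?thesis .
  qed
  define S where "S = {k\<in>KS. mass k \<ge> \<kappa> * n}"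
  have S: "finite S" "S \<subseteq> KS" using KS(1) by (auto simp: S_def)
  have massS: "(\<Sum>k\<in>S. mass k) \<ge> real (card V') - real (G + 1) ^ 3 * \<kappa> * n"
  proof -
    have "(\<Sum>k\<in>KS. mass k) = real (card V')" using fibre[of "\<lambda>_. 1"] by simp
    moreover have "(\<Sum>k\<in>KS. mass k) = (\<Sum>k\<in>KS - S. mass k) + (\<Sum>k\<in>S. mass k)"
      by (rule sum.subset_diff[OF S(2) KS(1)])
    moreover have "(\<Sum>k\<in>KS - S. mass k) \<le> (\<Sum>k\<in>KS - S. \<kappa> * n)"
      by (rule sum_mono) (auto simp: S_def)
    moreover have "(\<Sum>k\<in>KS - S. \<kappa> * n) \<le> (\<Sum>k\<in>KS. \<kappa> * n)"
      by (rule sum_mono2) (use KS(1) \<kappa> n in simp_all)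
    moreover have "(\<Sum>k\<in>KS. \<kappa> * n) = real (G + 1) ^ 3 * \<kappa> * n" using KS(2) by simp
    ultimately show ?thesis by linarith
  qed
  have t': "(\<Sum>k\<in>S. mass k * f c k) \<le> t + n / real G" if c: "c < 3" for c
  proof -
    have "(\<Sum>k\<in>S. mass k * f c k) \<le> (\<Sum>k\<in>KS. mass k * f c k)"
      by (rule sum_mono2[OF KS(1) S(2)]) (simp add: mass_nonneg f_nonneg)
    also have "\<dots> = (\<Sum>x\<in>V'. f c (key x))" by (rule fibre)
    also have "\<dots> \<le> (\<Sum>x\<in>V'. w c x + 1 / real G)" by (rule sum_mono) (rule f_le[OF c])
    also have "\<dots> = (\<Sum>x\<in>V'. w c x) + real (card V') / real G" by (simp add: sum.distrib)
    also have "\<dots> \<le> t + n / real G"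
      using cost[OF c] card_mono[OF V(1) V'] G0 by (intro add_mono divide_right_mono) (simp_all add: n_def)
    finally show ?thesis .
  qed
  have "\<exists>S' y. S' \<subseteq> S \<and> card S' \<le> 3 \<and> (\<forall>p\<in>S'. y p \<ge> 0) \<and> (\<Sum>p\<in>S'. y p) = (\<Sum>p\<in>S. mass p)
     \<and> (\<forall>c<3. (\<Sum>p\<in>S'. y p * f c p) \<le> (\<Sum>p\<in>S. mass p * f c p))"
    by (rule three_points_suffice[OF S(1)]) (simp add: mass_nonneg)
  then obtain S' y where S': "S' \<subseteq> S" "card S' \<le> 3" "\<forall>p\<in>S'. y p \<ge> 0" "(\<Sum>p\<in>S'. y p) = (\<Sum>p\<in>S. mass p)"
     and S'c: "\<forall>c<3. (\<Sum>p\<in>S'. y p * f c p) \<le> (\<Sum>p\<in>S. mass p * f c p)" by (elim exE conjE)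
  have finS': "finite S'" using S'(1) S(1) by (rule finite_subset)
  have t0: "0 \<le> t + n / real G"
  proof -
    have "0 \<le> (\<Sum>k\<in>S. mass k * f 0 k)" by (intro sum_nonneg mult_nonneg_nonneg mass_nonneg f_nonneg)
    also have "\<dots> \<le> t + n / real G" by (rule t') simp
    finally show ?thesis .
  qed
  have "7 * (\<Sum>k\<in>S'. y k) \<le> 78 * (t + n / real G)"
  proof (cases "S' = {}")
    case True
    then show ?thesis using t0 by simp
  next
    case False
    obtain g :: "nat \<Rightarrow> nat \<times> nat \<times> nat" and m where gm: "(\<forall>r. g r \<in> S' \<and> m r \<ge> 0) \<and>
      (\<forall>\<phi>. (\<Sum>r<3. m r * \<phi> (g r)) = (\<Sum>k\<in>S'. y k * \<phi> k))"
      using list_three_points[OF finS' S'(2) False S'(3)] by (elim exE)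
    have g: "g r \<in> S'" and m: "m r \<ge> 0" for r using gm by simp_all
    have msum: "(\<Sum>r<3. m r * \<phi> (g r)) = (\<Sum>k\<in>S'. y k * \<phi> k)" for \<phi> using gm by simp
    \<comment> \<open>a group has to survive the removal of the vertices of high degree and of \<open>3N\<close> neighbourhoods\<close>
    define e where "e = \<kappa> / real (3 * N + 2)"
    have e: "e > 0" using \<kappa> by (simp add: e_def)
    define High where "High = {x\<in>V. real (card {y\<in>V. \<not> (\<exists>c<3. R c x y)}) > e * n}"
    have High: "real (card High) \<le> e * n"
      unfolding High_def n_def by (rule few_high_degrees[OF V e]) (use poor in \<open>simp add: e_def\<close>)
    have finHigh: "finite High" using V(1) by (simp add: High_def)
    define \<Gamma> where "\<Gamma> = (\<lambda>r. {x\<in>V'. key x = g r} - High)"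
    have "7 * (\<Sum>r<3. m r) \<le> 78 * (t + n / real G)"
    proof (rule three_group_bound[OF N V(1), where R = R and \<Gamma> = \<Gamma> and d = "e * n" and f = "\<lambda>c r. f c (g r)"])
      show "R c y x" if "R c x y" for c x y using sym that .
      show "\<Gamma> r \<subseteq> V" for r using V' by (auto simp: \<Gamma>_def)
      show "real (card {y \<in> V. \<not> (\<exists>c<3. R c x y)}) \<le> e * n" if "x \<in> \<Gamma> r" for r x
      proof -
        have "x \<in> V" "x \<notin> High" using that V' by (auto simp: \<Gamma>_def)
        then show ?thesis unfolding High_def by (metis (mono_tags, lifting) CollectI linorder_not_less)
      qed
      show "real (3 * N) * (e * n) < real (card (\<Gamma> r))" for r
      proof -
        have "g r \<in> S" using g S'(1) by blast
        then have "\<kappa> * n \<le> mass (g r)" by (simp add: S_def)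
        moreover have "card {x\<in>V'. key x = g r} - card High \<le> card (\<Gamma> r)"
          unfolding \<Gamma>_def by (rule diff_card_le_card_Diff[OF finHigh])
        then have "mass (g r) - real (card High) \<le> real (card (\<Gamma> r))" unfolding mass_def by linarith
        moreover have "\<kappa> = real (3 * N + 2) * e" by (simp add: e_def)
        then have "\<kappa> * n = real (3 * N) * (e * n) + 2 * (e * n)" by (simp add: algebra_simps)
        moreover have "e * n > 0" using e n by simp
        ultimately show ?thesis using High by linarith
      qed
      show "0 \<le> e * n" using e n by simp
      show "0 \<le> f c (g r)" for c r by (rule f_nonneg)
      show "1 \<le> f c (g r) + f c (g s) + 2 * f c (g p) + 3 * f c (g q)"
        if c: "c < 3" and mem: "x \<in> \<Gamma> r" "z \<in> \<Gamma> s" "a \<in> \<Gamma> p" "b \<in> \<Gamma> q" and rel: "R c x z" "R c x a" "R c z b"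
        for c r s p q x z a b
      proof -
        have in': "x \<in> V'" "z \<in> V'" "a \<in> V'" "b \<in> V'" and k: "key x = g r" "key z = g s" "key a = g p" "key b = g q"
          using mem by (simp_all add: \<Gamma>_def)
        have "1 \<le> w c x + w c z + 2 * w c a + 3 * w c b" by (rule cover[OF c in' rel])
        then show ?thesis
          using f_ge[OF c in'(1)] f_ge[OF c in'(2)] f_ge[OF c in'(3)] f_ge[OF c in'(4)] unfolding k by linarith
      qed
      show "0 \<le> m r" for r by (rule m)
      show "(\<Sum>r<3. m r * f c (g r)) \<le> t + n / real G" if "c < 3" for c
        unfolding msum using S'c t'[OF that] that by fastforce
    qed
    moreover have "(\<Sum>r<3. m r) = (\<Sum>k\<in>S'. y k)" using msum[of "\<lambda>_. 1"] by simp
    ultimately show ?thesis by simp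
  qed
  moreover have "7 * (real (card V') - real (G + 1) ^ 3 * \<kappa> * n) \<le> 7 * (\<Sum>k\<in>S'. y k)"
    using massS S'(4) by (intro mult_left_mono) simp_all
  ultimately show ?thesis unfolding n_def by (rule order_trans[rotated])
qed

section \<open>The lower bound\<close>

lemma rich_sym:
  assumes "rich \<delta> E X Y" "\<And>a b. E a b \<Longrightarrow> E b a"
  shows "rich \<delta> E Y X"
  unfolding rich_def
proof (intro allI impI)
  fix A B assume "A \<subseteq> Y" "B \<subseteq> X" "\<delta> * real (card Y) \<le> real (card A)" "\<delta> * real (card X) \<le> real (card B)"
  then obtain b a where "b \<in> B" "a \<in> A" "E b a" using richD[OF assms(1), of B A] by blast
  then show "\<exists>a\<in>A. \<exists>b\<in>B. E a b" using assms(2) by blast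
qed

text \<open>All error terms are controlled by \<open>z\<close>. The parameters are chosen in the order
\<open>G\<close>, \<open>\<kappa>\<close>, \<open>\<delta>\<close>, \<open>\<epsilon>\<close>,
number of clusters, \<open>n\<close>: each may depend on those before it.\<close>

lemma mono_packing_number_lower:
  assumes \<zeta>: "\<zeta> > 0"
  shows "\<exists>n0. \<forall>n\<ge>n0. \<forall>\<chi>\<in>edges (complete_graph n) \<rightarrow>\<^sub>E {1..3}.
    (7 / 78 - \<zeta>) * real n \<le> real (mono_packing_number 3 (double_star 2 3) (complete_graph n) \<chi>)"
proof -
  define z where "z = min (\<zeta> / 3) (1 / 2)"
  have z: "z > 0" "z \<le> 1 / 2" "3 * z \<le> \<zeta>" using \<zeta> by (simp_all add: z_def min_def)
  define G where "G = nat \<lceil>1 / z\<rceil>"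
  have "1 / z > 0" using z(1) by simp
  then have Gz: "1 / z \<le> real G" "G \<ge> 1" unfolding G_def by linarith+
  then have G: "G \<ge> 1" "1 / real G \<le> z" using z(1) by (simp_all add: field_simps)
  define \<kappa> where "\<kappa> = z / real (G + 1) ^ 3"
  have \<kappa>: "\<kappa> > 0" "real (G + 1) ^ 3 * \<kappa> = z" using z(1) by (simp_all add: \<kappa>_def)
  obtain N where N: "forces_types N" using homogeneous_types ..
  define \<delta> where "\<delta> = z / 40"
  have \<delta>: "\<delta> > 0" "40 * \<delta> = z" "40 * \<delta> < 1" using z by (simp_all add: \<delta>_def)
  define \<epsilon> where "\<epsilon> = (\<kappa> / real (3 * N + 2))\<^sup>2"
  have \<epsilon>: "\<epsilon> > 0" using \<kappa>(1) by (simp add: \<epsilon>_def)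
  obtain K where K: "\<forall>(V::nat set) col. finite V \<longrightarrow> (\<forall>x\<in>V. \<forall>y\<in>V. col x y < 3) \<longrightarrow>
    (\<exists>F. finite F \<and> card F \<le> K \<and> real (card (poor_pairs V 3 col \<delta> F)) \<le> \<epsilon> * real (card V) ^ 2)"
    using hole_regularity[OF \<delta>(1) \<epsilon>, of 3] ..
  define L :: real where "L = 2 ^ K"
  have L: "L \<ge> 1" by (simp add: L_def)
  \<comment> \<open>clusters with fewer than \<open>\<kappa>0 n\<close> vertices are ignored; together they have at most \<open>z n\<close> vertices\<close>
  define \<kappa>0 where "\<kappa>0 = z / L"
  have \<kappa>0: "\<kappa>0 > 0" "L * \<kappa>0 = z" using z(1) L by (simp_all add: \<kappa>0_def)
  define n0 where "n0 = nat \<lceil>1 / (\<kappa>0 * \<delta>)\<rceil> + nat \<lceil>L ^ 4 / z\<rceil> + 1"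
  show ?thesis
  proof (intro exI[of _ n0] allI impI ballI)
    fix n :: nat and \<chi> :: "nat set \<Rightarrow> nat" assume n: "n0 \<le> n" and \<chi>: "\<chi> \<in> edges (complete_graph n) \<rightarrow>\<^sub>E {1..3}"
    have "1 / (\<kappa>0 * \<delta>) \<le> real n" "L ^ 4 / z \<le> real n" "n > 0" using n unfolding n0_def by linarith+
    then have n_large: "1 \<le> \<kappa>0 * real n * \<delta>" "L ^ 4 \<le> z * real n" "n > 0"
      using \<kappa>0(1) \<delta>(1) z(1) by (simp_all add: pos_divide_le_eq mult_ac)
    let ?\<nu> = "real (mono_packing_number 3 (double_star 2 3) (complete_graph n) \<chi>)"
    \<comment> \<open>extended to singletons, so that the regularity lemma applies to all pairs of vertices\<close>
    define \<psi> where "\<psi> = (\<lambda>e. if e \<in> edges (complete_graph n) then \<chi> e else 1)"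
    have \<psi>: "\<psi> e \<in> {1..3}" for e using \<chi> by (auto simp: \<psi>_def PiE_iff)
    have same_class: "colour_class (complete_graph n) \<psi> c = colour_class (complete_graph n) \<chi> c" for c
      by (auto simp: colour_class_def \<psi>_def)
    define V where "V = {..<n}"
    have V: "finite V" "V \<noteq> {}" "card V = n" using n_large(3) by (auto simp: V_def)
    define E where "E = (\<lambda>c a b. \<psi> {a, b} = Suc c)"
    define col where "col = (\<lambda>x y. \<psi> {x, y} - 1)"
    have col: "(\<lambda>a b. col a b = c) = E c" for c
    proof (intro ext)
      fix a b show "(col a b = c) = E c a b" using \<psi>[of "{a, b}"] by (auto simp: col_def E_def)
    qed
    have E_sym: "E c b a" if "E c a b" for c a b using that by (simp add: E_def insert_commute)
    have "col x y < 3" for x y using \<psi>[of "{x, y}"] by (auto simp: col_def)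
    then have "\<exists>F. finite F \<and> card F \<le> K \<and> real (card (poor_pairs V 3 col \<delta> F)) \<le> \<epsilon> * real (card V) ^ 2"
      by (intro K[rule_format] V(1))
    then obtain F where F: "finite F" "card F \<le> K" "real (card (poor_pairs V 3 col \<delta> F)) \<le> \<epsilon> * real (card V) ^ 2"
      by (elim exE conjE)
    define At where "At = atom V F"
    have At_self: "x \<in> At x" if "x \<in> V" for x using atom_self[OF that] by (simp add: At_def)
    have At_sub: "At x \<subseteq> V" for x by (simp add: At_def atom_subset)
    have finAt: "finite (At ` V)" and cardAt: "real (card (At ` V)) \<le> L"
    proof -
      show "finite (At ` V)" using card_atoms(1)[OF F(1)] by (simp add: At_def)
      have "card (At ` V) \<le> 2 ^ card F" using card_atoms(2)[OF F(1)] by (simp add: At_def)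
      also have "\<dots> \<le> 2 ^ K" using F(2) by simp
      finally have "real (card (At ` V)) \<le> real (2 ^ K)" by (simp only: of_nat_le_iff)
      then show "real (card (At ` V)) \<le> L" by (simp add: L_def)
    qed
    define Q where "Q = {q \<in> At ` V. \<kappa>0 * real n \<le> real (card q)}"
    have Q_sub: "Q \<subseteq> At ` V" by (auto simp: Q_def)
    have finQ: "finite Q" using Q_sub finAt by (rule finite_subset)
    have cardQ: "real (card Q) \<le> L" using card_mono[OF finAt Q_sub] cardAt by linarith
    have fibre: "{x\<in>V. At x = q} = q" if q: "q \<in> At ` V" for q
    proof -
      obtain y where y: "q = At y" using q by blast
      have "x \<in> V \<and> At x = At y \<longleftrightarrow> x \<in> At y" for x
        using At_self[of x] At_sub[of y] atom_eq[of x V F y] unfolding At_def by blast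
      then show ?thesis unfolding y by blast
    qed
    have Q: "\<forall>X\<in>Q. X \<subseteq> {..<n} \<and> 1 \<le> \<delta> * real (card X)"
    proof
      fix X assume X: "X \<in> Q"
      have "X \<subseteq> V" using X Q_sub At_sub by blast
      moreover have "\<kappa>0 * real n * \<delta> \<le> real (card X) * \<delta>"
        using X \<delta>(1) by (intro mult_right_mono) (simp_all add: Q_def)
      then have "1 \<le> \<delta> * real (card X)" using n_large(1) by (simp add: mult.commute)
      ultimately show "X \<subseteq> {..<n} \<and> 1 \<le> \<delta> * real (card X)" by (simp add: V_def)
    qed
    have disj: "\<forall>X\<in>Q. \<forall>Y\<in>Q. X = Y \<or> X \<inter> Y = {}"
    proof (intro ballI)
      fix X Y assume "X \<in> Q" "Y \<in> Q"
      then obtain x y where "X = atom V F x" "Y = atom V F y" using Q_sub unfolding At_def by blast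
      then show "X = Y \<or> X \<inter> Y = {}" using atom_disjoint[of V F x y] by blast
    qed
    define t where "t = (?\<nu> + L ^ 4) / (1 - z)"
    have "\<exists>w. (\<forall>q\<in>Q. 0 \<le> w q) \<and>
      (\<forall>i\<in>Q. \<forall>j\<in>Q. \<forall>a\<in>Q. \<forall>b\<in>Q. rich \<delta> (E c) i j \<longrightarrow> rich \<delta> (E c) i a \<longrightarrow> rich \<delta> (E c) j b \<longrightarrow> w i + w j + 2 * w a + 3 * w b \<ge> 1) \<and>
      (c < 3 \<longrightarrow> (\<Sum>q\<in>Q. w q * real (card q)) \<le> t)" for c
    proof -
      let ?p = "real (packing_number (double_star 2 3) (colour_class (complete_graph n) \<psi> (Suc c)))"
      obtain w where w: "\<forall>q\<in>Q. 0 \<le> w q"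
        "\<forall>i\<in>Q. \<forall>j\<in>Q. \<forall>a\<in>Q. \<forall>b\<in>Q. rich \<delta> (E c) i j \<longrightarrow> rich \<delta> (E c) i a \<longrightarrow> rich \<delta> (E c) j b \<longrightarrow> w i + w j + 2 * w a + 3 * w b \<ge> 1"
        "(\<Sum>q\<in>Q. w q * real (card q)) \<le> (?p + real (card Q) ^ 4) / (1 - 40 * \<delta>)"
        using colour_weights[OF \<delta>(1,3) finQ Q disj, of \<psi> "Suc c"] unfolding E_def by (elim exE conjE)
      have "(\<Sum>q\<in>Q. w q * real (card q)) \<le> t" if c: "c < 3"
      proof -
        have "packing_number (double_star 2 3) (colour_class (complete_graph n) \<psi> (Suc c))
            \<le> mono_packing_number 3 (double_star 2 3) (complete_graph n) \<chi>"
          unfolding mono_packing_number_def same_class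
          by (intro Max_ge finite_imageI imageI) (use c in simp_all)
        then have "?p \<le> ?\<nu>" by (simp only: of_nat_le_iff)
        moreover have "real (card Q) ^ 4 \<le> L ^ 4" using cardQ by (intro power_mono) simp_all
        ultimately have "(?p + real (card Q) ^ 4) / (1 - 40 * \<delta>) \<le> t"
          unfolding t_def \<delta>(2) using z(2) by (intro divide_right_mono) simp_all
        then show ?thesis using w(3) by (rule order_trans[rotated])
      qed
      then show ?thesis using w(1,2) by blast
    qed
    then have "\<forall>c. \<exists>w. (\<forall>q\<in>Q. 0 \<le> w q) \<and>
      (\<forall>i\<in>Q. \<forall>j\<in>Q. \<forall>a\<in>Q. \<forall>b\<in>Q. rich \<delta> (E c) i j \<longrightarrow> rich \<delta> (E c) i a \<longrightarrow> rich \<delta> (E c) j b \<longrightarrow> w i + w j + 2 * w a + 3 * w b \<ge> 1) \<and>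
      (c < 3 \<longrightarrow> (\<Sum>q\<in>Q. w q * real (card q)) \<le> t)" by (rule allI)
    from choice[OF this] obtain W where W: "\<forall>c. (\<forall>q\<in>Q. 0 \<le> W c q) \<and>
      (\<forall>i\<in>Q. \<forall>j\<in>Q. \<forall>a\<in>Q. \<forall>b\<in>Q. rich \<delta> (E c) i j \<longrightarrow> rich \<delta> (E c) i a \<longrightarrow> rich \<delta> (E c) j b \<longrightarrow> W c i + W c j + 2 * W c a + 3 * W c b \<ge> 1) \<and>
      (c < 3 \<longrightarrow> (\<Sum>q\<in>Q. W c q * real (card q)) \<le> t)" ..
    have W0: "0 \<le> W c q" if "q \<in> Q" for c q using W that by simp
    have W1: "1 \<le> W c i + W c j + 2 * W c a + 3 * W c b"
      if "i \<in> Q" "j \<in> Q" "a \<in> Q" "b \<in> Q" "rich \<delta> (E c) i j" "rich \<delta> (E c) i a" "rich \<delta> (E c) j b" for c i j a b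
      using W that by simp
    have Wt: "(\<Sum>q\<in>Q. W c q * real (card q)) \<le> t" if "c < 3" for c using W that by simp
    define V' where "V' = {x\<in>V. At x \<in> Q}"
    have V': "V' \<subseteq> V" by (auto simp: V'_def)
    \<comment> \<open>truncation at one keeps the cover inequalities, in which all coefficients are at least one\<close>
    define w where "w = (\<lambda>c x. min 1 (W c (At x)))"
    define R where "R = (\<lambda>c x y. rich \<delta> (E c) (At x) (At y))"
    have bound: "7 * (real (card V') - real (G + 1) ^ 3 * \<kappa> * real (card V)) \<le> 78 * (t + real (card V) / real G)"
    proof (rule cover_cost_bound[OF N V(1,2) V', where R = R and w = w])
      show "R c y x" if "R c x y" for c x y
        using rich_sym[of \<delta> "E c" "At x" "At y"] E_sym that unfolding R_def by blast
      show "\<kappa> > 0" "G \<ge> 1" by fact+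
      have "{(x, y) \<in> V \<times> V. \<not> (\<exists>c<3. R c x y)} = poor_pairs V 3 col \<delta> F"
        unfolding poor_pairs_def col R_def At_def ..
      then show "real (card {(x, y) \<in> V \<times> V. \<not> (\<exists>c<3. R c x y)}) \<le> (\<kappa> / real (3 * N + 2))\<^sup>2 * (real (card V))\<^sup>2"
        using F(3) unfolding \<epsilon>_def by simp
      show "0 \<le> w c x \<and> w c x \<le> 1" if "x \<in> V'" for c x
        using W0[of "At x" c] that by (simp add: w_def V'_def)
      show "1 \<le> w c x + w c y + 2 * w c a + 3 * w c b"
        if mem: "x \<in> V'" "y \<in> V'" "a \<in> V'" "b \<in> V'" and rel: "R c x y" "R c x a" "R c y b" for c x y a b
      proof -
        have q: "At x \<in> Q" "At y \<in> Q" "At a \<in> Q" "At b \<in> Q" using mem by (simp_all add: V'_def)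
        have "1 \<le> W c (At x) + W c (At y) + 2 * W c (At a) + 3 * W c (At b)"
          by (rule W1[OF q rel[unfolded R_def]])
        then show ?thesis
          using W0[OF q(1), of c] W0[OF q(2), of c] W0[OF q(3), of c] W0[OF q(4), of c]
          unfolding w_def min_def by (simp split: if_split)
      qed
      show "(\<Sum>x\<in>V'. w c x) \<le> t" if c: "c < 3" for c
      proof -
        have "(\<Sum>x\<in>V'. w c x) \<le> (\<Sum>x\<in>V'. W c (At x))" by (rule sum_mono) (simp add: w_def)
        also have "\<dots> = (\<Sum>q\<in>Q. \<Sum>x\<in>{x\<in>V'. At x = q}. W c (At x))"
          by (rule sum.group[symmetric]) (use V(1) finQ in \<open>auto simp: V'_def\<close>)
        also have "\<dots> = (\<Sum>q\<in>Q. W c q * real (card q))"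
        proof (rule sum.cong)
          fix q assume q: "q \<in> Q"
          have "{x\<in>V'. At x = q} = {x\<in>V. At x = q}" using q by (auto simp: V'_def)
          also have "\<dots> = q" using q Q_sub by (intro fibre) blast
          finally have eq: "{x\<in>V'. At x = q} = q" .
          have "(\<Sum>x\<in>{x\<in>V'. At x = q}. W c (At x)) = (\<Sum>x\<in>{x\<in>V'. At x = q}. W c q)"
            by (rule sum.cong) simp_all
          then show "(\<Sum>x\<in>{x\<in>V'. At x = q}. W c (At x)) = W c q * real (card q)"
            unfolding eq by simp
        qed simp
        also have "\<dots> \<le> t" by (rule Wt[OF c])
        finally show ?thesis .
      qed
    qed
    have "real (card (V - V')) \<le> z * real n"
    proof -
      have sub: "V - V' \<subseteq> \<Union>(At ` V - Q)" using At_self by (auto simp: V'_def)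
      have finU: "finite (\<Union>(At ` V - Q))" by (rule finite_subset[OF _ V(1)]) (use At_sub in blast)
      have "card (V - V') \<le> card (\<Union>(At ` V - Q))" by (rule card_mono[OF finU sub])
      also have "\<dots> \<le> (\<Sum>q\<in>At ` V - Q. card q)"
        using card_UN_le[of "At ` V - Q" "\<lambda>q. q"] finAt by simp
      finally have "real (card (V - V')) \<le> real (\<Sum>q\<in>At ` V - Q. card q)" by (simp only: of_nat_le_iff)
      also have "\<dots> = (\<Sum>q\<in>At ` V - Q. real (card q))" by simp
      also have "\<dots> \<le> (\<Sum>q\<in>At ` V - Q. \<kappa>0 * real n)" by (rule sum_mono) (auto simp: Q_def)
      also have "\<dots> = real (card (At ` V - Q)) * (\<kappa>0 * real n)" by simp
      also have "\<dots> \<le> L * (\<kappa>0 * real n)"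
      proof (rule mult_right_mono)
        have "card (At ` V - Q) \<le> card (At ` V)" by (rule card_mono[OF finAt]) blast
        then show "real (card (At ` V - Q)) \<le> L" using cardAt by linarith
        show "0 \<le> \<kappa>0 * real n" using \<kappa>0(1) by simp
      qed
      also have "\<dots> = z * real n" using \<kappa>0(2) by simp
      finally show ?thesis .
    qed
    moreover have "real (card V') = real n - real (card (V - V'))"
    proof -
      have "card (V - V') = card V - card V'" using V(1) V' by (meson card_Diff_subset finite_subset)
      moreover have "card V' \<le> card V" by (rule card_mono[OF V(1) V'])
      ultimately show ?thesis using V(3) by simp
    qed
    ultimately have card_V': "real (card V') \<ge> real n - z * real n" by linarith
    have "1 / real G * real n \<le> z * real n" using G(2) by (rule mult_right_mono) simp
    then have "78 * (t + real n / real G) \<le> 78 * (t + z * real n)" by simp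
    with bound[unfolded V(3) \<kappa>(2)] have "7 * (real (card V') - z * real n) \<le> 78 * (t + z * real n)"
      by (rule order_trans)
    moreover have "7 * (real n - 2 * (z * real n)) \<le> 7 * (real (card V') - z * real n)"
      using card_V' by (intro mult_left_mono) simp_all
    ultimately have t_ge: "7 * (real n - 2 * (z * real n)) \<le> 78 * (t + z * real n)"
      by (rule order_trans[rotated])
    have "t * (1 - z) = ?\<nu> + L ^ 4" using z(2) by (simp add: t_def)
    moreover have "78 * (t * (1 - z)) \<ge> (7 * (real n - 2 * (z * real n)) - 78 * (z * real n)) * (1 - z)"
    proof -
      have "(7 * (real n - 2 * (z * real n)) - 78 * (z * real n)) * (1 - z) \<le> (78 * t) * (1 - z)"
        by (rule mult_right_mono) (use t_ge z(2) in simp_all)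
      then show ?thesis by simp
    qed
    moreover have "(7 * (real n - 2 * (z * real n)) - 78 * (z * real n)) * (1 - z) \<ge> 7 * real n - 99 * (z * real n)"
    proof -
      have "(7 * (real n - 2 * (z * real n)) - 78 * (z * real n)) * (1 - z)
         = 7 * real n - 99 * (z * real n) + 92 * (z * z * real n)" by (simp add: algebra_simps)
      moreover have "0 \<le> z * z * real n" by simp
      ultimately show ?thesis by linarith
    qed
    moreover have "3 * z * real n \<le> \<zeta> * real n" using z(3) by (intro mult_right_mono) simp_all
    moreover have "0 \<le> z * real n" using z(1) by simp
    ultimately have "7 * real n - 78 * (\<zeta> * real n) \<le> 78 * ?\<nu>" using n_large(2) by linarith
    then show "(7 / 78 - \<zeta>) * real n \<le> ?\<nu>" by (simp add: algebra_simps)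
  qed
qed

lemma Rt_lower:
  assumes "\<zeta> > 0"
  shows "\<exists>n0. \<forall>n\<ge>n0. (7 / 78 - \<zeta>) * real n \<le> real (Rt 3 (double_star 2 3) (complete_graph n))"
proof -
  obtain n0 where n0: "\<forall>n\<ge>n0. \<forall>\<chi>\<in>edges (complete_graph n) \<rightarrow>\<^sub>E {1..3}.
    (7 / 78 - \<zeta>) * real n \<le> real (mono_packing_number 3 (double_star 2 3) (complete_graph n) \<chi>)"
    using mono_packing_number_lower[OF assms] ..
  have "(7 / 78 - \<zeta>) * real n \<le> real (Rt 3 (double_star 2 3) (complete_graph n))" if "n \<ge> n0" for n
  proof -
    have "Rt 3 (double_star 2 3) (complete_graph n)
       \<in> mono_packing_number 3 (double_star 2 3) (complete_graph n) ` (edges (complete_graph n) \<rightarrow>\<^sub>E {1..3})"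
      unfolding Rt_def
    proof (rule Min_in)
      show "finite (mono_packing_number 3 (double_star 2 3) (complete_graph n) ` (edges (complete_graph n) \<rightarrow>\<^sub>E {1..3}))"
        by (intro finite_imageI finite_colourings)
      show "mono_packing_number 3 (double_star 2 3) (complete_graph n) ` (edges (complete_graph n) \<rightarrow>\<^sub>E {1..3}) \<noteq> {}"
        using colourings_nonempty[of 3 n] by simp
    qed
    then show ?thesis using n0 that by auto
  qed
  then show ?thesis by blast
qed

section \<open>The limit\<close>

theorem theorem6p9:
  "\<exists>\<epsilon> :: nat \<Rightarrow> real. \<epsilon> \<in> o(\<lambda>_. 1) \<and>
     (\<forall>\<^sub>F n in sequentially.
        real (Rt 3 (double_star 2 3) (complete_graph n)) = (7 / 78 + \<epsilon> n) * real n)"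
proof -
  define \<rho> where "\<rho> = (\<lambda>n. real (Rt 3 (double_star 2 3) (complete_graph n)))"
  define \<epsilon> where "\<epsilon> = (\<lambda>n. \<rho> n / real n - 7 / 78)"
  have "\<epsilon> \<longlonglongrightarrow> 0"
  proof (rule LIMSEQ_I)
    fix r :: real assume r: "r > 0"
    obtain n0 where n0: "\<forall>n\<ge>n0. (7 / 78 - r / 2) * real n \<le> \<rho> n"
      using Rt_lower[of "r / 2"] r unfolding \<rho>_def by auto
    define n1 where "n1 = n0 + nat \<lceil>1 / r\<rceil> + 1"
    have "norm (\<epsilon> n - 0) < r" if n: "n \<ge> n1" for n
    proof -
      have "n \<ge> n0" "1 / r < real n" "real n > 0" using n unfolding n1_def by linarith+
      have "1 < r * real n" using \<open>1 / r < real n\<close> r by (simp add: pos_divide_less_eq mult.commute)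
      have "\<rho> n \<le> 7 / 78 * real n + 1" unfolding \<rho>_def by (rule Rt_upper)
      then have up: "\<rho> n < (7 / 78 + r) * real n" using \<open>1 < r * real n\<close> by (simp add: algebra_simps)
      have "0 < r * real n" using \<open>1 < r * real n\<close> by simp
      moreover have "(7 / 78 - r / 2) * real n \<le> \<rho> n" using n0 \<open>n \<ge> n0\<close> by blast
      ultimately have low: "(7 / 78 - r) * real n < \<rho> n" by (simp add: algebra_simps)
      have "\<rho> n / real n < 7 / 78 + r" using up \<open>real n > 0\<close> by (simp only: pos_divide_less_eq)
      moreover have "7 / 78 - r < \<rho> n / real n" using low \<open>real n > 0\<close> by (simp only: pos_less_divide_eq)
      ultimately show ?thesis unfolding \<epsilon>_def by (simp add: abs_less_iff)
    qed
    then show "\<exists>no. \<forall>n\<ge>no. norm (\<epsilon> n - 0) < r" by blast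
  qed
  then have "\<epsilon> \<in> o(\<lambda>_. 1)" by (intro smalloI_tendsto) simp_all
  moreover have "\<forall>\<^sub>F n in sequentially. \<rho> n = (7 / 78 + \<epsilon> n) * real n"
    using eventually_gt_at_top[of 0] by eventually_elim (simp add: \<epsilon>_def)
  ultimately show ?thesis unfolding \<rho>_def by blast
qed

end
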